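(* There exist smooth compactly supported magnetic potentials $A\in C^\infty_0(\mathbb{R}^3,\mathbb{R}^3)$, with magnetic field $\operatorname{curl}A$ not identically zero, such that for every $t\in\mathbb{R}$ the Weyl-Dirac operator $\mathcal{D}_{tA}$ does not have a zero mode.
   Context: For a smooth vector field (magnetic potential) $A:\mathbb{R}^3\to\mathbb{R}^3$ the Weyl-Dirac operator is $\mathcal{D}_A=\sigma\cdot(-\mathrm{i}\nabla-A)=\sum_{j=1}^3\sigma_j(-\mathrm{i}\nabla_j-A_j)$, where $\sigma_1,\sigma_2,\sigma_3$ are the Pauli matrices. It acts on $\mathbb{C}^2$-valued functions on $\mathbb{R}^3$. Defined initially on $C^\infty_0(\mathbb{R}^3,\mathbb{C}^2)$ it has a unique self-adjoint extension in $L^2(\mathbb{R}^3,\mathbb{C}^2)$, which is also denoted $\mathcal{D}_A$. A zero mode is a non-zero $\psi\in L^2(\mathbb{R}^3,\mathbb{C}^2)$ in the domain of this extension with $\mathcal{D}_A\psi=0$. *)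

theory Defs
  imports "HOL-Analysis.Analysis"
begin

section \<open>Smooth functions, compact support and curl on three-space\<close>

definition partial_deriv :: "3 \<Rightarrow> (real^3 \<Rightarrow> 'b::real_normed_vector) \<Rightarrow> real^3 \<Rightarrow> 'b" where
  "partial_deriv j f x = frechet_derivative f (at x) (axis j 1)"

primrec C_k :: "nat \<Rightarrow> (real^3 \<Rightarrow> 'b::real_normed_vector) \<Rightarrow> bool" where
  "C_k 0 f \<longleftrightarrow> continuous_on UNIV f"
| "C_k (Suc k) f \<longleftrightarrow> (\<forall>x. f differentiable (at x)) \<and> (\<forall>j. C_k k (partial_deriv j f))"

definition smooth :: "(real^3 \<Rightarrow> 'b::real_normed_vector) \<Rightarrow> bool" where
  "smooth f \<longleftrightarrow> (\<forall>k. C_k k f)"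

definition Cc_infinity :: "(real^3 \<Rightarrow> 'b::real_normed_vector) set" where
  "Cc_infinity = {f. smooth f \<and> compact (closure {x. f x \<noteq> 0})}"

definition curl :: "(real^3 \<Rightarrow> real^3) \<Rightarrow> real^3 \<Rightarrow> real^3" where
  "curl A x = vector
     [partial_deriv 2 (\<lambda>y. A y $ 3) x - partial_deriv 3 (\<lambda>y. A y $ 2) x,
      partial_deriv 3 (\<lambda>y. A y $ 1) x - partial_deriv 1 (\<lambda>y. A y $ 3) x,
      partial_deriv 1 (\<lambda>y. A y $ 2) x - partial_deriv 2 (\<lambda>y. A y $ 1) x]"

section \<open>Square-integrable spinor fields\<close>

type_synonym spinor_field = "real^3 \<Rightarrow> complex^2"

text \<open>Elements of the Hilbert space are represented by Borel functions; functions that agree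
  almost everywhere are not identified.\<close>

definition L2 :: "spinor_field set" where
  "L2 = {\<psi>. \<psi> \<in> borel_measurable lborel \<and> integrable lborel (\<lambda>x. (norm (\<psi> x))\<^sup>2)}"

definition L2_inner :: "spinor_field \<Rightarrow> spinor_field \<Rightarrow> complex" where
  "L2_inner \<phi> \<psi> = (LINT x|lborel. (\<Sum>i\<in>UNIV. cnj (\<phi> x $ i) * \<psi> x $ i))"

definition L2_norm :: "spinor_field \<Rightarrow> real" where
  "L2_norm \<psi> = sqrt (LINT x|lborel. (norm (\<psi> x))\<^sup>2)"

section \<open>Unbounded operators\<close>

text \<open>An operator is given by its graph, a set of pairs of representatives. The adjoint is then
  automatically closed under changing either component on a null set, and it is single-valued
  up to null sets when the operator is densely defined. In particular both properties, and
  linearity, hold for every self-adjoint \<open>T\<close> below.\<close>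

type_synonym L2_operator = "(spinor_field \<times> spinor_field) set"

definition densely_defined :: "L2_operator \<Rightarrow> bool" where
  "densely_defined T \<longleftrightarrow>
     Domain T \<subseteq> L2 \<and> (\<forall>u\<in>L2. \<forall>\<epsilon>>0. \<exists>\<phi>\<in>Domain T. L2_norm (\<lambda>x. u x - \<phi> x) < \<epsilon>)"

definition op_adjoint :: "L2_operator \<Rightarrow> L2_operator" where
  "op_adjoint T = {(u, v). u \<in> L2 \<and> v \<in> L2 \<and>
     (\<forall>(f, g)\<in>T. L2_inner u g = L2_inner v f)}"

definition self_adjoint :: "L2_operator \<Rightarrow> bool" where
  "self_adjoint T \<longleftrightarrow> densely_defined T \<and> op_adjoint T = T"

section \<open>The Weyl-Dirac operator\<close>

definition pauli :: "3 \<Rightarrow> complex^2^2" where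
  "pauli j =
     (if j = 1 then vector [vector [0, 1], vector [1, 0]]
      else if j = 2 then vector [vector [0, - \<i>], vector [\<i>, 0]]
      else vector [vector [1, 0], vector [0, - 1]])"

definition weyl_dirac_expr :: "(real^3 \<Rightarrow> real^3) \<Rightarrow> spinor_field \<Rightarrow> spinor_field" where
  "weyl_dirac_expr A \<psi> x =
     (\<Sum>j\<in>UNIV. pauli j *v ((- \<i>) *s partial_deriv j \<psi> x - complex_of_real (A x $ j) *s \<psi> x))"

definition weyl_dirac_min :: "(real^3 \<Rightarrow> real^3) \<Rightarrow> L2_operator" where
  "weyl_dirac_min A = {(\<phi>, weyl_dirac_expr A \<phi>) | \<phi>. \<phi> \<in> Cc_infinity}"

text \<open>For smooth \<open>A\<close> there is exactly one self-adjoint extension, so the description below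
  is proper.\<close>

definition weyl_dirac :: "(real^3 \<Rightarrow> real^3) \<Rightarrow> L2_operator" where
  "weyl_dirac A = (THE T. self_adjoint T \<and> weyl_dirac_min A \<subseteq> T)"

definition zero_mode :: "L2_operator \<Rightarrow> spinor_field \<Rightarrow> bool" where
  "zero_mode T \<psi> \<longleftrightarrow> \<psi> \<in> L2 \<and> \<not> (AE x in lborel. \<psi> x = 0) \<and> (\<psi>, \<lambda>x. 0) \<in> T"

end

theory Submission
  imports Defs
begin

text \<open>
  The potentials used here are \<open>A = a e\<^sub>3\<close> with \<open>a\<close> a radial bump function. They are invariant under
  rotations about the third axis and are everywhere orthogonal to the rotation field
  \<open>X = (- x\<^sub>2, x\<^sub>1, 0)\<close>; both properties survive multiplication by \<open>t\<close>, so it is enough to exclude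
  zero modes for one potential with these two properties.

  Let \<open>r\<close> be the distance to the axis, \<open>S = \<sigma> \<cdot> X / r\<close> and \<open>J = L\<^sub>3 + \<sigma>\<^sub>3 / 2\<close>, the generator of
  the rotations of spinor fields. As \<open>A\<close> is orthogonal to \<open>X\<close>, the Clifford relations give
  \<open>D S + S D = (2 / r) J\<close>, without any trace of \<open>A\<close>. Since \<open>D\<close> commutes with the rotations
  \<open>U\<^sub>\<theta> = exp (- i \<theta> J)\<close>, a test field \<open>u\<close> satisfies
  \<open>2 \<langle>u / r, J U\<^sub>\<theta> u\<rangle> = \<langle>D u, S U\<^sub>\<theta> u\<rangle> + \<langle>S u, U\<^sub>\<theta> D u\<rangle>\<close>.
  The right-hand side is at most a multiple of \<open>\<parallel>u\<parallel> \<parallel>D u\<parallel>\<close>, and the left-hand side is, up to a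
  constant factor, the derivative of \<open>F(\<theta>) = \<langle>u / r, U\<^sub>\<theta> u\<rangle>\<close>. A full turn changes the sign of a spinor,
  hence \<open>F(2 \<pi>) = - F(0)\<close>, and integration over a full turn bounds \<open>F(0)\<close>, the integral of
  \<open>\<bar>u\<bar>\<^sup>2 / r\<close>, by a multiple of \<open>\<parallel>u\<parallel> \<parallel>D u\<parallel>\<close>. The smaller weight
  \<open>1 / sqrt (r\<^sup>2 + 1)\<close> is enough for the conclusion and is the one in \<open>axial_lower_bound\<close>. In the proof the
  singular factor \<open>1 / r\<close> is replaced by the reciprocal of \<open>sqrt (r\<^sup>2 + \<epsilon>\<^sup>2)\<close>, which costs an error term that vanishes with \<open>\<epsilon>\<close>
  (\<open>anticommutator\<close>, \<open>excess_integral_small\<close>).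

  The estimate holds for smooth compactly supported fields. It reaches zero modes because every pair
  in the adjoint of the minimal operator is a limit, in the graph norm, of such fields
  (\<open>graph_approximation\<close>): mollification turns the weak equation into a pointwise one, and slowly
  varying cutoffs restore the compact support. The same density statement shows that the adjoint is
  the unique self-adjoint extension (\<open>weyl_dirac_eq_adjoint\<close>), so that it is the operator that zero
  modes refer to. A zero mode is therefore a limit of fields \<open>u\<close> with \<open>D u\<close> tending to zero, and the
  estimate forces the limit to vanish.
\<close>

section \<open>Calculus of continuously differentiable functions\<close>

lemma partial_deriv_eq:
  assumes "(f has_derivative f') (at x)"
  shows "partial_deriv j f x = f' (axis j 1)"
  using frechet_derivative_at[OF assms] by (simp add: partial_deriv_def)

lemma vec3_expansion: "(h::real^3) = (\<Sum>j\<in>UNIV. (h $ j) *\<^sub>R axis j 1)"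
  by (simp add: basis_expansion scalar_mult_eq_scaleR[symmetric])

lemma has_derivative_partial:
  fixes f :: "real^3 \<Rightarrow> 'b::real_normed_vector"
  assumes "f differentiable (at x)"
  shows "(f has_derivative (\<lambda>h. \<Sum>j\<in>UNIV. (h $ j) *\<^sub>R partial_deriv j f x)) (at x)"
proof -
  have d: "(f has_derivative frechet_derivative f (at x)) (at x)"
    using assms frechet_derivative_works by blast
  then have l: "linear (frechet_derivative f (at x))"
    using has_derivative_linear by blast
  have "frechet_derivative f (at x) h = (\<Sum>j\<in>UNIV. (h $ j) *\<^sub>R partial_deriv j f x)" for h
  proof -
    have "frechet_derivative f (at x) h
        = frechet_derivative f (at x) (\<Sum>j\<in>UNIV. (h $ j) *\<^sub>R axis j 1)"
      by (subst vec3_expansion) simp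
    also have "\<dots> = (\<Sum>j\<in>UNIV. (h $ j) *\<^sub>R partial_deriv j f x)"
      by (simp add: linear_sum[OF l] linear_scale[OF l] partial_deriv_def)
    finally show ?thesis .
  qed
  then have "frechet_derivative f (at x) = (\<lambda>h. \<Sum>j\<in>UNIV. (h $ j) *\<^sub>R partial_deriv j f x)" by auto
  with d show ?thesis by simp
qed

lemma C_k_antimono_Suc: "C_k (Suc k) f \<Longrightarrow> C_k k f"
proof (induction k arbitrary: f)
  case 0
  then show ?case
    by (auto simp: continuous_on_eq_continuous_at intro: differentiable_imp_continuous_within)
qed (metis C_k.simps(2))

lemma C_k_continuous: "C_k k f \<Longrightarrow> continuous_on UNIV f"
  by (induction k) (use C_k_antimono_Suc in auto)

lemma smooth_C_k: "smooth f \<Longrightarrow> C_k k f"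
  by (simp add: smooth_def)

lemma smooth_partial: "smooth f \<Longrightarrow> smooth (partial_deriv j f)"
  unfolding smooth_def by (metis C_k.simps(2))

lemma smooth_differentiable: "smooth f \<Longrightarrow> f differentiable (at x)"
  unfolding smooth_def by (metis C_k.simps(2))

lemma smooth_continuous: "smooth f \<Longrightarrow> continuous_on UNIV f"
  using C_k_continuous smooth_C_k by blast

text \<open>Smoothness is proved without computing higher derivatives: it is enough to exhibit a class of
differentiable functions that is closed under partial differentiation.\<close>

lemma smooth_coinduct:
  assumes "P f"
    and step: "\<And>f. P f \<Longrightarrow> (\<forall>x. f differentiable (at x)) \<and> (\<forall>j. P (partial_deriv j f))"
  shows "smooth f"
proof -
  have "C_k k f" if "P f" for k f
    using that
  proof (induction k arbitrary: f)
    case 0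
    then show ?case using step[of f]
      by (auto simp: continuous_on_eq_continuous_at intro: differentiable_imp_continuous_within)
  next
    case (Suc k)
    then show ?case using step[of f] by simp
  qed
  with assms(1) show ?thesis by (simp add: smooth_def)
qed

lemma partial_deriv_const: "partial_deriv j (\<lambda>x. c) = (\<lambda>x. 0)"
  by (intro ext) (simp add: partial_deriv_eq[OF has_derivative_const])

lemma C_k_const: "C_k k (\<lambda>x. c)"
  by (induction k arbitrary: c) (auto simp: partial_deriv_const)

lemma partial_deriv_bilinear:
  assumes "bounded_bilinear prd" "f differentiable (at x)" "g differentiable (at x)"
  shows "partial_deriv j (\<lambda>x. prd (f x) (g x)) x
    = prd (f x) (partial_deriv j g x) + prd (partial_deriv j f x) (g x)"
  using partial_deriv_eq[OF bounded_bilinear.FDERIV[OF assms(1)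
        assms(2)[unfolded frechet_derivative_works] assms(3)[unfolded frechet_derivative_works]]]
  by (simp add: partial_deriv_def)

lemma partial_deriv_linear:
  assumes "bounded_linear L" "f differentiable (at x)"
  shows "partial_deriv j (\<lambda>x. L (f x)) x = L (partial_deriv j f x)"
  using partial_deriv_eq[OF bounded_linear.has_derivative[OF assms(1)
        assms(2)[unfolded frechet_derivative_works]]]
  by (simp add: partial_deriv_def)

lemma partial_deriv_add:
  assumes "f differentiable (at x)" "g differentiable (at x)"
  shows "partial_deriv j (\<lambda>x. f x + g x) x = partial_deriv j f x + partial_deriv j g x"
  using partial_deriv_eq[OF has_derivative_add[OF assms(1)[unfolded frechet_derivative_works]
        assms(2)[unfolded frechet_derivative_works]]]
  by (simp add: partial_deriv_def)

lemma C_k_add: "C_k k f \<Longrightarrow> C_k k g \<Longrightarrow> C_k k (\<lambda>x. f x + g x)"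
proof (induction k arbitrary: f g)
  case 0
  then show ?case by (auto intro: continuous_intros)
next
  case (Suc k)
  then have "partial_deriv j (\<lambda>x. f x + g x) = (\<lambda>x. partial_deriv j f x + partial_deriv j g x)" for j
    by (intro ext partial_deriv_add) auto
  with Suc show ?case by (auto intro!: differentiable_add)
qed

lemma C_k_linear: "bounded_linear L \<Longrightarrow> C_k k f \<Longrightarrow> C_k k (\<lambda>x. L (f x))"
proof (induction k arbitrary: f)
  case 0
  then show ?case by (auto intro: bounded_linear.continuous_on)
next
  case (Suc k)
  then have "partial_deriv j (\<lambda>x. L (f x)) = (\<lambda>x. L (partial_deriv j f x))" for j
    by (intro ext partial_deriv_linear) auto
  moreover have "(\<lambda>x. L (f x)) differentiable (at x)" for x
    using Suc bounded_linear.has_derivative[OF \<open>bounded_linear L\<close>, of f _ "at x"]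
    unfolding differentiable_def C_k.simps by blast
  ultimately show ?case using Suc by auto
qed

lemma C_k_bilinear: 
  assumes bb: "bounded_bilinear prd"
  shows "C_k k f \<Longrightarrow> C_k k g \<Longrightarrow> C_k k (\<lambda>x. prd (f x) (g x))"
proof (induction k arbitrary: f g)
  case 0
  then show ?case by (auto intro: bounded_bilinear.continuous_on[OF bb])
next
  case (Suc k)
  then have "partial_deriv j (\<lambda>x. prd (f x) (g x))
      = (\<lambda>x. prd (f x) (partial_deriv j g x) + prd (partial_deriv j f x) (g x))" for j
    by (intro ext partial_deriv_bilinear[OF bb]) auto
  moreover have "(\<lambda>x. prd (f x) (g x)) differentiable (at x)" for x
    using Suc bounded_bilinear.FDERIV[OF bb, of f _ x UNIV g]
    unfolding differentiable_def C_k.simps by blast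
  moreover have "C_k k f" "C_k k g" using Suc.prems C_k_antimono_Suc by blast+
  ultimately show ?case using Suc by (auto intro!: C_k_add)
qed

lemma C_k_nth: "C_k k (\<lambda>x::real^3. x $ i)"
proof (cases k)
  case (Suc m)
  have d: "((\<lambda>x::real^3. x $ i) has_derivative (\<lambda>x. x $ i)) (at x)" for x
    by (intro bounded_linear_imp_has_derivative bounded_linear_vec_nth)
  have "partial_deriv j (\<lambda>x::real^3. x $ i) = (\<lambda>x. axis j 1 $ i)" for j
    by (intro ext) (rule partial_deriv_eq[OF d])
  moreover have "(\<lambda>x::real^3. x $ i) differentiable (at x)" for x
    using d differentiable_def by blast
  ultimately show ?thesis using Suc by (auto intro: C_k_const)
qed (auto intro: continuous_intros)

lemma bounded_linear_axis: "bounded_linear (\<lambda>c::'a::real_normed_vector. axis i c :: 'a^'n)"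
proof
  show "axis i (x + y) = (axis i x + axis i y :: 'a^'n)" for x y :: 'a
    by (simp add: vec_eq_iff axis_def)
  show "axis i (r *\<^sub>R x) = (r *\<^sub>R axis i x :: 'a^'n)" for r and x :: 'a
    by (simp add: vec_eq_iff axis_def)
  have "norm (axis i x :: 'a^'n) \<le> norm x * 1" for x :: 'a
  proof -
    have "norm (axis i x :: 'a^'n) \<le> (\<Sum>j\<in>UNIV. norm ((axis i x :: 'a^'n) $ j))"
      unfolding norm_vec_def by (intro L2_set_le_sum) simp
    also have "\<dots> = (\<Sum>j\<in>(UNIV::'n set). if j = i then norm x else 0)"
      by (intro sum.cong) (auto simp: axis_def)
    finally show ?thesis by simp
  qed
  then show "\<exists>K. \<forall>x::'a. norm (axis i x :: 'a^'n) \<le> norm x * K" by blast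
qed

text \<open>In finite dimension a compact support is a bounded one, and the radius is what the later estimates
use.\<close>

lemma compact_support_iff:
  fixes f :: "real^3 \<Rightarrow> 'b::real_normed_vector"
  shows "compact (closure {x. f x \<noteq> 0}) \<longleftrightarrow> (\<exists>R. \<forall>x. norm x > R \<longrightarrow> f x = 0)"
  unfolding compact_closure bounded_iff by (auto simp: not_le[symmetric])

lemma Cc_infinityI: "smooth f \<Longrightarrow> (\<And>x. norm x > R \<Longrightarrow> f x = 0) \<Longrightarrow> f \<in> Cc_infinity"
  unfolding Cc_infinity_def compact_support_iff by auto

lemma Cc_infinityE:
  assumes "f \<in> Cc_infinity"
  obtains R where "smooth f" "R > 0" "\<And>x. norm x > R \<Longrightarrow> f x = 0"
proof -
  obtain R where R: "\<And>x. norm x > R \<Longrightarrow> f x = 0"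
    using assms unfolding Cc_infinity_def compact_support_iff by auto
  show ?thesis
    by (rule that[of "max R 1"]) (use assms R in \<open>auto simp: Cc_infinity_def\<close>)
qed

lemma partial_deriv_zero_outside:
  assumes "\<And>x. norm x > R \<Longrightarrow> f x = 0" "norm x > R"
  shows "partial_deriv j f x = 0"
proof -
  have "((\<lambda>x. 0) has_derivative (\<lambda>h. 0)) (at x)" by simp
  then have "(f has_derivative (\<lambda>h. 0)) (at x)"
  proof (rule has_derivative_transform_within_open)
    show "open {x::real^3. norm x > R}" by (auto intro: open_Collect_less continuous_intros)
  qed (use assms in auto)
  then show ?thesis by (simp add: partial_deriv_eq)
qed

section \<open>Bump functions\<close>

text \<open>The powers of \<open>s\<close> in the denominator make the family of all profiles closed, up to linear
combinations, under differentiation; \<open>k = 0\<close> is the classical smooth function that is flat at zero.\<close>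

definition bump_profile :: "nat \<Rightarrow> real \<Rightarrow> real" where
  "bump_profile k s = (if s > 0 then exp (- (1 / s)) / s ^ k else 0)"

lemma bump_profile_nonneg: "bump_profile k s \<ge> 0"
  by (simp add: bump_profile_def)

lemma bump_profile_pos: "s > 0 \<Longrightarrow> bump_profile k s > 0"
  by (simp add: bump_profile_def)

lemma bump_profile_nonpos: "s \<le> 0 \<Longrightarrow> bump_profile k s = 0"
  by (simp add: bump_profile_def)

lemma power_le_fact_exp:
  assumes "t \<ge> (0::real)"
  shows "t ^ n \<le> fact n * exp t"
proof -
  have "(\<Sum>i\<in>{n}. t ^ i /\<^sub>R fact i) \<le> exp t"
    unfolding exp_def using assms by (intro sum_le_suminf summable_exp_generic) auto
  then show ?thesis by (simp add: field_simps)
qed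

lemma bump_profile_le_fact: "bump_profile k s \<le> fact k"
  using power_le_fact_exp[of "1/s" k]
  by (auto simp: bump_profile_def exp_minus field_simps power_one_over)

text \<open>A profile is \<open>s\<^sup>2\<close> times the profile with two more powers of \<open>s\<close> in the denominator, and all of these
are bounded because the exponential series dominates each of its terms.\<close>

lemma bump_profile_quadratic_bound: "bump_profile k s \<le> fact (k + 2) * s\<^sup>2"
proof (cases "s > 0")
  case True
  then have "bump_profile k s = bump_profile (k + 2) s * s\<^sup>2"
    by (simp add: bump_profile_def power2_eq_square)
  then show ?thesis
    using bump_profile_le_fact[of "k + 2" s] by (simp only: mult_right_mono zero_le_power2)
qed (auto simp: bump_profile_def)

text \<open>At the gluing point the quadratic bound forces the derivative to vanish.\<close>

lemma bump_profile_deriv: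
  "(bump_profile k has_real_derivative bump_profile (k + 2) s - real k * bump_profile (k + 1) s) (at s)"
proof -
  consider "s > 0" | "s < 0" | "s = 0" by linarith
  then show ?thesis
  proof cases
    case 1
    have [derivative_intros]: "((\<lambda>s. s ^ k) has_real_derivative real k * s ^ k / s) (at s)"
      using 1 DERIV_pow[of k s] by (cases k) auto
    have "((\<lambda>s. exp (- (1 / s)) / s ^ k) has_real_derivative
       bump_profile (k + 2) s - real k * bump_profile (k + 1) s) (at s)"
      using 1 by (auto intro!: derivative_eq_intros simp: bump_profile_def field_simps power2_eq_square)
    then show ?thesis
      by (rule has_field_derivative_transform_within_open[of _ _ _ "{0<..}"])
        (use 1 in \<open>auto simp: bump_profile_def\<close>)
  next
    case 2
    have "((\<lambda>s. 0) has_real_derivative 0) (at s)" by simp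
    then have "(bump_profile k has_real_derivative 0) (at s)"
      by (rule has_field_derivative_transform_within_open[of _ _ _ "{..<0}"])
        (use 2 in \<open>auto simp: bump_profile_def\<close>)
    then show ?thesis using 2 by (simp add: bump_profile_def)
  next
    case 3
    have "((\<lambda>h. bump_profile k h / h) \<longlongrightarrow> 0) (at 0)"
    proof (rule Lim_null_comparison)
      show "\<forall>\<^sub>F h in at 0. norm (bump_profile k h / h) \<le> fact (k + 2) * \<bar>h\<bar>"
      proof (intro always_eventually allI)
        fix h :: real
        have "\<bar>bump_profile k h\<bar> \<le> (fact (k + 2) * \<bar>h\<bar>) * \<bar>h\<bar>"
          using bump_profile_quadratic_bound[of k h] bump_profile_nonneg[of k h]
          by (simp add: power2_eq_square abs_mult_self_eq mult.assoc del: fact_Suc)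
        then show "norm (bump_profile k h / h) \<le> fact (k + 2) * \<bar>h\<bar>"
          by (cases "h = 0") (simp_all add: pos_divide_le_eq del: fact_Suc)
      qed
      show "((\<lambda>h::real. fact (k + 2) * \<bar>h\<bar>) \<longlongrightarrow> 0) (at 0)"
        by (auto intro!: tendsto_eq_intros)
    qed
    then show ?thesis using 3 by (simp add: DERIV_def bump_profile_def)
  qed
qed

text \<open>For \<open>c > 0\<close> and \<open>d > 0\<close> this is positive exactly in the open ball of radius \<open>sqrt (c / d)\<close>. One family
serves as mollifier (small \<open>c\<close>), as cutoff (small \<open>d\<close>) and as the potential.\<close>

definition bump :: "real \<Rightarrow> real \<Rightarrow> real^3 \<Rightarrow> real" where
  "bump c d x = bump_profile 0 (c - d * (x \<bullet> x))"

text \<open>The partial derivatives of a bump function leave the family of bump functions, but they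
  stay in the algebra generated by all profiles and the coordinates.\<close>

inductive bump_algebra :: "real \<Rightarrow> real \<Rightarrow> (real^3 \<Rightarrow> real) \<Rightarrow> bool" for c d where
  profile: "bump_algebra c d (\<lambda>x. bump_profile k (c - d * (x \<bullet> x)))"
| coord: "bump_algebra c d (\<lambda>x. x $ j)"
| const: "bump_algebra c d (\<lambda>x. a)"
| add: "bump_algebra c d f \<Longrightarrow> bump_algebra c d g \<Longrightarrow> bump_algebra c d (\<lambda>x. f x + g x)"
| mult: "bump_algebra c d f \<Longrightarrow> bump_algebra c d g \<Longrightarrow> bump_algebra c d (\<lambda>x. f x * g x)"

lemma has_derivative_profile:
  "((\<lambda>x::real^3. bump_profile k (c - d * (x \<bullet> x))) has_derivative
     (\<lambda>h. (bump_profile (k + 2) (c - d * (x \<bullet> x)) - real k * bump_profile (k + 1) (c - d * (x \<bullet> x)))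
        * (- 2 * d * (x \<bullet> h)))) (at x)"
proof -
  have "((\<lambda>x::real^3. c - d * (x \<bullet> x)) has_derivative (\<lambda>h. - 2 * d * (x \<bullet> h))) (at x)"
    by (auto intro!: derivative_eq_intros simp: inner_commute algebra_simps)
  from has_derivative_compose[OF this bump_profile_deriv[unfolded has_field_derivative_def]]
  show ?thesis by simp
qed

lemma bump_algebra_partial:
  assumes "bump_algebra c d f"
  shows "(\<forall>x. f differentiable (at x)) \<and> (\<forall>j. bump_algebra c d (partial_deriv j f))"
  using assms
proof induction
  case (profile k)
  have "partial_deriv j (\<lambda>x. bump_profile k (c - d * (x \<bullet> x)))
    = (\<lambda>x. (bump_profile (k + 2) (c - d * (x \<bullet> x)) + (- real k) * bump_profile (k + 1) (c - d * (x \<bullet> x)))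
        * ((- 2 * d) * x $ j))" for j
    by (intro ext) (simp add: partial_deriv_eq[OF has_derivative_profile] inner_axis)
  then have "bump_algebra c d (partial_deriv j (\<lambda>x. bump_profile k (c - d * (x \<bullet> x))))" for j
    by (simp only:) (intro bump_algebra.intros)
  then show ?case using has_derivative_profile differentiable_def by blast
next
  case (coord i)
  have "C_k 1 (\<lambda>x::real^3. x $ i)" by (rule C_k_nth)
  moreover have "partial_deriv j (\<lambda>x::real^3. x $ i) = (\<lambda>x. axis j 1 $ i)" for j
    by (intro ext partial_deriv_eq bounded_linear_imp_has_derivative bounded_linear_vec_nth)
  ultimately show ?case by (auto intro: bump_algebra.const)
next
  case (const a)
  then show ?case by (auto simp: partial_deriv_const intro: bump_algebra.const)
next
  case (add f g)
  then have "partial_deriv j (\<lambda>x. f x + g x) = (\<lambda>x. partial_deriv j f x + partial_deriv j g x)" for j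
    by (intro ext partial_deriv_add) auto
  with add show ?case by (auto intro!: bump_algebra.add differentiable_add)
next
  case (mult f g)
  then have "partial_deriv j (\<lambda>x. f x * g x) = (\<lambda>x. f x * partial_deriv j g x + partial_deriv j f x * g x)" for j
    by (intro ext partial_deriv_bilinear[OF bounded_bilinear_mult]) auto
  with mult show ?case by (auto intro!: bump_algebra.intros differentiable_mult)
qed

lemma smooth_bump: "smooth (bump c d)"
proof (rule smooth_coinduct)
  show "bump_algebra c d (bump c d)"
    unfolding bump_def[abs_def] by (rule bump_algebra.profile)
qed (rule bump_algebra_partial)

lemma bump_nonneg: "bump c d x \<ge> 0"
  by (simp add: bump_def bump_profile_nonneg)

lemma bump_outside:
  assumes "R \<ge> 0" "c \<le> d * R\<^sup>2" "d > 0" "norm x > R"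
  shows "bump c d x = 0"
proof -
  have "R\<^sup>2 \<le> (norm x)\<^sup>2" using assms by (intro power_mono) auto
  then have "d * R\<^sup>2 \<le> d * (x \<bullet> x)"
    using assms by (simp add: power2_norm_eq_inner)
  then have "c \<le> d * (x \<bullet> x)" using assms by linarith
  then show ?thesis by (simp add: bump_def bump_profile_nonpos)
qed

lemma bump_Cc_infinity: "d > 0 \<Longrightarrow> bump c d \<in> Cc_infinity"
proof (rule Cc_infinityI[OF smooth_bump])
  fix x :: "real^3" assume d: "d > 0" and x: "norm x > max 1 (c / d)"
  show "bump c d x = 0"
  proof (rule bump_outside[OF _ _ d x])
    have "c / d \<le> max 1 (c / d)" by simp
    also have "\<dots> \<le> (max 1 (c / d))\<^sup>2"
      by (rule self_le_power) auto
    finally show "c \<le> d * (max 1 (c / d))\<^sup>2" using d by (simp add: field_simps)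
  qed auto
qed

lemma partial_deriv_bump:
  "partial_deriv j (bump c d) x = bump_profile 2 (c - d * (x \<bullet> x)) * (- 2 * d * x $ j)"
  using partial_deriv_eq[OF has_derivative_profile[of 0 c d x]]
  by (simp add: bump_def[abs_def] inner_axis numeral_2_eq_2)

section \<open>Products of smooth functions\<close>

lemma smooth_bilinear: "bounded_bilinear prd \<Longrightarrow> smooth f \<Longrightarrow> smooth g \<Longrightarrow> smooth (\<lambda>x. prd (f x) (g x))"
  by (simp add: smooth_def C_k_bilinear)

lemma smooth_linear: "bounded_linear L \<Longrightarrow> smooth f \<Longrightarrow> smooth (\<lambda>x. L (f x))"
  by (simp add: smooth_def C_k_linear)

lemma Cc_infinity_scaleR_right:
  assumes "smooth \<eta>" "\<phi> \<in> Cc_infinity"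
  shows "(\<lambda>x. \<eta> x *\<^sub>R \<phi> x) \<in> Cc_infinity"
proof -
  obtain R where R: "smooth \<phi>" "\<And>x. norm x > R \<Longrightarrow> \<phi> x = 0"
    using assms(2) Cc_infinityE by blast
  show ?thesis
    by (rule Cc_infinityI[where R = R, OF smooth_bilinear[OF bounded_bilinear_scaleR assms(1) R(1)]])
      (simp add: R(2))
qed

lemma Cc_infinity_scaleR_left:
  assumes "\<eta> \<in> Cc_infinity" "smooth \<phi>"
  shows "(\<lambda>x. \<eta> x *\<^sub>R \<phi> x) \<in> Cc_infinity"
proof -
  obtain R where R: "smooth \<eta>" "\<And>x. norm x > R \<Longrightarrow> \<eta> x = 0"
    using assms(1) Cc_infinityE by blast
  show ?thesis
    by (rule Cc_infinityI[where R = R, OF smooth_bilinear[OF bounded_bilinear_scaleR R(1) assms(2)]])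
      (simp add: R(2))
qed

section \<open>Integration by parts\<close>

lemma integrable_compact_support:
  fixes f :: "real^3 \<Rightarrow> 'b::euclidean_space"
  assumes "continuous_on UNIV f" "\<And>x. norm x > R \<Longrightarrow> f x = 0"
  shows "integrable lborel f"
proof -
  have "integrable lborel (\<lambda>x. indicator (cball 0 R) x *\<^sub>R f x)"
    by (rule borel_integrable_compact) (use assms in \<open>auto intro: continuous_on_subset\<close>)
  moreover have "indicator (cball 0 R) x *\<^sub>R f x = f x" for x
    using assms(2)[of x] by (auto simp: indicator_def)
  ultimately show ?thesis by simp
qed

lemma compact_support_bounded:
  fixes f :: "real^3 \<Rightarrow> 'b::real_normed_vector"
  assumes "continuous_on UNIV f" "\<And>x. norm x > R \<Longrightarrow> f x = 0"
  obtains B where "B > 0" "\<And>x. norm (f x) \<le> B"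
proof -
  have "compact (f ` cball 0 R)"
    by (rule compact_continuous_image) (use assms in \<open>auto intro: continuous_on_subset\<close>)
  then obtain B where "\<forall>x\<in>cball 0 R. norm (f x) \<le> B"
    by (auto dest!: compact_imp_bounded simp: bounded_iff)
  then have B: "\<And>x. norm x \<le> R \<Longrightarrow> norm (f x) \<le> B" by auto
  have "norm (f x) \<le> max B 1" for x
    using B[of x] assms(2)[of x] by (cases "norm x \<le> R") (auto simp: le_max_iff_disj)
  then show ?thesis using that[of "max B 1"] by auto
qed

lemma lborel_integral_translate:
  fixes f :: "'a::euclidean_space \<Rightarrow> 'b::euclidean_space"
  assumes [measurable]: "f \<in> borel_measurable borel"
  shows "(LINT x|lborel. f (c + x)) = (LINT x|lborel. f x)"
proof -
  have "(LINT x|lborel. f x) = (LINT x|distr lborel borel ((+) c). f x)"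
    by (simp add: lborel_distr_plus)
  also have "\<dots> = (LINT x|lborel. f (c + x))"
    by (rule integral_distr) auto
  finally show ?thesis by simp
qed

lemma lborel_integrable_translate:
  fixes f :: "'a::euclidean_space \<Rightarrow> 'b::euclidean_space"
  assumes "integrable lborel f"
  shows "integrable lborel (\<lambda>x. f (c + x))"
proof -
  have [measurable]: "f \<in> borel_measurable borel" using assms by auto
  have "integrable (distr lborel borel ((+) c)) f"
    using assms by (simp add: lborel_distr_plus)
  then show ?thesis by (subst (asm) integrable_distr_eq) auto
qed

text \<open>The partial derivatives are continuous with bounded support, hence bounded, and the mean value
theorem applies.\<close>

lemma C1_lipschitz_compact_support:
  fixes f :: "real^3 \<Rightarrow> 'b::real_normed_vector"
  assumes "C_k 1 f" "\<And>x. norm x > R \<Longrightarrow> f x = 0"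
  obtains B where "B > 0" "\<And>x y. norm (f x - f y) \<le> B * norm (x - y)"
proof -
  have "\<exists>B>0. \<forall>x. norm (partial_deriv j f x) \<le> B" for j
    by (rule compact_support_bounded[of "partial_deriv j f" R])
      (use assms partial_deriv_zero_outside[OF assms(2)] in auto)
  then obtain B where B: "\<And>j. B j > 0" "\<And>j x. norm (partial_deriv j f x) \<le> B j"
    by metis
  have "norm (f x - f y) \<le> (\<Sum>j\<in>UNIV. B j) * norm (x - y)" for x y
  proof (rule differentiable_bound[of UNIV f])
    show "onorm (\<lambda>h. \<Sum>j\<in>UNIV. (h $ j) *\<^sub>R partial_deriv j f x) \<le> (\<Sum>j\<in>UNIV. B j)" for x
    proof (rule onorm_le)
      fix h :: "real^3"
      have "norm (\<Sum>j\<in>UNIV. (h $ j) *\<^sub>R partial_deriv j f x) \<le> (\<Sum>j\<in>UNIV. norm h * B j)"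
        by (rule order_trans[OF norm_sum], intro sum_mono)
          (auto intro!: mult_mono B component_le_norm_cart)
      then show "norm (\<Sum>j\<in>UNIV. (h $ j) *\<^sub>R partial_deriv j f x) \<le> (\<Sum>j\<in>UNIV. B j) * norm h"
        by (simp add: sum_distrib_left mult.commute)
    qed
  qed (use assms has_derivative_partial in auto)
  moreover have "(\<Sum>j\<in>UNIV. B j) > 0" using B(1) by (intro sum_pos) auto
  ultimately show ?thesis using that by blast
qed

text \<open>Translation invariance makes the integral of every difference quotient vanish. The quotients are
  dominated by the Lipschitz constant on a fixed ball, so the limit can be taken under the integral.\<close>

lemma integral_partial_deriv_zero:
  fixes f :: "real^3 \<Rightarrow> 'b::euclidean_space"
  assumes f: "C_k 1 f" and R: "\<And>x. norm x > R \<Longrightarrow> f x = 0"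
  shows "(LINT x|lborel. partial_deriv j f x) = 0"
proof -
  obtain B where B: "B > 0" "\<And>x y. norm (f x - f y) \<le> B * norm (x - y)"
    using C1_lipschitz_compact_support[OF f R] by metis
  have cf: "continuous_on UNIV f" using C_k_continuous[OF f] .
  then have [measurable]: "f \<in> borel_measurable borel" by (rule borel_measurable_continuous_onI)
  have [measurable]: "partial_deriv j f \<in> borel_measurable borel"
    using f by (intro borel_measurable_continuous_onI) auto
  have intf: "integrable lborel f" by (rule integrable_compact_support[OF cf R])
  define q where "q n x = real (Suc n) *\<^sub>R (f ((1 / real (Suc n)) *\<^sub>R axis j 1 + x) - f x)" for n x
  have [measurable]: "q n \<in> borel_measurable borel" for n unfolding q_def[abs_def] by measurable
  have q0: "(LINT x|lborel. q n x) = 0" for n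
    unfolding q_def by (simp add: lborel_integrable_translate[OF intf] intf lborel_integral_translate)
  have lim: "(\<lambda>n. q n x) \<longlonglongrightarrow> partial_deriv j f x" for x
  proof -
    have "f differentiable (at x)" using f by simp
    then have D: "(f has_derivative frechet_derivative f (at x)) (at x)"
      by (simp add: frechet_derivative_works)
    let ?h = "\<lambda>n. (1 / real (Suc n)) *\<^sub>R axis j (1::real) :: real^3"
    have "(\<lambda>n. 1 / real (Suc n)) \<longlonglongrightarrow> 0"
      using LIMSEQ_inverse_real_of_nat by (simp add: inverse_eq_divide)
    then have "?h \<longlonglongrightarrow> 0 *\<^sub>R axis j 1" by (intro tendsto_intros)
    then have "filterlim ?h (at 0) sequentially"
      unfolding filterlim_at by (auto simp: axis_eq_0_iff)
    from filterlim_compose[OF conjunct2[OF D[unfolded has_derivative_at]] this]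
    have "(\<lambda>n. norm (f (x + ?h n) - f x - frechet_derivative f (at x) (?h n)) / norm (?h n)) \<longlonglongrightarrow> 0"
      .
    moreover have "norm (f (x + ?h n) - f x - frechet_derivative f (at x) (?h n)) / norm (?h n)
        = norm (q n x - partial_deriv j f x)" for n
    proof -
      have "q n x - partial_deriv j f x
          = real (Suc n) *\<^sub>R (f (x + ?h n) - f x - frechet_derivative f (at x) (?h n))"
        unfolding linear_scale[OF has_derivative_linear[OF D]]
        by (simp add: q_def partial_deriv_def add.commute scaleR_diff_right)
      then show ?thesis by (simp add: divide_simps)
    qed
    ultimately show ?thesis
      by (simp add: LIM_zero_iff tendsto_norm_zero_iff)
  qed
  have bound: "norm (q n x) \<le> indicator (cball 0 (\<bar>R\<bar> + 1)) x * B" for n x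
  proof (cases "norm x \<le> \<bar>R\<bar> + 1")
    case True
    have "norm (q n x) \<le> real (Suc n) * (B * norm ((1 / real (Suc n)) *\<^sub>R axis j (1::real) :: real^3))"
      unfolding q_def norm_scaleR abs_of_nat
      by (rule mult_left_mono) (use B(2)[of "(1 / real (Suc n)) *\<^sub>R axis j 1 + x" x] in auto)
    then show ?thesis using True by simp
  next
    case False
    define h :: "real^3" where "h = (1 / real (Suc n)) *\<^sub>R axis j 1"
    have "norm h \<le> 1" by (simp add: h_def divide_simps)
    moreover have "norm x \<le> norm (h + x) + norm h"
      using norm_triangle_ineq4[of "h + x" h] by simp
    ultimately have "norm (h + x) > R" using False by linarith
    then have "q n x = 0" using False by (simp add: q_def R del: of_nat_Suc flip: h_def)
    then show ?thesis using B by simp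
  qed
  have "(\<lambda>n. LINT x|lborel. q n x) \<longlonglongrightarrow> (LINT x|lborel. partial_deriv j f x)"
  proof (rule integral_dominated_convergence)
    show "integrable lborel (\<lambda>x::real^3. indicator (cball 0 (\<bar>R\<bar> + 1)) x * B)"
      using borel_integrable_compact[of "cball 0 (\<bar>R\<bar> + 1) :: (real^3) set" "\<lambda>x. B"] by simp
  qed (use lim bound in auto)
  then show ?thesis by (simp add: q0 LIMSEQ_const_iff)
qed

section \<open>Square-integrable spinor fields\<close>

definition sdot :: "complex^2 \<Rightarrow> complex^2 \<Rightarrow> complex" where
  "sdot a b = (\<Sum>i\<in>UNIV. cnj (a $ i) * b $ i)"

lemma L2_inner_sdot: "L2_inner \<phi> \<psi> = (LINT x|lborel. sdot (\<phi> x) (\<psi> x))"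
  by (simp add: L2_inner_def sdot_def)

lemma norm_sdot_le: "norm (sdot a b) \<le> norm a * norm b"
proof -
  have "norm (sdot a b) \<le> (\<Sum>i\<in>UNIV. norm (a $ i) * norm (b $ i))"
    unfolding sdot_def by (rule order_trans[OF norm_sum]) (simp add: norm_mult)
  also have "\<dots> \<le> norm a * norm b"
    unfolding norm_vec_def using L2_set_mult_ineq[of "\<lambda>i. norm (a $ i)" "\<lambda>i. norm (b $ i)" UNIV] by simp
  finally show ?thesis .
qed

lemma sdot_self: "sdot a a = of_real ((norm a)\<^sup>2)"
  by (simp add: sdot_def norm_vec_def L2_set_def sum_nonneg complex_norm_square mult.commute
      flip: of_real_power)

lemma bounded_bilinear_sdot: "bounded_bilinear sdot"
proof
  show "\<exists>K. \<forall>a b. norm (sdot a b) \<le> norm a * norm b * K"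
    by (rule exI[of _ 1]) (simp add: norm_sdot_le)
qed (auto simp: sdot_def algebra_simps sum.distrib scaleR_sum_right)

lemmas sdot_add_left = bounded_bilinear.add_left[OF bounded_bilinear_sdot]
  and sdot_add_right = bounded_bilinear.add_right[OF bounded_bilinear_sdot]
  and sdot_diff_left = bounded_bilinear.diff_left[OF bounded_bilinear_sdot]
  and sdot_diff_right = bounded_bilinear.diff_right[OF bounded_bilinear_sdot]
  and sdot_scaleR_left = bounded_bilinear.scaleR_left[OF bounded_bilinear_sdot]
  and sdot_scaleR_right = bounded_bilinear.scaleR_right[OF bounded_bilinear_sdot]

lemma borel_measurable_sdot [measurable]:
  assumes [measurable]: "f \<in> borel_measurable M" "g \<in> borel_measurable M"
  shows "(\<lambda>x. sdot (f x) (g x)) \<in> borel_measurable M"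
proof -
  have "continuous_on UNIV (\<lambda>p. sdot (fst p) (snd p))"
    by (intro bounded_bilinear.continuous_on[OF bounded_bilinear_sdot] continuous_intros)
  from borel_measurable_continuous_onI[OF this]
  have "(\<lambda>p. sdot (fst p) (snd p)) \<in> borel_measurable (borel \<Otimes>\<^sub>M borel)"
    by (simp add: borel_prod)
  from measurable_compose[OF _ this, of "\<lambda>x. (f x, g x)"] show ?thesis by simp
qed

lemma L2_measurable: "f \<in> L2 \<Longrightarrow> f \<in> borel_measurable borel"
  by (simp add: L2_def)

lemma L2_integrable: "f \<in> L2 \<Longrightarrow> integrable lborel (\<lambda>x. (norm (f x))\<^sup>2)"
  by (simp add: L2_def)

lemma L2I: "f \<in> borel_measurable borel \<Longrightarrow> integrable lborel (\<lambda>x. (norm (f x))\<^sup>2) \<Longrightarrow> f \<in> L2"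
  by (simp add: L2_def)

lemma L2_dominated:
  assumes "f \<in> borel_measurable borel" "g \<in> L2" "\<And>x. norm (f x) \<le> K * norm (g x)"
  shows "f \<in> L2"
proof (rule L2I)
  have [measurable]: "f \<in> borel_measurable borel" by fact
  have "(norm (f x))\<^sup>2 \<le> K\<^sup>2 * (norm (g x))\<^sup>2" for x
    using power_mono[OF assms(3), of x 2] by (simp add: power_mult_distrib)
  then have le: "AE x in lborel. norm ((norm (f x))\<^sup>2) \<le> norm (K\<^sup>2 * (norm (g x))\<^sup>2)"
    by simp
  have "integrable lborel (\<lambda>x. K\<^sup>2 * (norm (g x))\<^sup>2)"
    using L2_integrable[OF assms(2)] by simp
  then show "integrable lborel (\<lambda>x. (norm (f x))\<^sup>2)"
    by (rule Bochner_Integration.integrable_bound) (simp, rule le)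
qed (use assms in auto)

lemma norm_add_sq_le: "(norm (a + b))\<^sup>2 \<le> 2 * (norm a)\<^sup>2 + 2 * (norm (b::'a::real_normed_vector))\<^sup>2"
proof -
  have "(norm (a + b))\<^sup>2 \<le> (norm a + norm b)\<^sup>2" by (intro power_mono norm_triangle_ineq) auto
  also have "\<dots> \<le> 2 * (norm a)\<^sup>2 + 2 * (norm b)\<^sup>2"
    using zero_le_power2[of "norm a - norm b"] by (simp add: power2_diff power2_sum)
  finally show ?thesis .
qed

lemma L2_add: assumes "f \<in> L2" "g \<in> L2" shows "(\<lambda>x. f x + g x) \<in> L2"
proof (rule L2I)
  note [measurable] = L2_measurable[OF assms(1)] L2_measurable[OF assms(2)]
  show "(\<lambda>x. f x + g x) \<in> borel_measurable borel" by measurable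
  have "integrable lborel (\<lambda>x. 2 * (norm (f x))\<^sup>2 + 2 * (norm (g x))\<^sup>2)"
    using assms L2_integrable by auto
  then show "integrable lborel (\<lambda>x. (norm (f x + g x))\<^sup>2)"
    by (rule Bochner_Integration.integrable_bound) (auto simp: norm_add_sq_le)
qed

lemma L2_minus: "f \<in> L2 \<Longrightarrow> (\<lambda>x. - f x) \<in> L2"
  by (auto simp: L2_def)

lemma L2_diff: "f \<in> L2 \<Longrightarrow> g \<in> L2 \<Longrightarrow> (\<lambda>x. f x - g x) \<in> L2"
  using L2_add[OF _ L2_minus, of f g] by simp

lemma L2_continuous_compact_support:
  assumes "continuous_on UNIV f" "\<And>x. norm x > R \<Longrightarrow> f x = 0"
  shows "f \<in> L2"
proof (rule L2I)
  show "integrable lborel (\<lambda>x. (norm (f x))\<^sup>2)"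
    by (rule integrable_compact_support[where R = R])
      (use assms in \<open>auto intro!: continuous_intros\<close>)
qed (use assms borel_measurable_continuous_onI in auto)

lemma L2_norm_nonneg: "L2_norm f \<ge> 0"
  by (simp add: L2_norm_def integral_nonneg_AE)

lemma L2_norm_square: "(L2_norm f)\<^sup>2 = (LINT x|lborel. (norm (f x))\<^sup>2)"
  by (simp add: L2_norm_def integral_nonneg_AE)

lemma L2_norm_mono:
  assumes "f \<in> borel_measurable borel" "g \<in> L2" "\<And>x. norm (f x) \<le> K * norm (g x)" "K \<ge> 0"
  shows "L2_norm f \<le> K * L2_norm g"
proof (rule power2_le_imp_le)
  have "(L2_norm f)\<^sup>2 \<le> (LINT x|lborel. K\<^sup>2 * (norm (g x))\<^sup>2)"
    unfolding L2_norm_square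
    using L2_integrable[OF assms(2)] L2_integrable[OF L2_dominated[OF assms(1,2,3)]]
      power_mono[OF assms(3), of _ 2]
    by (intro integral_mono) (auto simp: power_mult_distrib)
  then show "(L2_norm f)\<^sup>2 \<le> (K * L2_norm g)\<^sup>2"
    by (simp add: power_mult_distrib L2_norm_square)
qed (use assms L2_norm_nonneg in auto)

lemma integrable_norm_mult:
  assumes "f \<in> L2" "g \<in> L2"
  shows "integrable lborel (\<lambda>x. norm (f x) * norm (g x))"
proof (rule Bochner_Integration.integrable_bound)
  note [measurable] = L2_measurable[OF assms(1)] L2_measurable[OF assms(2)]
  show "integrable lborel (\<lambda>x. (norm (f x))\<^sup>2 + (norm (g x))\<^sup>2)"
    using assms L2_integrable by auto
  show "(\<lambda>x. norm (f x) * norm (g x)) \<in> borel_measurable lborel" by measurable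
  have "norm (f x) * norm (g x) \<le> (norm (f x))\<^sup>2 + (norm (g x))\<^sup>2" for x
  proof -
    have "2 * (norm (f x) * norm (g x)) \<le> (norm (f x))\<^sup>2 + (norm (g x))\<^sup>2"
      using sum_squares_bound[of "norm (f x)" "norm (g x)"] by (simp add: mult.assoc)
    moreover have "0 \<le> norm (f x) * norm (g x)" by simp
    ultimately show ?thesis by linarith
  qed
  then show "AE x in lborel. norm (norm (f x) * norm (g x)) \<le> norm ((norm (f x))\<^sup>2 + (norm (g x))\<^sup>2)"
    by (auto simp: abs_mult)
qed

text \<open>The square of \<open>\<parallel>g\<parallel> \<bar>f\<bar> - \<parallel>f\<parallel> \<bar>g\<bar>\<close> has a nonnegative integral. This is inconclusive when one of the norms
vanishes, but then the product vanishes almost everywhere.\<close>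

lemma L2_Cauchy_Schwarz:
  assumes "f \<in> L2" "g \<in> L2"
  shows "(LINT x|lborel. norm (f x) * norm (g x)) \<le> L2_norm f * L2_norm g"
proof -
  let ?r = "L2_norm f" and ?s = "L2_norm g" and ?m = "LINT x|lborel. norm (f x) * norm (g x)"
  note [measurable] = L2_measurable[OF assms(1)] L2_measurable[OF assms(2)]
  have null: "?m = 0" if "L2_norm h = 0" "h \<in> L2" "h = f \<or> h = g" for h
  proof -
    have "(LINT x|lborel. (norm (h x))\<^sup>2) = 0" using that L2_norm_square[of h] by simp
    then have "AE x in lborel. (norm (h x))\<^sup>2 = 0"
      using integral_nonneg_eq_0_iff_AE[OF L2_integrable[OF that(2)]] by simp
    then have "AE x in lborel. norm (f x) * norm (g x) = 0"
      using that(3) by auto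
    then show ?thesis by (simp add: integral_eq_zero_AE)
  qed
  show ?thesis
  proof (cases "?r = 0 \<or> ?s = 0")
    case True
    then show ?thesis using null assms by auto
  next
    case False
    then have pos: "?r > 0" "?s > 0" using L2_norm_nonneg by (auto simp: less_le)
    have "0 \<le> (LINT x|lborel. (?s * norm (f x) - ?r * norm (g x))\<^sup>2)"
      by (intro integral_nonneg_AE) auto
    also have "\<dots> = (LINT x|lborel. ?s\<^sup>2 * (norm (f x))\<^sup>2 + ?r\<^sup>2 * (norm (g x))\<^sup>2
        - (2 * ?s * ?r) * (norm (f x) * norm (g x)))"
      by (intro Bochner_Integration.integral_cong) (auto simp: power2_diff power_mult_distrib)
    also have "\<dots> = ?s\<^sup>2 * ?r\<^sup>2 + ?r\<^sup>2 * ?s\<^sup>2 - (2 * ?s * ?r) * ?m"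
      using assms L2_integrable integrable_norm_mult[OF assms] by (simp add: L2_norm_square)
    finally have "(?s * ?r) * ?m \<le> (?s * ?r) * (?r * ?s)"
      by (simp add: power2_eq_square algebra_simps)
    then show ?thesis using pos by (simp add: mult_le_cancel_left)
  qed
qed

lemma integrable_sdot:
  assumes "f \<in> L2" "g \<in> L2"
  shows "integrable lborel (\<lambda>x. sdot (f x) (g x))"
proof (rule Bochner_Integration.integrable_bound[OF integrable_norm_mult[OF assms]])
  note [measurable] = L2_measurable[OF assms(1)] L2_measurable[OF assms(2)]
  show "(\<lambda>x. sdot (f x) (g x)) \<in> borel_measurable lborel" by measurable
qed (simp add: abs_mult norm_sdot_le)

lemma norm_L2_inner_le:
  assumes "f \<in> L2" "g \<in> L2"
  shows "norm (L2_inner f g) \<le> L2_norm f * L2_norm g"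
proof -
  have "norm (L2_inner f g) \<le> (LINT x|lborel. norm (sdot (f x) (g x)))"
    unfolding L2_inner_sdot by (rule integral_norm_bound)
  also have "\<dots> \<le> (LINT x|lborel. norm (f x) * norm (g x))"
    using integrable_sdot[OF assms] integrable_norm_mult[OF assms]
    by (intro integral_mono) (auto simp: norm_sdot_le)
  also note L2_Cauchy_Schwarz[OF assms]
  finally show ?thesis .
qed

lemma L2_inner_diff_right:
  assumes "f \<in> L2" "g \<in> L2" "h \<in> L2"
  shows "L2_inner f (\<lambda>x. g x - h x) = L2_inner f g - L2_inner f h"
  unfolding L2_inner_sdot sdot_diff_right using assms by (simp add: integrable_sdot)

lemma L2_norm_triangle:
  assumes "f \<in> L2" "g \<in> L2"
  shows "L2_norm (\<lambda>x. f x + g x) \<le> L2_norm f + L2_norm g"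
proof (rule power2_le_imp_le)
  have "(L2_norm (\<lambda>x. f x + g x))\<^sup>2
      \<le> (LINT x|lborel. (norm (f x))\<^sup>2 + (norm (g x))\<^sup>2 + 2 * (norm (f x) * norm (g x)))"
    unfolding L2_norm_square
  proof (rule integral_mono)
    fix x
    have "(norm (f x + g x))\<^sup>2 \<le> (norm (f x) + norm (g x))\<^sup>2"
      by (intro power_mono norm_triangle_ineq) auto
    then show "(norm (f x + g x))\<^sup>2 \<le> (norm (f x))\<^sup>2 + (norm (g x))\<^sup>2 + 2 * (norm (f x) * norm (g x))"
      by (simp add: power2_sum)
  qed (use assms L2_integrable L2_add integrable_norm_mult in auto)
  also have "\<dots> = (L2_norm f)\<^sup>2 + (L2_norm g)\<^sup>2 + 2 * (LINT x|lborel. norm (f x) * norm (g x))"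
    using assms L2_integrable integrable_norm_mult[OF assms] by (simp add: L2_norm_square)
  also have "\<dots> \<le> (L2_norm f + L2_norm g)\<^sup>2"
    using L2_Cauchy_Schwarz[OF assms] by (simp add: power2_sum)
  finally show "(L2_norm (\<lambda>x. f x + g x))\<^sup>2 \<le> (L2_norm f + L2_norm g)\<^sup>2" .
qed (use L2_norm_nonneg[of f] L2_norm_nonneg[of g] in auto)

lemma L2_norm_diff_triangle:
  assumes "f \<in> L2" "g \<in> L2" "h \<in> L2"
  shows "L2_norm (\<lambda>x. f x - h x) \<le> L2_norm (\<lambda>x. f x - g x) + L2_norm (\<lambda>x. g x - h x)"
  using L2_norm_triangle[OF L2_diff[OF assms(1,2)] L2_diff[OF assms(2,3)]] by simp

lemma L2_norm_diff_commute: "L2_norm (\<lambda>x. f x - g x) = L2_norm (\<lambda>x. g x - f x)"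
  by (simp add: L2_norm_def norm_minus_commute)

lemma L2_dominated_convergence:
  assumes "\<And>n. s n \<in> borel_measurable borel" "f \<in> borel_measurable borel" "integrable lborel w"
    and lim: "AE x in lborel. (\<lambda>n. s n x) \<longlonglongrightarrow> f x"
    and bound: "\<And>n. AE x in lborel. (norm (s n x - f x))\<^sup>2 \<le> w x"
  shows "(\<lambda>n. L2_norm (\<lambda>x. s n x - f x)) \<longlonglongrightarrow> 0"
proof -
  note [measurable] = assms(1,2)
  have "(\<lambda>n. LINT x|lborel. (norm (s n x - f x))\<^sup>2) \<longlonglongrightarrow> (LINT x|(lborel::(real^3) measure). 0)"
  proof (rule integral_dominated_convergence[OF _ _ assms(3)])
    show "AE x in lborel. (\<lambda>n. (norm (s n x - f x))\<^sup>2) \<longlonglongrightarrow> 0"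
      using lim
    proof eventually_elim
      fix x assume "(\<lambda>n. s n x) \<longlonglongrightarrow> f x"
      then have "(\<lambda>n. (norm (s n x - f x))\<^sup>2) \<longlonglongrightarrow> (norm (f x - f x))\<^sup>2" by (intro tendsto_intros)
      then show "(\<lambda>n. (norm (s n x - f x))\<^sup>2) \<longlonglongrightarrow> 0" by simp
    qed
  qed (use bound in auto)
  from tendsto_real_sqrt[OF this] show ?thesis by (simp add: L2_norm_def)
qed

section \<open>Approximation in the mean square\<close>

lemma indicator_power: "0 < n \<Longrightarrow> indicator A x ^ n = (indicator A x :: real)"
  by (simp add: indicator_def)

text \<open>The radial retraction onto the ball of radius \<open>K\<close>, written with \<open>max\<close> so that continuity at the
origin is evident.\<close>

definition clip :: "real \<Rightarrow> 'a::real_normed_vector \<Rightarrow> 'a" where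
  "clip K z = z /\<^sub>R max 1 (norm z / K)"

lemma continuous_on_clip: "continuous_on UNIV (clip K)"
  unfolding clip_def[abs_def] divide_inverse by (intro continuous_intros) auto

lemma norm_clip_le: "K > 0 \<Longrightarrow> norm (clip K z) \<le> K"
  by (auto simp: clip_def field_simps max_def)

lemma clip_eq: "norm z \<le> K \<Longrightarrow> K > 0 \<Longrightarrow> clip K z = z"
  by (auto simp: clip_def field_simps max_def)

lemma norm_clip_le_norm: "norm (clip K z) \<le> norm z"
proof -
  have "norm (clip K z) = norm z / max 1 (norm z / K)" by (simp add: clip_def divide_inverse mult.commute)
  also have "\<dots> \<le> norm z / 1" by (intro divide_left_mono) auto
  finally show ?thesis by simp
qed

definition plateau :: "real \<Rightarrow> real^3 \<Rightarrow> real" where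
  "plateau K x = max 0 (min 1 (K + 1 - norm x))"

lemma continuous_on_plateau: "continuous_on UNIV (plateau K)"
  unfolding plateau_def[abs_def] by (intro continuous_intros)

lemma plateau_bounds: "0 \<le> plateau K x" "plateau K x \<le> 1"
  by (auto simp: plateau_def)

lemma plateau_eq: "norm x \<le> K \<Longrightarrow> plateau K x = 1" "norm x > K + 1 \<Longrightarrow> plateau K x = 0"
  by (auto simp: plateau_def)

lemma integrable_indicator_cball: "integrable lborel (\<lambda>x::real^3. c * indicator (cball a R) x :: real)"
  using borel_integrable_compact[of "cball a R" "\<lambda>x. c"] by (simp add: mult.commute)

text \<open>Truncating range and domain reduces the claim to bounded functions of bounded support, for
  which almost everywhere approximation by continuous functions is enough.\<close>

lemma L2_approx_continuous:
  assumes "u \<in> L2" and e: "e > 0"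
  obtains g R where "continuous_on UNIV g" "\<And>x. norm x > R \<Longrightarrow> g x = 0" "L2_norm (\<lambda>x. u x - g x) < e"
proof -
  note [measurable] = L2_measurable[OF assms(1)]
  have [measurable]: "plateau K \<in> borel_measurable borel" "(clip K :: complex^2 \<Rightarrow> _) \<in> borel_measurable borel" for K
    by (intro borel_measurable_continuous_onI continuous_on_plateau continuous_on_clip)+
  define v where "v K x = plateau K x *\<^sub>R clip K (u x)" for K x
  have [measurable]: "v K \<in> borel_measurable borel" for K unfolding v_def[abs_def] by measurable
  have "(\<lambda>n. L2_norm (\<lambda>x. v (real (Suc n)) x - u x)) \<longlonglongrightarrow> 0"
  proof (rule L2_dominated_convergence[where w = "\<lambda>x. 4 * (norm (u x))\<^sup>2"])
    show "AE x in lborel. (\<lambda>n. v (real (Suc n)) x) \<longlonglongrightarrow> u x"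
    proof (intro AE_I2 tendsto_eventually)
      fix x
      obtain N where N: "real N \<ge> max (norm x) (norm (u x))" using real_arch_simple by blast
      have "v (real (Suc n)) x = u x" if "n \<ge> N" for n
        using that N by (simp add: v_def plateau_eq clip_eq)
      then show "\<forall>\<^sub>F n in sequentially. v (real (Suc n)) x = u x"
        by (auto simp: eventually_sequentially)
    qed
    have "norm (v K x - u x) \<le> 2 * norm (u x)" for K x
    proof -
      have "norm (v K x) \<le> 1 * norm (u x)" unfolding v_def norm_scaleR
        by (rule mult_mono) (use plateau_bounds[of K x] norm_clip_le_norm[of K "u x"] in auto)
      then show ?thesis using norm_triangle_ineq4[of "v K x" "u x"] by simp
    qed
    then show "AE x in lborel. (norm (v (real (Suc n)) x - u x))\<^sup>2 \<le> 4 * (norm (u x))\<^sup>2" for n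
      using power_mono[of "norm (v (real (Suc n)) x - u x)" "2 * norm (u x)" 2 for x]
      by (simp add: power_mult_distrib)
  qed (use L2_integrable[OF assms(1)] in auto)
  from order_tendstoD(2)[OF this, of "e / 2"] e
  obtain m where "L2_norm (\<lambda>x. v (real (Suc m)) x - u x) < e / 2"
    by (auto simp: eventually_sequentially)
  then obtain K where K: "K > 0" "L2_norm (\<lambda>x. v K x - u x) < e / 2"
    by (metis of_nat_0_less_iff zero_less_Suc)
  have "u \<in> borel_measurable lebesgue"
    using L2_measurable[OF assms(1)] by (simp add: measurable_completion)
  then have "u measurable_on UNIV" by (simp add: measurable_on_iff_borel_measurable)
  then obtain N g where N: "negligible N" and g: "\<And>n. continuous_on UNIV (g n)"
    "\<And>x. x \<notin> N \<Longrightarrow> (\<lambda>n. g n x) \<longlonglongrightarrow> u x"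
    by (auto simp: measurable_on_def)
  define w where "w n x = plateau K x *\<^sub>R clip K (g n x)" for n x
  have w: "continuous_on UNIV (w n)" for n
    unfolding w_def[abs_def]
    by (intro continuous_intros continuous_on_compose2[OF continuous_on_clip g(1)]
        continuous_on_plateau) auto
  have "(\<lambda>n. L2_norm (\<lambda>x. w n x - v K x)) \<longlonglongrightarrow> 0"
  proof (rule L2_dominated_convergence[where w = "\<lambda>x. (2 * K)\<^sup>2 * indicator (cball 0 (K + 1)) x"])
    have "AE x in lebesgue. x \<notin> N" using N negligible_iff_null_sets AE_not_in by blast
    then have "AE x in lborel. x \<notin> N" by (simp add: AE_completion_iff)
    then show "AE x in lborel. (\<lambda>n. w n x) \<longlonglongrightarrow> v K x"
    proof eventually_elim
      fix x assume x: "x \<notin> N"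
      have "isCont (clip K) (u x)"
        using continuous_on_clip[where 'a = "complex^2"] by (simp add: continuous_on_eq_continuous_at)
      from isCont_tendsto_compose[OF this g(2)[OF x]]
      show "(\<lambda>n. w n x) \<longlonglongrightarrow> v K x" unfolding w_def v_def by (intro tendsto_intros)
    qed
    have *: "norm (plateau K x *\<^sub>R clip K z) \<le> K" for x z
      using mult_mono[OF plateau_bounds(2)[of K x] norm_clip_le[OF K(1), of z]] plateau_bounds(1)[of K x]
      by simp
    have le: "norm (w n x - v K x) \<le> 2 * K * indicator (cball 0 (K + 1)) x" for n x
    proof (cases "norm x \<le> K + 1")
      case True
      then show ?thesis
        using norm_triangle_ineq4[of "w n x" "v K x"] *[of x "g n x"] *[of x "u x"]
        unfolding w_def v_def by simp
    qed (simp add: w_def v_def plateau_eq)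
    show "AE x in lborel. (norm (w n x - v K x))\<^sup>2 \<le> (2 * K)\<^sup>2 * indicator (cball 0 (K + 1)) x" for n
      using power_mono[OF le norm_ge_zero, where n = 2]
      by (simp add: power_mult_distrib indicator_power)
  qed (use w borel_measurable_continuous_onI integrable_indicator_cball in auto)
  from order_tendstoD(2)[OF this, of "e / 2"] e
  obtain n where n: "L2_norm (\<lambda>x. w n x - v K x) < e / 2"
    by (auto simp: eventually_sequentially)
  have w0: "w n x = 0" if "norm x > K + 1" for x using that by (simp add: w_def plateau_eq)
  have wL: "w n \<in> L2" by (rule L2_continuous_compact_support[OF w w0])
  have vL: "v K \<in> L2"
  proof (rule L2_dominated[OF _ assms(1), where K = 1])
    show "norm (v K x) \<le> 1 * norm (u x)" for x unfolding v_def norm_scaleR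
        by (rule mult_mono) (use plateau_bounds[of K x] norm_clip_le_norm[of K "u x"] in auto)
  qed auto
  have "L2_norm (\<lambda>x. u x - w n x) < e"
    using L2_norm_diff_triangle[OF assms(1) vL wL] n K(2)
    by (simp add: L2_norm_diff_commute[of u "v K"] L2_norm_diff_commute[of "v K" "w n"])
  then show ?thesis using that[OF w w0] by simp
qed

lemma L2_translate:
  assumes "u \<in> L2"
  shows "(\<lambda>x. u (c + x)) \<in> L2" "L2_norm (\<lambda>x. u (c + x)) = L2_norm u"
proof -
  note [measurable] = L2_measurable[OF assms]
  show "(\<lambda>x. u (c + x)) \<in> L2"
    using lborel_integrable_translate[OF L2_integrable[OF assms], of c] by (intro L2I) auto
  show "L2_norm (\<lambda>x. u (c + x)) = L2_norm u"
    using lborel_integral_translate[of "\<lambda>x. (norm (u x))\<^sup>2" c] by (simp add: L2_norm_def)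
qed

text \<open>Translations are isometries, so an approximation by a continuous function of bounded support reduces
the claim to such functions, where dominated convergence applies.\<close>

lemma L2_translation_continuous:
  assumes u: "u \<in> L2" and e: "e > 0"
  obtains \<delta> where "\<delta> > 0" "\<And>y. norm y \<le> \<delta> \<Longrightarrow> L2_norm (\<lambda>x. u (y + x) - u x) \<le> e"
proof -
  obtain g R where g: "continuous_on UNIV g" "\<And>x. norm x > R \<Longrightarrow> g x = 0"
    and ug: "L2_norm (\<lambda>x. u x - g x) < e / 3"
    using L2_approx_continuous[OF u, of "e / 3"] e by auto
  have gL: "g \<in> L2" by (rule L2_continuous_compact_support[OF g])
  note [measurable] = L2_measurable[OF u] L2_measurable[OF gL]
  obtain B where B: "B > 0" "\<And>x. norm (g x) \<le> B" using compact_support_bounded[OF g] by blast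
  have "\<exists>\<delta>>0. \<forall>y. norm y \<le> \<delta> \<longrightarrow> L2_norm (\<lambda>x. g (y + x) - g x) \<le> e / 3"
  proof (rule ccontr)
    assume "\<not> ?thesis"
    then have *: "\<forall>\<delta>>0. \<exists>y. norm y \<le> \<delta> \<and> L2_norm (\<lambda>x. g (y + x) - g x) > e / 3"
      by (simp add: not_le)
    have "\<forall>n. \<exists>y. norm y \<le> 1 / real (Suc n) \<and> L2_norm (\<lambda>x. g (y + x) - g x) > e / 3"
      by (intro allI *[rule_format]) simp
    then obtain y where y: "\<And>n. norm (y n) \<le> 1 / real (Suc n)"
      "\<And>n. L2_norm (\<lambda>x. g (y n + x) - g x) > e / 3" by metis
    have y0: "y \<longlonglongrightarrow> 0"
      by (rule Lim_null_comparison[of _ "\<lambda>n. 1 / real (Suc n)"])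
        (use y(1) LIMSEQ_inverse_real_of_nat in \<open>auto simp: inverse_eq_divide simp del: of_nat_Suc\<close>)
    have "(\<lambda>n. L2_norm (\<lambda>x. g (y n + x) - g x)) \<longlonglongrightarrow> 0"
    proof (rule L2_dominated_convergence[where w = "\<lambda>x. (2 * B)\<^sup>2 * indicator (cball 0 (\<bar>R\<bar> + 1)) x"])
      show "AE x in lborel. (\<lambda>n. g (y n + x)) \<longlonglongrightarrow> g x"
      proof (rule AE_I2)
        fix x
        have "isCont g x" using g(1) by (simp add: continuous_on_eq_continuous_at)
        moreover have "(\<lambda>n. y n + x) \<longlonglongrightarrow> x" using tendsto_add[OF y0 tendsto_const[of x]] by simp
        ultimately show "(\<lambda>n. g (y n + x)) \<longlonglongrightarrow> g x" by (rule isCont_tendsto_compose)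
      qed
      have le: "norm (g (y n + x) - g x) \<le> 2 * B * indicator (cball 0 (\<bar>R\<bar> + 1)) x" for n x
      proof (cases "norm x \<le> \<bar>R\<bar> + 1")
        case True
        then show ?thesis using norm_triangle_ineq4[of "g (y n + x)" "g x"] B(2)[of "y n + x"] B(2)[of x] by simp
      next
        case False
        have "norm (y n) \<le> 1" using y(1)[of n] by (rule order_trans) simp
        moreover have "norm x \<le> norm (y n + x) + norm (y n)"
          using norm_triangle_ineq4[of "y n + x" "y n"] by simp
        ultimately have "norm (y n + x) > R" using False by linarith
        then show ?thesis using False g(2) by simp
      qed
      show "AE x in lborel. (norm (g (y n + x) - g x))\<^sup>2 \<le> (2 * B)\<^sup>2 * indicator (cball 0 (\<bar>R\<bar> + 1)) x" for n
        using power_mono[OF le norm_ge_zero, where n = 2]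
        by (simp add: power_mult_distrib indicator_power)
    qed (use integrable_indicator_cball in auto)
    from order_tendstoD(2)[OF this, of "e / 3"] e
    obtain n where "L2_norm (\<lambda>x. g (y n + x) - g x) < e / 3"
      by (auto simp: eventually_sequentially)
    with y(2)[of n] show False by simp
  qed
  then obtain \<delta> where \<delta>: "\<delta> > 0" "\<And>y. norm y \<le> \<delta> \<Longrightarrow> L2_norm (\<lambda>x. g (y + x) - g x) \<le> e / 3" by blast
  have "L2_norm (\<lambda>x. u (y + x) - u x) \<le> e" if "norm y \<le> \<delta>" for y
  proof -
    note uy = L2_translate(1)[OF u, of y] and gy = L2_translate(1)[OF gL, of y]
    have "L2_norm (\<lambda>x. u (y + x) - g (y + x)) = L2_norm (\<lambda>x. u x - g x)"
      using L2_translate(2)[OF L2_diff[OF u gL]] by simp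
    then show ?thesis
      using L2_norm_diff_triangle[OF uy gy u] L2_norm_diff_triangle[OF gy gL u] ug \<delta>(2)[OF that]
      by (simp add: L2_norm_diff_commute[of g u])
  qed
  with \<delta>(1) show ?thesis using that by blast
qed

section \<open>Mollification\<close>

definition conv :: "(real^3 \<Rightarrow> real) \<Rightarrow> spinor_field \<Rightarrow> spinor_field" where
  "conv \<rho> u x = (LINT y|lborel. \<rho> (x - y) *\<^sub>R u y)"

lemma integrable_weighted:
  assumes "continuous_on UNIV \<rho>" "\<And>x. norm x > R \<Longrightarrow> \<rho> x = (0::real)" "u \<in> L2"
  shows "integrable lborel (\<lambda>x. \<rho> x *\<^sub>R u x)"
proof -
  have [measurable]: "\<rho> \<in> borel_measurable borel" "u \<in> borel_measurable borel"
    using assms L2_measurable borel_measurable_continuous_onI by auto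
  have "integrable lborel (\<lambda>x. (\<rho> x)\<^sup>2)"
    by (rule integrable_compact_support[where R = R]) (use assms in \<open>auto intro!: continuous_intros\<close>)
  then have int: "integrable lborel (\<lambda>x. (\<rho> x)\<^sup>2 + (norm (u x))\<^sup>2)"
    using L2_integrable[OF assms(3)] by auto
  have "\<bar>\<rho> x\<bar> * norm (u x) \<le> (\<rho> x)\<^sup>2 + (norm (u x))\<^sup>2" for x
  proof -
    have "2 * (\<bar>\<rho> x\<bar> * norm (u x)) \<le> \<bar>\<rho> x\<bar>\<^sup>2 + (norm (u x))\<^sup>2"
      using sum_squares_bound[of "\<bar>\<rho> x\<bar>" "norm (u x)"] by (simp add: mult.assoc)
    moreover have "0 \<le> \<bar>\<rho> x\<bar> * norm (u x)" by simp
    ultimately show ?thesis unfolding power2_abs by linarith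
  qed
  then have le: "AE x in lborel. norm (\<rho> x *\<^sub>R u x) \<le> norm ((\<rho> x)\<^sup>2 + (norm (u x))\<^sup>2)"
    by simp
  show ?thesis
    by (rule Bochner_Integration.integrable_bound[OF int _ le]) simp
qed

lemma integrable_conv:
  assumes "continuous_on UNIV \<rho>" "\<And>x. norm x > R \<Longrightarrow> \<rho> x = (0::real)" "u \<in> L2"
  shows "integrable lborel (\<lambda>y. \<rho> (x - y) *\<^sub>R u y)"
proof (rule integrable_weighted[where R = "R + norm x"])
  show "continuous_on UNIV (\<lambda>y. \<rho> (x - y))"
    by (rule continuous_on_compose2[OF assms(1)]) (auto intro: continuous_intros)
  fix y :: "real^3" assume "norm y > R + norm x"
  then have "norm (x - y) > R" using norm_triangle_ineq2[of y x] by (simp add: norm_minus_commute)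
  then show "\<rho> (x - y) = 0" by (rule assms(2))
qed fact

lemma conv_eq_average:
  assumes "continuous_on UNIV \<rho>" "\<And>x. \<rho> (- x) = \<rho> x" "u \<in> L2"
  shows "conv \<rho> u x = (LINT z|lborel. \<rho> z *\<^sub>R u (z + x))"
proof -
  have [measurable]: "\<rho> \<in> borel_measurable borel" "u \<in> borel_measurable borel"
    using assms L2_measurable borel_measurable_continuous_onI by auto
  have "\<rho> (x - y) = \<rho> (y - x)" for y :: "real^3" using assms(2)[of "x - y"] by simp
  then have "conv \<rho> u x = (LINT y|lborel. \<rho> (y - x) *\<^sub>R u y)" by (simp add: conv_def)
  also have "\<dots> = (LINT z|lborel. \<rho> ((x + z) - x) *\<^sub>R u (x + z))"
    by (rule lborel_integral_translate[symmetric]) simp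
  finally show ?thesis by (simp add: add.commute)
qed

text \<open>Jensen's inequality for the probability density \<open>\<rho>\<close>.\<close>

lemma conv_error_pointwise:
  assumes \<rho>: "continuous_on UNIV \<rho>" "\<And>x. norm x > R \<Longrightarrow> \<rho> x = (0::real)" "\<And>x. \<rho> x \<ge> 0"
      "\<And>x. \<rho> (- x) = \<rho> x" "(LINT x|lborel. \<rho> x) = 1" and u: "u \<in> L2"
  shows "integrable lborel (\<lambda>z. \<rho> z * (norm (u (z + x) - u x))\<^sup>2)"
    and "(norm (conv \<rho> u x - u x))\<^sup>2 \<le> (LINT z|lborel. \<rho> z * (norm (u (z + x) - u x))\<^sup>2)"
proof -
  have [measurable]: "\<rho> \<in> borel_measurable borel" "u \<in> borel_measurable borel"
    using \<rho> u L2_measurable borel_measurable_continuous_onI by auto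
  obtain B where B: "B > 0" "\<And>x. norm (\<rho> x) \<le> B" using compact_support_bounded[OF \<rho>(1,2)] by blast
  have i\<rho>: "integrable lborel \<rho>" by (rule integrable_compact_support[OF \<rho>(1,2)])
  have ux: "(\<lambda>z. u (z + x)) \<in> L2" using L2_translate(1)[OF u, of x] by (simp add: add.commute)
  define k where "k z = norm (u (z + x) - u x)" for z
  have [measurable]: "k \<in> borel_measurable borel" unfolding k_def[abs_def] by measurable
  have iD: "integrable lborel (\<lambda>z. \<rho> z *\<^sub>R (u (z + x) - u x))"
    unfolding scaleR_diff_right using integrable_weighted[OF \<rho>(1,2) ux] i\<rho> by simp
  have ik: "integrable lborel (\<lambda>z. \<rho> z * k z)"
    using integrable_norm[OF iD] \<rho>(3) by (simp add: k_def)
  have le: "\<rho> z * (k z)\<^sup>2 \<le> 2 * B * (norm (u (z + x)))\<^sup>2 + 2 * (norm (u x))\<^sup>2 * \<rho> z" for z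
  proof -
    have "\<rho> z * (k z)\<^sup>2 \<le> \<rho> z * (2 * (norm (u (z + x)))\<^sup>2 + 2 * (norm (u x))\<^sup>2)"
      unfolding k_def using norm_add_sq_le[of "u (z + x)" "- u x"] \<rho>(3) by (simp add: mult_left_mono)
    also have "\<dots> \<le> 2 * B * (norm (u (z + x)))\<^sup>2 + 2 * (norm (u x))\<^sup>2 * \<rho> z"
      using mult_right_mono[of "\<rho> z" B "(norm (u (z + x)))\<^sup>2"] B(2)[of z] by (simp add: algebra_simps)
    finally show ?thesis .
  qed
  show ik2: "integrable lborel (\<lambda>z. \<rho> z * (norm (u (z + x) - u x))\<^sup>2)"
    unfolding k_def[symmetric]
  proof (rule Bochner_Integration.integrable_bound)
    show "integrable lborel (\<lambda>z. 2 * B * (norm (u (z + x)))\<^sup>2 + 2 * (norm (u x))\<^sup>2 * \<rho> z)"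
      using L2_integrable[OF ux] i\<rho> by simp
    show "AE z in lborel. norm (\<rho> z * (k z)\<^sup>2) \<le> norm (2 * B * (norm (u (z + x)))\<^sup>2 + 2 * (norm (u x))\<^sup>2 * \<rho> z)"
      using le \<rho>(3) by (auto intro: order_trans[OF _ abs_ge_self])
  qed simp
  define m where "m = (LINT z|lborel. \<rho> z * k z)"
  have "conv \<rho> u x - u x = (LINT z|lborel. \<rho> z *\<^sub>R (u (z + x) - u x))"
    unfolding scaleR_diff_right conv_eq_average[OF \<rho>(1,4) u]
    using integrable_weighted[OF \<rho>(1,2) ux] i\<rho> \<rho>(5) by simp
  then have "norm (conv \<rho> u x - u x) \<le> (LINT z|lborel. norm (\<rho> z *\<^sub>R (u (z + x) - u x)))"
    by (simp only: integral_norm_bound)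
  also have "\<dots> = m" using \<rho>(3) by (simp add: m_def k_def)
  finally have "(norm (conv \<rho> u x - u x))\<^sup>2 \<le> m\<^sup>2" by (intro power_mono) auto
  also have "m\<^sup>2 \<le> (LINT z|lborel. \<rho> z * (k z)\<^sup>2)"
  proof -
    \<comment> \<open>The variance of \<open>k\<close> under the density \<open>\<rho>\<close> is nonnegative.\<close>
    have "0 \<le> (LINT z|lborel. \<rho> z * (k z - m)\<^sup>2)"
      using \<rho>(3) by (intro integral_nonneg_AE) auto
    also have "\<dots> = (LINT z|lborel. \<rho> z * (k z)\<^sup>2 - 2 * m * (\<rho> z * k z) + m\<^sup>2 * \<rho> z)"
      by (intro Bochner_Integration.integral_cong) (auto simp: power2_diff algebra_simps)
    also have "\<dots> = (LINT z|lborel. \<rho> z * (k z)\<^sup>2) - 2 * m * m + m\<^sup>2 * 1"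
      using ik2 ik i\<rho> \<rho>(5) by (simp add: k_def[symmetric] m_def)
    finally show ?thesis by (simp add: power2_eq_square)
  qed
  finally show "(norm (conv \<rho> u x - u x))\<^sup>2 \<le> (LINT z|lborel. \<rho> z * (norm (u (z + x) - u x))\<^sup>2)"
    by (simp add: k_def)
qed

lemma borel_measurable_conv:
  assumes "continuous_on UNIV \<rho>" "u \<in> L2"
  shows "conv \<rho> u \<in> borel_measurable borel"
proof -
  have [measurable]: "\<rho> \<in> borel_measurable borel" "u \<in> borel_measurable borel"
    using assms L2_measurable borel_measurable_continuous_onI by auto
  have "(\<lambda>x. LINT y|lborel. \<rho> (x - y) *\<^sub>R u y) \<in> borel_measurable borel" by measurable
  then show ?thesis by (simp add: conv_def[abs_def])
qed

text \<open>Averaging the pointwise error over \<open>x\<close> and exchanging the integrals leaves the mean, with density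
\<open>\<rho>\<close>, of the squared distances between \<open>u\<close> and its translates by vectors in the support of \<open>\<rho>\<close>.\<close>

lemma conv_close:
  assumes \<rho>: "continuous_on UNIV \<rho>" "\<And>x. norm x > R \<Longrightarrow> \<rho> x = (0::real)" "\<And>x. \<rho> x \<ge> 0"
      "\<And>x. \<rho> (- x) = \<rho> x" "(LINT x|lborel. \<rho> x) = 1" and u: "u \<in> L2"
    and close: "\<And>z. norm z \<le> R \<Longrightarrow> L2_norm (\<lambda>x. u (z + x) - u x) \<le> e" and "e \<ge> 0"
  shows "conv \<rho> u \<in> L2" "L2_norm (\<lambda>x. conv \<rho> u x - u x) \<le> e"
proof -
  have [measurable]: "\<rho> \<in> borel_measurable borel" "u \<in> borel_measurable borel"
    using \<rho> u L2_measurable borel_measurable_continuous_onI by auto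
  have [measurable]: "conv \<rho> u \<in> borel_measurable borel" by (rule borel_measurable_conv[OF \<rho>(1) u])
  let ?d = "\<lambda>x. conv \<rho> u x - u x"
  have "(\<integral>\<^sup>+x. ennreal ((norm (?d x))\<^sup>2) \<partial>lborel)
      \<le> (\<integral>\<^sup>+x. \<integral>\<^sup>+z. ennreal (\<rho> z * (norm (u (z + x) - u x))\<^sup>2) \<partial>lborel \<partial>lborel)"
  proof (rule nn_integral_mono)
    fix x
    show "ennreal ((norm (?d x))\<^sup>2) \<le> (\<integral>\<^sup>+z. ennreal (\<rho> z * (norm (u (z + x) - u x))\<^sup>2) \<partial>lborel)"
      using conv_error_pointwise[OF \<rho> u, where x = x] \<rho>(3)
      by (subst nn_integral_eq_integral) (auto simp: ennreal_leI)
  qed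
  also have "\<dots> = (\<integral>\<^sup>+z. \<integral>\<^sup>+x. ennreal (\<rho> z * (norm (u (z + x) - u x))\<^sup>2) \<partial>lborel \<partial>lborel)"
    by (rule lborel_pair.Fubini') simp
  also have "\<dots> \<le> (\<integral>\<^sup>+z. ennreal (e\<^sup>2 * \<rho> z) \<partial>lborel)"
  proof (rule nn_integral_mono)
    fix z
    have dL: "(\<lambda>x. u (z + x) - u x) \<in> L2" by (intro L2_diff L2_translate u)
    have "(\<integral>\<^sup>+x. ennreal (\<rho> z * (norm (u (z + x) - u x))\<^sup>2) \<partial>lborel)
        = ennreal (\<rho> z * (L2_norm (\<lambda>x. u (z + x) - u x))\<^sup>2)"
      using L2_integrable[OF dL] \<rho>(3) by (subst nn_integral_eq_integral) (auto simp: L2_norm_square)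
    also have "\<dots> \<le> ennreal (e\<^sup>2 * \<rho> z)"
    proof (cases "norm z \<le> R")
      case True
      from power_mono[OF close[OF True] L2_norm_nonneg, of 2] show ?thesis
        using \<rho>(3)[of z] by (intro ennreal_leI) (simp add: mult.commute mult_left_mono)
    qed (simp add: \<rho>(2))
    finally show "(\<integral>\<^sup>+x. ennreal (\<rho> z * (norm (u (z + x) - u x))\<^sup>2) \<partial>lborel) \<le> ennreal (e\<^sup>2 * \<rho> z)" .
  qed
  also have "\<dots> = ennreal (e\<^sup>2)"
    using integrable_compact_support[OF \<rho>(1,2)] \<rho>(3,5)
    by (subst nn_integral_eq_integral) auto
  finally have nn: "(\<integral>\<^sup>+x. ennreal ((norm (?d x))\<^sup>2) \<partial>lborel) \<le> ennreal (e\<^sup>2)" .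
  have i: "integrable lborel (\<lambda>x. (norm (?d x))\<^sup>2)"
    by (rule integrableI_nonneg) (use nn in \<open>auto intro: le_less_trans\<close>)
  then have dL: "?d \<in> L2" by (intro L2I) auto
  from L2_add[OF dL u] show "conv \<rho> u \<in> L2" by simp
  have "ennreal ((L2_norm ?d)\<^sup>2) \<le> ennreal (e\<^sup>2)"
    using nn i by (subst (asm) nn_integral_eq_integral) (auto simp: L2_norm_square)
  then have "(L2_norm ?d)\<^sup>2 \<le> e\<^sup>2" by (subst (asm) ennreal_le_iff) auto
  then show "L2_norm ?d \<le> e" using \<open>e \<ge> 0\<close> power2_le_imp_le by blast
qed

lemma bump_integral_pos: "c > 0 \<Longrightarrow> d > 0 \<Longrightarrow> (LINT x|lborel. bump c d x) > 0"
proof -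
  assume c: "c > 0" "d > 0"
  obtain R where "\<And>x. norm x > R \<Longrightarrow> bump c d x = 0"
    using Cc_infinityE[OF bump_Cc_infinity[OF c(2)]] by metis
  then have i: "integrable lborel (bump c d)"
    by (rule integrable_compact_support[OF smooth_continuous[OF smooth_bump]])
  have "(LINT x|lborel. bump c d x) \<noteq> 0"
  proof
    assume "(LINT x|lborel. bump c d x) = 0"
    then have "AE x in lborel. bump c d x = 0"
      using integral_nonneg_eq_0_iff_AE[OF i] bump_nonneg by simp
    then have "AE x in lebesgue. x \<notin> {x. bump c d x \<noteq> 0}" by (simp add: AE_completion)
    then have "negligible {x. bump c d x \<noteq> 0}"
      by (simp add: negligible_iff_null_sets AE_iff_null_sets completion.AE_iff_null_sets)
    moreover have "open {x. bump c d x \<noteq> 0}"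
      using smooth_continuous[OF smooth_bump] by (intro open_Collect_neq) auto
    moreover have "0 \<in> {x. bump c d x \<noteq> 0}"
      using bump_profile_pos[of c 0] c by (simp add: bump_def)
    ultimately show False using open_not_negligible by blast
  qed
  moreover have "(LINT x|lborel. bump c d x) \<ge> 0"
    by (intro integral_nonneg_AE) (simp add: bump_nonneg)
  ultimately show ?thesis by simp
qed

lemma mollifier_exists:
  assumes "\<epsilon> > 0"
  obtains \<rho> :: "real^3 \<Rightarrow> real" where "\<rho> \<in> Cc_infinity" "\<And>x. norm x > \<epsilon> \<Longrightarrow> \<rho> x = 0"
    "\<And>x. \<rho> x \<ge> 0" "\<And>x. \<rho> (- x) = \<rho> x" "(LINT x|lborel. \<rho> x) = 1"
proof -
  define I where "I = (LINT x|lborel. bump (\<epsilon>\<^sup>2) 1 x)"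
  have I: "I > 0" unfolding I_def using assms by (intro bump_integral_pos) auto
  define \<rho> where "\<rho> x = (1 / I) *\<^sub>R bump (\<epsilon>\<^sup>2) 1 x" for x
  show ?thesis
  proof (rule that[of \<rho>])
    have "smooth (\<lambda>x::real^3. 1 / I)" by (simp add: smooth_def C_k_const)
    then show "\<rho> \<in> Cc_infinity" unfolding \<rho>_def[abs_def]
      by (rule Cc_infinity_scaleR_right) (simp add: bump_Cc_infinity)
    show "\<rho> x = 0" if "norm x > \<epsilon>" for x
      using bump_outside[of \<epsilon> "\<epsilon>\<^sup>2" 1 x] that assms by (simp add: \<rho>_def)
    show "(LINT x|lborel. \<rho> x) = 1" using I by (simp add: \<rho>_def I_def)
    show "\<rho> x \<ge> 0" for x using I by (simp add: \<rho>_def bump_nonneg)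
    show "\<rho> (- x) = \<rho> x" for x by (simp add: \<rho>_def bump_def)
  qed
qed

text \<open>The remainder is quadratic uniformly in the base point because the partial derivatives are Lipschitz.
  The uniformity is what allows differentiation under the convolution integral when the other factor
  is merely square-integrable.\<close>

lemma taylor_remainder:
  fixes \<rho> :: "real^3 \<Rightarrow> real"
  assumes "\<rho> \<in> Cc_infinity"
  obtains B where "B > 0"
    "\<And>z h. \<bar>\<rho> (z + h) - \<rho> z - (\<Sum>j\<in>UNIV. (h $ j) * partial_deriv j \<rho> z)\<bar> \<le> B * (norm h)\<^sup>2"
proof -
  obtain R where R: "smooth \<rho>" "\<And>x. norm x > R \<Longrightarrow> \<rho> x = 0"
    using Cc_infinityE[OF assms] by metis
  have "\<exists>B>0. \<forall>x y. norm (partial_deriv j \<rho> x - partial_deriv j \<rho> y) \<le> B * norm (x - y)" for j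
    by (rule C1_lipschitz_compact_support[of "partial_deriv j \<rho>" R])
      (use smooth_C_k[OF smooth_partial[OF R(1)]] partial_deriv_zero_outside[OF R(2)] in auto)
  then obtain B where B: "\<And>j. B j > 0"
    "\<And>j x y. norm (partial_deriv j \<rho> x - partial_deriv j \<rho> y) \<le> B j * norm (x - y)" by metis
  have *: "norm (\<rho> (z + h) - \<rho> z - (\<Sum>j\<in>UNIV. ((z + h) - z) $ j *\<^sub>R partial_deriv j \<rho> z))
      \<le> norm ((z + h) - z) * ((\<Sum>j\<in>UNIV. B j) * norm h)" for z h
  proof (rule differentiable_bound_linearization[where S = "cball z (norm h)"
        and f' = "\<lambda>x h. \<Sum>j\<in>UNIV. h $ j *\<^sub>R partial_deriv j \<rho> x"])
    show "z + t *\<^sub>R (z + h - z) \<in> cball z (norm h)" if "t \<in> {0..1}" for t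
      using that by (simp add: dist_norm mult_left_le_one_le)
    show "(\<rho> has_derivative (\<lambda>h. \<Sum>j\<in>UNIV. h $ j *\<^sub>R partial_deriv j \<rho> x)) (at x within cball z (norm h))" for x
      by (rule has_derivative_at_withinI[OF has_derivative_partial[OF smooth_differentiable[OF R(1)]]])
    fix x assume x: "x \<in> cball z (norm h)"
    show "onorm ((\<lambda>h. \<Sum>j\<in>UNIV. h $ j *\<^sub>R partial_deriv j \<rho> x) - (\<lambda>h. \<Sum>j\<in>UNIV. h $ j *\<^sub>R partial_deriv j \<rho> z))
        \<le> (\<Sum>j\<in>UNIV. B j) * norm h"
    proof (rule onorm_le)
      fix k :: "real^3"
      have "norm (((\<lambda>h. \<Sum>j\<in>UNIV. h $ j *\<^sub>R partial_deriv j \<rho> x) - (\<lambda>h. \<Sum>j\<in>UNIV. h $ j *\<^sub>R partial_deriv j \<rho> z)) k)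
          = norm (\<Sum>j\<in>UNIV. k $ j *\<^sub>R (partial_deriv j \<rho> x - partial_deriv j \<rho> z))"
        by (simp add: sum_subtractf algebra_simps)
      also have "\<dots> \<le> (\<Sum>j\<in>UNIV. norm k * (B j * norm h))"
      proof (rule order_trans[OF norm_sum], rule sum_mono)
        fix j
        have "norm (partial_deriv j \<rho> x - partial_deriv j \<rho> z) \<le> B j * norm h"
        proof -
          have "B j * norm (x - z) \<le> B j * norm h"
            using x B(1)[of j] by (intro mult_left_mono) (auto simp: dist_norm norm_minus_commute)
          with B(2)[of j x z] show ?thesis by linarith
        qed
        then show "norm (k $ j *\<^sub>R (partial_deriv j \<rho> x - partial_deriv j \<rho> z)) \<le> norm k * (B j * norm h)"
          unfolding norm_scaleR using component_le_norm_cart[of k j] by (intro mult_mono) auto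
      qed
      also have "\<dots> = (\<Sum>j\<in>UNIV. B j) * norm h * norm k"
        by (simp add: sum_distrib_left sum_distrib_right mult.commute mult.left_commute)
      finally show "norm (((\<lambda>h. \<Sum>j\<in>UNIV. h $ j *\<^sub>R partial_deriv j \<rho> x) - (\<lambda>h. \<Sum>j\<in>UNIV. h $ j *\<^sub>R partial_deriv j \<rho> z)) k)
        \<le> (\<Sum>j\<in>UNIV. B j) * norm h * norm k" .
    qed
  qed auto
  have "(\<Sum>j\<in>UNIV. B j) > 0" using B(1) by (intro sum_pos) auto
  from that[OF this] show ?thesis using *
    by (simp add: power2_eq_square mult.commute mult.left_commute)
qed

lemma conv_has_derivative:
  assumes \<rho>: "\<rho> \<in> Cc_infinity" and u: "u \<in> L2"
  shows "(conv \<rho> u has_derivative (\<lambda>h. \<Sum>j\<in>UNIV. (h $ j) *\<^sub>R conv (partial_deriv j \<rho>) u x)) (at x)"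
    (is "(_ has_derivative ?D) _")
proof -
  obtain R where R: "R > 0" "smooth \<rho>" "\<And>x. norm x > R \<Longrightarrow> \<rho> x = 0"
    using Cc_infinityE[OF \<rho>] by metis
  obtain B where B: "B > 0"
    "\<And>z h. \<bar>\<rho> (z + h) - \<rho> z - (\<Sum>j\<in>UNIV. (h $ j) * partial_deriv j \<rho> z)\<bar> \<le> B * (norm h)\<^sup>2"
    using taylor_remainder[OF \<rho>] by blast
  have i0: "integrable lborel (\<lambda>y. \<rho> (x - y) *\<^sub>R u y)" for x
    by (rule integrable_conv[OF smooth_continuous[OF R(2)] R(3) u])
  have ij: "integrable lborel (\<lambda>y. partial_deriv j \<rho> (x - y) *\<^sub>R u y)" for x j
    by (rule integrable_conv[OF smooth_continuous[OF smooth_partial[OF R(2)]]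
          partial_deriv_zero_outside[OF R(3)] u])
  \<comment> \<open>For \<open>norm h \<le> 1\<close> the Taylor remainder vanishes where \<open>p (x - y)\<close> is not one, so \<open>p\<close> serves as a
    fixed integrable weight.\<close>
  define p where "p = plateau (R + 1)"
  have iM: "integrable lborel (\<lambda>y. norm (p (x - y) *\<^sub>R u y))"
    by (intro integrable_norm integrable_conv[where R = "R + 2"] u)
      (auto simp: p_def plateau_eq continuous_on_plateau)
  define M where "M = (LINT y|lborel. norm (p (x - y) *\<^sub>R u y))"
  have M: "M \<ge> 0" unfolding M_def by (intro integral_nonneg_AE) simp
  have rem: "norm (conv \<rho> u (x + h) - conv \<rho> u x - ?D h) \<le> B * M * (norm h)\<^sup>2" if h: "norm h \<le> 1" for h
  proof -
    define r where "r y = \<rho> (x + h - y) - \<rho> (x - y) - (\<Sum>j\<in>UNIV. (h $ j) * partial_deriv j \<rho> (x - y))" for y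
    have "conv \<rho> u (x + h) - conv \<rho> u x - ?D h = (LINT y|lborel. \<rho> (x + h - y) *\<^sub>R u y - \<rho> (x - y) *\<^sub>R u y
        - (\<Sum>j\<in>UNIV. (h $ j) *\<^sub>R (partial_deriv j \<rho> (x - y) *\<^sub>R u y)))"
      unfolding conv_def using i0 ij by (simp del: scaleR_scaleR)
    also have "\<dots> = (LINT y|lborel. r y *\<^sub>R u y)"
      by (intro Bochner_Integration.integral_cong)
        (simp_all add: r_def algebra_simps scaleR_sum_left)
    finally have eq: "conv \<rho> u (x + h) - conv \<rho> u x - ?D h = (LINT y|lborel. r y *\<^sub>R u y)" .
    have ir: "integrable lborel (\<lambda>y. r y *\<^sub>R u y)"
      unfolding r_def scaleR_diff_left scaleR_sum_left scaleR_scaleR[symmetric] using i0 ij by (simp del: scaleR_scaleR)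
    have "norm (r y *\<^sub>R u y) \<le> (B * (norm h)\<^sup>2) * norm (p (x - y) *\<^sub>R u y)" for y
    proof (cases "norm (x - y) \<le> R + 1")
      case True
      have "\<bar>r y\<bar> \<le> B * (norm h)\<^sup>2" unfolding r_def using B(2)[of "x - y" h] by (simp add: algebra_simps)
      then show ?thesis using True by (simp add: p_def plateau_eq mult_right_mono)
    next
      case False
      have "norm (x - y) \<le> norm (x + h - y) + norm h"
        using norm_triangle_ineq4[of "x + h - y" h] by (simp add: algebra_simps)
      then have "norm (x + h - y) > R" "norm (x - y) > R" using False h by linarith+
      then have "r y = 0" by (simp add: r_def R(3) partial_deriv_zero_outside[OF R(3)])
      then show ?thesis using B(1) by simp
    qed
    then have "(LINT y|lborel. norm (r y *\<^sub>R u y)) \<le> (LINT y|lborel. (B * (norm h)\<^sup>2) * norm (p (x - y) *\<^sub>R u y))"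
      by (intro integral_mono integrable_norm ir integrable_mult_right iM)
    also have "\<dots> = B * M * (norm h)\<^sup>2" by (simp add: M_def)
    finally show ?thesis unfolding eq by (rule order_trans[OF integral_norm_bound])
  qed
  show ?thesis unfolding has_derivative_at_alt
  proof (intro conjI allI impI)
    show "bounded_linear ?D"
      by (intro bounded_linear_sum bounded_linear_compose[OF bounded_linear_scaleR_left] bounded_linear_vec_nth)
    fix e :: real assume e: "e > 0"
    define d where "d = min 1 (e / (B * M + 1))"
    have BM: "B * M + 1 > 0" using B(1) M by (simp add: add_nonneg_pos)
    have d: "d > 0" using e BM by (simp add: d_def)
    have "norm (conv \<rho> u y - conv \<rho> u x - ?D (y - x)) \<le> e * norm (y - x)" if y: "norm (y - x) < d" for y
    proof -
      have "norm (conv \<rho> u y - conv \<rho> u x - ?D (y - x)) \<le> (B * M * norm (y - x)) * norm (y - x)"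
        using rem[of "y - x"] y by (simp add: d_def power2_eq_square mult.assoc)
      also have "\<dots> \<le> e * norm (y - x)"
      proof (rule mult_right_mono)
        have "B * M * norm (y - x) \<le> (B * M + 1) * (e / (B * M + 1))"
          using y B(1) M BM by (intro mult_mono) (auto simp: d_def)
        then show "B * M * norm (y - x) \<le> e" using BM by simp
      qed simp
      finally show ?thesis .
    qed
    with d show "\<exists>d>0. \<forall>y. norm (y - x) < d \<longrightarrow> norm (conv \<rho> u y - conv \<rho> u x - ?D (y - x)) \<le> e * norm (y - x)"
      by blast
  qed
qed

lemma Cc_infinity_partial: "f \<in> Cc_infinity \<Longrightarrow> partial_deriv j f \<in> Cc_infinity"
  by (metis Cc_infinityE Cc_infinityI smooth_partial partial_deriv_zero_outside)

lemma partial_deriv_conv: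
  assumes "\<rho> \<in> Cc_infinity" "u \<in> L2"
  shows "partial_deriv j (conv \<rho> u) = conv (partial_deriv j \<rho>) u"
proof
  fix x
  have "partial_deriv j (conv \<rho> u) x = (\<Sum>i\<in>UNIV. (axis j 1 $ i) *\<^sub>R conv (partial_deriv i \<rho>) u x)"
    by (rule partial_deriv_eq[OF conv_has_derivative[OF assms]])
  also have "\<dots> = (\<Sum>i\<in>UNIV. if i = j then conv (partial_deriv i \<rho>) u x else 0)"
    by (intro sum.cong) (auto simp: axis_def)
  finally show "partial_deriv j (conv \<rho> u) x = conv (partial_deriv j \<rho>) u x" by simp
qed

text \<open>All derivatives fall on the mollifier, and the partial derivatives of a mollifier are again smooth
with compact support.\<close>

lemma smooth_conv:
  assumes "\<rho> \<in> Cc_infinity" "u \<in> L2"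
  shows "smooth (conv \<rho> u)"
proof (rule smooth_coinduct[where P = "\<lambda>f. \<exists>\<rho>\<in>Cc_infinity. f = conv \<rho> u"])
  fix f :: spinor_field assume "\<exists>\<rho>\<in>Cc_infinity. f = conv \<rho> u"
  then obtain \<rho> where \<rho>: "\<rho> \<in> Cc_infinity" "f = conv \<rho> u" by blast
  show "(\<forall>x. f differentiable at x) \<and> (\<forall>j. \<exists>\<rho>\<in>Cc_infinity. partial_deriv j f = conv \<rho> u)"
    using conv_has_derivative[OF \<rho>(1) assms(2)] partial_deriv_conv[OF \<rho>(1) assms(2)]
      Cc_infinity_partial[OF \<rho>(1)] unfolding \<rho>(2) differentiable_def by blast
qed (use assms in blast)

section \<open>The Weyl-Dirac expression\<close>

abbreviation "dirac \<equiv> weyl_dirac_expr"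

lemma pauli_components:
  "(pauli 1 *v a) $ 1 = a $ 2" "(pauli 1 *v a) $ 2 = a $ 1"
  "(pauli 2 *v a) $ 1 = - \<i> * a $ 2" "(pauli 2 *v a) $ 2 = \<i> * a $ 1"
  "(pauli 3 *v a) $ 1 = a $ 1" "(pauli 3 *v a) $ 2 = - (a $ 2)"
  by (simp_all add: pauli_def matrix_vector_mult_def sum_2)

lemma sdot_pauli: "sdot (pauli j *v a) b = sdot a (pauli j *v b)"
  using exhaust_3[of j] by (auto simp: sdot_def sum_2 pauli_components)

lemma sdot_smult_left: "sdot (c *s a) b = cnj c * sdot a b"
  and sdot_smult_right: "sdot a (c *s b) = c * sdot a b"
  by (simp_all add: sdot_def sum_2 algebra_simps)

lemma norm_pauli: "norm (pauli j *v a) = norm a"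
proof -
  have "(norm (pauli j *v a))\<^sup>2 = (norm a)\<^sup>2"
    using exhaust_3[of j]
    by (auto simp: norm_vec_def L2_set_def sum_2 pauli_components norm_mult)
  then show ?thesis by simp
qed

lemma bounded_linear_pauli: "bounded_linear (\<lambda>a. pauli j *v a)"
proof (rule bounded_linear_intro[where K = 1])
  show "pauli j *v (a + b) = pauli j *v a + pauli j *v b" for a b
    by (rule matrix_vector_right_distrib)
  show "pauli j *v (r *\<^sub>R a) = r *\<^sub>R (pauli j *v a)" for r a
    using exhaust_3[of j] by (auto simp: vec_eq_iff forall_2 pauli_components)
  show "norm (pauli j *v a) \<le> norm a * 1" for a
    by (simp add: norm_pauli)
qed

lemma bounded_linear_smult: "bounded_linear (\<lambda>a::complex^2. c *s a)"
proof
  show "\<exists>K. \<forall>a::complex^2. norm (c *s a) \<le> norm a * K"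
    by (rule exI[of _ "norm c"])
      (auto simp: norm_vec_def L2_set_def sum_2 norm_mult power_mult_distrib real_sqrt_mult
        simp flip: distrib_left)
qed (auto simp: vec_eq_iff algebra_simps)

lemma norm_smult: "norm (c *s (a::complex^2)) = norm c * norm a"
  by (auto simp: norm_vec_def L2_set_def sum_2 norm_mult power_mult_distrib real_sqrt_mult
        simp flip: distrib_left)

text \<open>Clifford multiplication by the vector \<open>v\<close>, that is \<open>\<sigma> \<cdot> v\<close>.\<close>

definition slash :: "real^3 \<Rightarrow> complex^2 \<Rightarrow> complex^2" where
  "slash v a = (\<Sum>j\<in>UNIV. (v $ j) *\<^sub>R (pauli j *v a))"

lemma norm_slash_le: "norm (slash v a) \<le> 3 * norm v * norm a"
proof -
  have "norm (slash v a) \<le> (\<Sum>j\<in>(UNIV::3 set). norm v * norm a)"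
    unfolding slash_def
    by (rule order_trans[OF norm_sum], intro sum_mono)
      (simp add: norm_pauli mult_right_mono component_le_norm_cart)
  then show ?thesis by simp
qed

lemma bounded_bilinear_slash: "bounded_bilinear slash"
proof
  show "\<exists>K. \<forall>v a. norm (slash v a) \<le> norm v * norm a * K"
    by (rule exI[of _ 3]) (use norm_slash_le in \<open>simp add: mult_ac\<close>)
qed (auto simp: slash_def algebra_simps sum.distrib scaleR_sum_right
    linear_add[OF bounded_linear.linear[OF bounded_linear_pauli]]
    linear_scale[OF bounded_linear.linear[OF bounded_linear_pauli]])

lemma sdot_slash: "sdot (slash v a) b = sdot a (slash v b)"
  unfolding slash_def
  by (simp add: bounded_bilinear.sum_left[OF bounded_bilinear_sdot]
      bounded_bilinear.sum_right[OF bounded_bilinear_sdot] sdot_scaleR_left sdot_scaleR_right sdot_pauli)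

lemma dirac_eq: "dirac A f x = (- \<i>) *s (\<Sum>j\<in>UNIV. pauli j *v partial_deriv j f x) - slash (A x) (f x)"
  by (simp add: weyl_dirac_expr_def slash_def sum_3 vec_eq_iff forall_2 pauli_components algebra_simps
      scaleR_conv_of_real[where 'a = complex])

lemma dirac_components:
  "dirac A f x $ 1 = - \<i> * partial_deriv 3 f x $ 1 - A x $ 3 * f x $ 1
     + (- \<i> * partial_deriv 1 f x $ 2 - A x $ 1 * f x $ 2) - \<i> * (- \<i> * partial_deriv 2 f x $ 2 - A x $ 2 * f x $ 2)"
  "dirac A f x $ 2 = - \<i> * partial_deriv 1 f x $ 1 - A x $ 1 * f x $ 1
     + \<i> * (- \<i> * partial_deriv 2 f x $ 1 - A x $ 2 * f x $ 1) - (- \<i> * partial_deriv 3 f x $ 2 - A x $ 3 * f x $ 2)"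
  by (simp_all add: weyl_dirac_expr_def sum_3 pauli_components algebra_simps)

lemma dirac_potential: "dirac A f x = dirac (\<lambda>x. 0) f x - slash (A x) (f x)"
  by (simp add: dirac_eq slash_def)

lemma continuous_on_dirac:
  assumes "C_k 1 f" "continuous_on UNIV A"
  shows "continuous_on UNIV (dirac A f)"
proof -
  have "continuous_on UNIV (\<lambda>x. (- \<i>) *s (\<Sum>j\<in>UNIV. pauli j *v partial_deriv j f x) - slash (A x) (f x))"
    using assms C_k_continuous[OF assms(1)]
    by (intro continuous_intros bounded_linear.continuous_on[OF bounded_linear_smult]
        bounded_linear.continuous_on[OF bounded_linear_pauli]
        bounded_bilinear.continuous_on[OF bounded_bilinear_slash]) auto
  then show ?thesis by (simp add: dirac_eq[abs_def])
qed

lemma dirac_zero_outside: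
  assumes "\<And>x. norm x > R \<Longrightarrow> f x = 0" "norm x > R"
  shows "dirac A f x = 0"
  using assms partial_deriv_zero_outside[of R f x]
  by (simp add: vec_eq_iff forall_2 dirac_components)

lemma dirac_L2:
  assumes "C_k 1 f" "\<And>x. norm x > R \<Longrightarrow> f x = 0" "continuous_on UNIV A"
  shows "dirac A f \<in> L2"
  by (rule L2_continuous_compact_support[OF continuous_on_dirac[OF assms(1,3)] dirac_zero_outside[OF assms(2)]])

text \<open>Since the Pauli matrices are hermitian and the potential is real, the difference of the two
  integrands is the divergence of the field \<open>i \<langle>\<sigma>\<^sub>j f, g\<rangle>\<close>.\<close>

lemma dirac_symmetric:
  assumes f: "C_k 1 f" "\<And>x. norm x > R \<Longrightarrow> f x = 0"
    and g: "C_k 1 g" "\<And>x. norm x > R \<Longrightarrow> g x = 0"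
    and A: "continuous_on UNIV A"
  shows "L2_inner f (dirac A g) = L2_inner (dirac A f) g"
proof -
  define T where "T j x = \<i> * sdot (pauli j *v f x) (g x)" for j x
  have CT: "C_k 1 (T j)" for j
    unfolding T_def
    by (intro C_k_linear[OF bounded_linear_mult_right] C_k_bilinear[OF bounded_bilinear_sdot]
        C_k_linear[OF bounded_linear_pauli] f g)
  have T0: "T j x = 0" if "norm x > R" for j x using g(2)[OF that] by (simp add: T_def sdot_def)
  have df: "f differentiable (at x)" "g differentiable (at x)" for x using f g by auto
  have dT: "partial_deriv j (T j) x
      = \<i> * (sdot (pauli j *v f x) (partial_deriv j g x) + sdot (pauli j *v partial_deriv j f x) (g x))" for j x
  proof -
    have 1: "(\<lambda>x. pauli j *v f x) differentiable (at x)"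
      using df(1) bounded_linear.has_derivative[OF bounded_linear_pauli]
      unfolding differentiable_def by blast
    have 2: "(\<lambda>x. sdot (pauli j *v f x) (g x)) differentiable (at x)"
      using 1 df(2) bounded_bilinear.FDERIV[OF bounded_bilinear_sdot]
      unfolding differentiable_def by blast
    show ?thesis unfolding T_def
      by (simp add: partial_deriv_linear[OF bounded_linear_mult_right 2]
          partial_deriv_bilinear[OF bounded_bilinear_sdot 1 df(2)]
          partial_deriv_linear[OF bounded_linear_pauli df(1)])
  qed
  have iT: "integrable lborel (partial_deriv j (T j))" for j
    by (rule integrable_compact_support[OF _ partial_deriv_zero_outside[OF T0]]) (use CT in auto)
  have "L2_inner (dirac A f) g - L2_inner f (dirac A g)
      = (LINT x|lborel. sdot (dirac A f x) (g x) - sdot (f x) (dirac A g x))"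
    unfolding L2_inner_sdot
    using integrable_sdot dirac_L2[OF f A] dirac_L2[OF g A] L2_continuous_compact_support
      C_k_continuous f g by (subst Bochner_Integration.integral_diff) blast+
  also have "\<dots> = (LINT x|lborel. (\<Sum>j\<in>UNIV. partial_deriv j (T j) x))"
  proof (rule Bochner_Integration.integral_cong)
    fix x
    show "sdot (dirac A f x) (g x) - sdot (f x) (dirac A g x) = (\<Sum>j\<in>UNIV. partial_deriv j (T j) x)"
      unfolding dT dirac_eq sdot_diff_left sdot_diff_right sdot_slash sdot_smult_left sdot_smult_right
        bounded_bilinear.sum_left[OF bounded_bilinear_sdot]
        bounded_bilinear.sum_right[OF bounded_bilinear_sdot] sdot_pauli
      by (simp add: sum.distrib sum_distrib_left distrib_left sum_negf)
  qed simp
  also have "\<dots> = 0"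
    using iT integral_partial_deriv_zero[OF CT T0] by simp
  finally show ?thesis by simp
qed

lemma dirac_scale:
  assumes "\<eta> differentiable (at x)" "f differentiable (at x)"
  shows "dirac A (\<lambda>x. \<eta> x *\<^sub>R f x) x
    = \<eta> x *\<^sub>R dirac A f x + (- \<i>) *s slash (\<chi> j. partial_deriv j \<eta> x) (f x)"
  by (simp add: vec_eq_iff forall_2 dirac_components partial_deriv_bilinear[OF bounded_bilinear_scaleR assms]
      slash_def sum_3 pauli_components scaleR_conv_of_real[where 'a = complex] algebra_simps)

section \<open>Smooth compactly supported fields are dense in the graph norm\<close>

text \<open>The support is the ball of radius \<open>n + 1\<close>, and the factor \<open>exp 1\<close> normalises the value at the origin
to one. The cutoffs are not constant on large balls; convergence to one at each point suffices.\<close>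

definition cutoff :: "nat \<Rightarrow> real^3 \<Rightarrow> real" where
  "cutoff n x = exp 1 * bump 1 (1 / (real (Suc n))\<^sup>2) x"

lemma cutoff_Cc_infinity: "cutoff n \<in> Cc_infinity"
proof -
  have "smooth (\<lambda>x::real^3. exp 1 :: real)" by (simp add: smooth_def C_k_const)
  from Cc_infinity_scaleR_right[OF this bump_Cc_infinity[of "1 / (real (Suc n))\<^sup>2" 1]]
  show ?thesis by (simp add: cutoff_def[abs_def] del: of_nat_Suc)
qed

lemma cutoff_bounds: "0 \<le> cutoff n x" "cutoff n x \<le> 1"
proof -
  show "0 \<le> cutoff n x" by (simp add: cutoff_def bump_nonneg)
  define s where "s = 1 - 1 / (real (Suc n))\<^sup>2 * (x \<bullet> x)"
  have "s \<le> 1" by (simp add: s_def)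
  have "exp 1 * bump_profile 0 s \<le> 1"
  proof (cases "s > 0")
    case True
    then have "1 - 1 / s \<le> 0" using \<open>s \<le> 1\<close> by (simp add: field_simps)
    then show ?thesis using True by (simp add: bump_profile_def flip: exp_add)
  qed (simp add: bump_profile_nonpos)
  then show "cutoff n x \<le> 1" by (simp add: cutoff_def bump_def s_def)
qed

lemma cutoff_tendsto: "(\<lambda>n. cutoff n x) \<longlonglongrightarrow> 1"
proof -
  have "(\<lambda>n. (1 / real (Suc n))\<^sup>2) \<longlonglongrightarrow> 0\<^sup>2"
    using tendsto_power[OF LIMSEQ_inverse_real_of_nat, of 2] by (simp add: inverse_eq_divide)
  from tendsto_diff[OF tendsto_const tendsto_mult_right[OF this]]
  have "(\<lambda>n. 1 - (1 / real (Suc n))\<^sup>2 * (x \<bullet> x)) \<longlonglongrightarrow> 1 - 0\<^sup>2 * (x \<bullet> x)" .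
  then have *: "(\<lambda>n. 1 - 1 / (real (Suc n))\<^sup>2 * (x \<bullet> x)) \<longlonglongrightarrow> 1"
    by (simp add: power_one_over del: of_nat_Suc)
  have "isCont (bump_profile 0) 1" using bump_profile_deriv by (rule DERIV_isCont)
  from tendsto_mult_left[OF isCont_tendsto_compose[OF this *], of "exp 1"]
  show ?thesis by (simp add: cutoff_def bump_def bump_profile_def flip: exp_add del: of_nat_Suc)
qed

lemma cutoff_partial_bound: "\<bar>partial_deriv j (cutoff n) x\<bar> \<le> 4 * exp 1 / real (Suc n)"
proof -
  define N where "N = real (Suc n)"
  have "N > 0" by (simp add: N_def)
  define s where "s = 1 - 1 / N\<^sup>2 * (x \<bullet> x)"
  have d: "bump 1 (1 / N\<^sup>2) differentiable (at x)"
    by (rule smooth_differentiable[OF smooth_bump])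
  have eq: "partial_deriv j (cutoff n) x = exp 1 * (bump_profile 2 s * (- 2 * (1 / N\<^sup>2) * x $ j))"
    unfolding cutoff_def[abs_def] N_def[symmetric]
    by (simp add: partial_deriv_linear[OF bounded_linear_mult_right d] partial_deriv_bump s_def)
  show ?thesis
  proof (cases "norm x \<le> N")
    case True
    have "\<bar>x $ j\<bar> \<le> N" using component_le_norm_cart[of x j] True by linarith
    then have "bump_profile 2 s * (2 * (1 / N\<^sup>2) * \<bar>x $ j\<bar>) \<le> 2 * (2 * (1 / N\<^sup>2) * N)"
      using bump_profile_le_fact[of 2 s] by (intro mult_mono) (use \<open>N > 0\<close> in \<open>auto simp: fact_2 bump_profile_nonneg\<close>)
    also have "\<dots> = 4 / N" by (simp add: power2_eq_square)
    finally have "exp 1 * (bump_profile 2 s * (2 * (1 / N\<^sup>2) * \<bar>x $ j\<bar>)) \<le> exp 1 * (4 / N)"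
      by (intro mult_left_mono) auto
    then show ?thesis unfolding eq N_def[symmetric]
      by (simp add: abs_mult bump_profile_nonneg mult.commute[of 4])
  next
    case False
    then have "N\<^sup>2 \<le> x \<bullet> x" unfolding power2_norm_eq_inner[symmetric]
      using \<open>N > 0\<close> by (intro power_mono) auto
    then have "s \<le> 0" using \<open>N > 0\<close> by (simp add: s_def divide_simps)
    then show ?thesis unfolding eq by (simp add: bump_profile_nonpos)
  qed
qed

lemma cutoff_L2:
  assumes "w \<in> L2"
  shows "(\<lambda>n. L2_norm (\<lambda>x. cutoff n x *\<^sub>R w x - w x)) \<longlonglongrightarrow> 0"
proof (rule L2_dominated_convergence[where w = "\<lambda>x. (norm (w x))\<^sup>2"])
  note [measurable] = L2_measurable[OF assms]
  have [measurable]: "cutoff n \<in> borel_measurable borel" for n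
    using cutoff_Cc_infinity[of n]
    by (intro borel_measurable_continuous_onI smooth_continuous) (simp add: Cc_infinity_def)
  show "(\<lambda>x. cutoff n x *\<^sub>R w x) \<in> borel_measurable borel" for n by measurable
  show "AE x in lborel. (\<lambda>n. cutoff n x *\<^sub>R w x) \<longlonglongrightarrow> w x"
    using tendsto_scaleR[OF cutoff_tendsto tendsto_const] by (auto simp del: scaleR_left_diff_distrib)
  have "(norm (cutoff n x *\<^sub>R w x - w x))\<^sup>2 \<le> (norm (w x))\<^sup>2" for n x
  proof -
    have "cutoff n x *\<^sub>R w x - w x = (cutoff n x - 1) *\<^sub>R w x" by (simp add: scaleR_diff_left)
    moreover have "\<bar>cutoff n x - 1\<bar> \<le> 1" using cutoff_bounds[of n x] by simp
    ultimately show ?thesis by (simp add: mult_left_le_one_le power_mono)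
  qed
  then show "AE x in lborel. (norm (cutoff n x *\<^sub>R w x - w x))\<^sup>2 \<le> (norm (w x))\<^sup>2" for n by simp
qed (use assms L2_measurable L2_integrable in auto)

text \<open>The commutator of the Dirac expression with a cutoff is, up to the factor \<open>- i\<close>, Clifford
multiplication by the gradient of the cutoff, which is of order \<open>1 / n\<close>.\<close>

lemma cutoff_dirac_L2:
  assumes w: "smooth w" "w \<in> L2" and A: "continuous_on UNIV A" and D: "dirac A w \<in> L2"
  shows "(\<lambda>n. L2_norm (\<lambda>x. dirac A (\<lambda>x. cutoff n x *\<^sub>R w x) x - dirac A w x)) \<longlonglongrightarrow> 0"
proof -
  define G where "G n x = (\<chi> j. partial_deriv j (cutoff n) x)" for n x
  have sc: "smooth (cutoff n)" for n using cutoff_Cc_infinity[of n] by (simp add: Cc_infinity_def)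
  have eq: "dirac A (\<lambda>x. cutoff n x *\<^sub>R w x) x = cutoff n x *\<^sub>R dirac A w x + (- \<i>) *s slash (G n x) (w x)" for n x
    unfolding G_def by (rule dirac_scale) (intro smooth_differentiable sc w)+
  have G: "norm (G n x) \<le> 12 * exp 1 / real (Suc n)" for n x
  proof -
    have "norm (G n x) \<le> (\<Sum>j\<in>UNIV. \<bar>G n x $ j\<bar>)" by (rule norm_le_l1_cart)
    also have "\<dots> \<le> (\<Sum>j\<in>(UNIV::3 set). 4 * exp 1 / real (Suc n))"
      by (intro sum_mono) (simp add: G_def cutoff_partial_bound del: of_nat_Suc)
    finally show ?thesis by simp
  qed
  let ?C = "36 * exp 1 :: real"
  have sG: "norm ((- \<i>) *s slash (G n x) (w x)) \<le> (?C / real (Suc n)) * norm (w x)" for n x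
  proof -
    have "norm ((- \<i>) *s slash (G n x) (w x)) \<le> 3 * norm (G n x) * norm (w x)"
      using norm_slash_le by (simp add: norm_smult)
    also have "\<dots> \<le> 3 * (12 * exp 1 / real (Suc n)) * norm (w x)"
      by (intro mult_mono G) auto
    finally show ?thesis by simp
  qed
  have sG': "norm ((- \<i>) *s slash (G n x) (w x)) \<le> ?C * norm (w x)" for n x
    by (rule order_trans[OF sG], intro mult_right_mono) (auto simp: field_simps)
  show ?thesis
  proof (rule L2_dominated_convergence[where w = "\<lambda>x. 2 * (norm (dirac A w x))\<^sup>2 + 2 * (?C * norm (w x))\<^sup>2"])
    show "dirac A (\<lambda>x. cutoff n x *\<^sub>R w x) \<in> borel_measurable borel" for n
      by (intro borel_measurable_continuous_onI continuous_on_dirac A smooth_C_k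
          smooth_bilinear[OF bounded_bilinear_scaleR] sc w)
    show "AE x in lborel. (\<lambda>n. dirac A (\<lambda>x. cutoff n x *\<^sub>R w x) x) \<longlonglongrightarrow> dirac A w x"
    proof (rule AE_I2)
      fix x
      have "(\<lambda>n. (?C * inverse (real (Suc n))) * norm (w x)) \<longlonglongrightarrow> (?C * 0) * norm (w x)"
        by (intro tendsto_intros LIMSEQ_inverse_real_of_nat)
      then have "(\<lambda>n. (?C / real (Suc n)) * norm (w x)) \<longlonglongrightarrow> 0"
        by (simp add: divide_inverse del: of_nat_Suc)
      then have "(\<lambda>n. (- \<i>) *s slash (G n x) (w x)) \<longlonglongrightarrow> 0"
        by (rule Lim_null_comparison[rotated]) (intro always_eventually allI sG)
      from tendsto_add[OF tendsto_scaleR[OF cutoff_tendsto tendsto_const] this, of x "dirac A w x"]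
      show "(\<lambda>n. dirac A (\<lambda>x. cutoff n x *\<^sub>R w x) x) \<longlonglongrightarrow> dirac A w x"
        by (simp add: eq)
    qed
    show "AE x in lborel. (norm (dirac A (\<lambda>x. cutoff n x *\<^sub>R w x) x - dirac A w x))\<^sup>2
        \<le> 2 * (norm (dirac A w x))\<^sup>2 + 2 * (?C * norm (w x))\<^sup>2" for n
    proof (rule AE_I2)
      fix x
      have "dirac A (\<lambda>x. cutoff n x *\<^sub>R w x) x - dirac A w x
        = (cutoff n x - 1) *\<^sub>R dirac A w x + (- \<i>) *s slash (G n x) (w x)"
        by (simp add: eq scaleR_diff_left)
      then have "(norm (dirac A (\<lambda>x. cutoff n x *\<^sub>R w x) x - dirac A w x))\<^sup>2
        \<le> 2 * (norm ((cutoff n x - 1) *\<^sub>R dirac A w x))\<^sup>2 + 2 * (norm ((- \<i>) *s slash (G n x) (w x)))\<^sup>2"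
        by (simp only: norm_add_sq_le)
      also have "\<dots> \<le> 2 * (norm (dirac A w x))\<^sup>2 + 2 * (?C * norm (w x))\<^sup>2"
        using cutoff_bounds[of n x] sG'[of n x]
        by (intro add_mono mult_left_mono power_mono) (auto simp: mult_left_le_one_le)
      finally show "(norm (dirac A (\<lambda>x. cutoff n x *\<^sub>R w x) x - dirac A w x))\<^sup>2
        \<le> 2 * (norm (dirac A w x))\<^sup>2 + 2 * (?C * norm (w x))\<^sup>2" .
    qed
    have "integrable lborel (\<lambda>x. 2 * (norm (dirac A w x))\<^sup>2 + 2 * (?C\<^sup>2 * (norm (w x))\<^sup>2))"
      using L2_integrable[OF D] L2_integrable[OF w(2)] by simp
    then show "integrable lborel (\<lambda>x. 2 * (norm (dirac A w x))\<^sup>2 + 2 * (?C * norm (w x))\<^sup>2)"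
      by (simp only: power_mult_distrib)
  qed (use L2_measurable[OF D] in auto)
qed

text \<open>Convolution against a fixed point \<open>x\<close> tests with the function \<open>\<rho> (x - y)\<close> of \<open>y\<close>.\<close>

lemma
  fixes \<rho> :: "real^3 \<Rightarrow> real"
  assumes "\<rho> differentiable (at (x - y))"
  shows differentiable_reflect: "(\<lambda>y. \<rho> (x - y)) differentiable (at y)"
    and partial_deriv_reflect: "partial_deriv j (\<lambda>y. \<rho> (x - y)) y = - partial_deriv j \<rho> (x - y)"
proof -
  have D: "(\<rho> has_derivative frechet_derivative \<rho> (at (x - y))) (at (x - y))"
    using assms by (simp add: frechet_derivative_works)
  have "((\<lambda>y. x - y) has_derivative (\<lambda>h. - h)) (at y)"
    by (auto intro!: derivative_eq_intros)
  from has_derivative_compose[OF this D]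
  have E: "((\<lambda>y. \<rho> (x - y)) has_derivative (\<lambda>h. frechet_derivative \<rho> (at (x - y)) (- h))) (at y)" .
  then show "(\<lambda>y. \<rho> (x - y)) differentiable (at y)" by (auto simp: differentiable_def)
  show "partial_deriv j (\<lambda>y. \<rho> (x - y)) y = - partial_deriv j \<rho> (x - y)"
    unfolding partial_deriv_eq[OF E]
    by (simp add: linear_neg[OF has_derivative_linear[OF D]] partial_deriv_def)
qed

lemma smooth_reflect:
  fixes \<rho> :: "real^3 \<Rightarrow> real"
  assumes "smooth \<rho>"
  shows "smooth (\<lambda>y. \<rho> (x - y))"
proof (rule smooth_coinduct[where P = "\<lambda>f. \<exists>\<rho>. smooth \<rho> \<and> f = (\<lambda>y. \<rho> (x - y))"])
  fix f :: "real^3 \<Rightarrow> real" assume "\<exists>\<rho>. smooth \<rho> \<and> f = (\<lambda>y. \<rho> (x - y))"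
  then obtain \<rho> where \<rho>: "smooth \<rho>" "f = (\<lambda>y. \<rho> (x - y))" by blast
  have "smooth (\<lambda>y. - partial_deriv j \<rho> y)" for j
    by (intro smooth_linear[OF bounded_linear_minus[OF bounded_linear_ident]] smooth_partial \<rho>)
  moreover have "partial_deriv j f = (\<lambda>y. - partial_deriv j \<rho> (x - y))" for j
    unfolding \<rho>(2) by (intro ext partial_deriv_reflect smooth_differentiable \<rho>)
  moreover have "f differentiable (at y)" for y
    unfolding \<rho>(2) by (intro differentiable_reflect smooth_differentiable \<rho>)
  ultimately show "(\<forall>x. f differentiable at x) \<and>
      (\<forall>j. \<exists>\<rho>. smooth \<rho> \<and> partial_deriv j f = (\<lambda>y. \<rho> (x - y)))"
    by blast
qed (use assms in blast)

lemma sdot_eqI: "(\<And>c. sdot a c = sdot b c) \<Longrightarrow> a = b"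
  using sdot_self[of "a - b"] by (simp add: sdot_diff_left)

lemma sdot_conv:
  assumes "continuous_on UNIV \<rho>" "\<And>x. norm x > R \<Longrightarrow> \<rho> x = (0::real)" "u \<in> L2"
  shows "sdot (conv \<rho> u x) c = (LINT y|lborel. sdot (u y) (\<rho> (x - y) *\<^sub>R c))"
proof -
  have "(LINT y|lborel. sdot (\<rho> (x - y) *\<^sub>R u y) c) = sdot (conv \<rho> u x) c"
    unfolding conv_def
    by (rule integral_bounded_linear[OF bounded_bilinear.bounded_linear_left[OF bounded_bilinear_sdot]
          integrable_conv[OF assms]])
  then show ?thesis by (simp add: sdot_scaleR_left sdot_scaleR_right)
qed

text \<open>Mollification turns the weak equation into a pointwise one: testing against the translated
  and reflected mollifier times a constant spinor gives every component.\<close>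

lemma dirac_conv:
  assumes u: "u \<in> L2" and g: "g \<in> L2" and \<rho>: "\<rho> \<in> Cc_infinity"
    and weak: "\<And>f. f \<in> Cc_infinity \<Longrightarrow> L2_inner u (dirac (\<lambda>x. 0) f) = L2_inner g f"
  shows "dirac (\<lambda>x. 0) (conv \<rho> u) x = conv \<rho> g x"
proof (rule sdot_eqI)
  fix c :: "complex^2"
  obtain R where R: "smooth \<rho>" "\<And>x. norm x > R \<Longrightarrow> \<rho> x = 0" using Cc_infinityE[OF \<rho>] by metis
  define f where "f y = \<rho> (x - y) *\<^sub>R c" for y
  have sr: "smooth (\<lambda>y. \<rho> (x - y))" by (rule smooth_reflect[OF R(1)])
  have "smooth f" unfolding f_def[abs_def]
    by (intro smooth_linear[OF bounded_linear_scaleR_left] sr)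
  moreover have "f y = 0" if "norm y > R + norm x" for y :: "real^3"
  proof -
    have "norm (x - y) > R"
      using that norm_triangle_ineq2[of y x] by (simp add: norm_minus_commute)
    then show ?thesis by (simp add: f_def R(2))
  qed
  ultimately have f: "f \<in> Cc_infinity" by (rule Cc_infinityI)
  have df: "partial_deriv j f y = - (partial_deriv j \<rho> (x - y) *\<^sub>R c)" for j y
    unfolding f_def[abs_def]
    by (simp add: partial_deriv_linear[OF bounded_linear_scaleR_left smooth_differentiable[OF sr]]
        partial_deriv_reflect[OF smooth_differentiable[OF R(1)]])
  have cj: "sdot (conv (partial_deriv j \<rho>) u x) d = (LINT y|lborel. sdot (u y) (partial_deriv j \<rho> (x - y) *\<^sub>R d))" for j d
    by (rule sdot_conv[OF smooth_continuous[OF smooth_partial[OF R(1)]]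
          partial_deriv_zero_outside[OF R(2)] u])
  have ij: "integrable lborel (\<lambda>y. sdot (u y) (partial_deriv j \<rho> (x - y) *\<^sub>R d))" for j d
  proof -
    have "integrable lborel (\<lambda>y. sdot (partial_deriv j \<rho> (x - y) *\<^sub>R u y) d)"
      by (rule integrable_bounded_linear[OF bounded_bilinear.bounded_linear_left[OF bounded_bilinear_sdot]
          integrable_conv[OF smooth_continuous[OF smooth_partial[OF R(1)]]
          partial_deriv_zero_outside[OF R(2)] u]])
    then show ?thesis by (simp add: sdot_scaleR_left sdot_scaleR_right)
  qed
  have "sdot (dirac (\<lambda>x. 0) (conv \<rho> u) x) c
      = \<i> * (\<Sum>j\<in>UNIV. sdot (conv (partial_deriv j \<rho>) u x) (pauli j *v c))"
    by (simp add: dirac_eq slash_def partial_deriv_conv[OF \<rho> u] sdot_smult_left sdot_pauli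
        bounded_bilinear.sum_left[OF bounded_bilinear_sdot] sum_negf
        bounded_bilinear.minus_left[OF bounded_bilinear_sdot])
  also have "\<dots> = (LINT y|lborel. \<i> * (\<Sum>j\<in>UNIV. sdot (u y) (partial_deriv j \<rho> (x - y) *\<^sub>R (pauli j *v c))))"
    unfolding cj using ij by simp
  also have "\<dots> = (LINT y|lborel. sdot (u y) (dirac (\<lambda>x. 0) f y))"
    by (intro Bochner_Integration.integral_cong)
      (simp_all add: dirac_eq slash_def df sdot_smult_right sdot_scaleR_right
        bounded_bilinear.sum_right[OF bounded_bilinear_sdot] sum_negf
        bounded_bilinear.minus_right[OF bounded_bilinear_sdot]
        linear_neg[OF bounded_linear.linear[OF bounded_linear_pauli]]
        linear_scale[OF bounded_linear.linear[OF bounded_linear_pauli]])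
  also have "\<dots> = L2_inner g f" using weak[OF f] by (simp add: L2_inner_sdot)
  also have "\<dots> = sdot (conv \<rho> g x) c"
    using sdot_conv[OF smooth_continuous[OF R(1)] R(2) g, where x = x and c = c]
    by (simp add: L2_inner_sdot f_def)
  finally show "sdot (dirac (\<lambda>x. 0) (conv \<rho> u) x) c = sdot (conv \<rho> g x) c" .
qed

lemma Cc_infinity_L2: "f \<in> Cc_infinity \<Longrightarrow> f \<in> L2"
  by (metis Cc_infinityE L2_continuous_compact_support smooth_continuous)

lemma cutoff_scale_Cc_infinity: "smooth w \<Longrightarrow> (\<lambda>x. cutoff n x *\<^sub>R w x) \<in> Cc_infinity"
  by (rule Cc_infinity_scaleR_left[OF cutoff_Cc_infinity])

lemma mollification:
  assumes "u \<in> L2" "g \<in> L2" "e > 0"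
  obtains \<rho> where "\<rho> \<in> Cc_infinity" "conv \<rho> u \<in> L2" "L2_norm (\<lambda>x. conv \<rho> u x - u x) \<le> e"
    "conv \<rho> g \<in> L2" "L2_norm (\<lambda>x. conv \<rho> g x - g x) \<le> e"
proof -
  obtain d1 where d1: "d1 > 0" "\<And>y. norm y \<le> d1 \<Longrightarrow> L2_norm (\<lambda>x. u (y + x) - u x) \<le> e"
    using L2_translation_continuous[OF assms(1,3)] by blast
  obtain d2 where d2: "d2 > 0" "\<And>y. norm y \<le> d2 \<Longrightarrow> L2_norm (\<lambda>x. g (y + x) - g x) \<le> e"
    using L2_translation_continuous[OF assms(2,3)] by blast
  obtain \<rho> :: "real^3 \<Rightarrow> real" where \<rho>: "\<rho> \<in> Cc_infinity" "\<And>x. norm x > min d1 d2 \<Longrightarrow> \<rho> x = 0"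
    "\<And>x. \<rho> x \<ge> 0" "\<And>x. \<rho> (- x) = \<rho> x" "(LINT x|lborel. \<rho> x) = 1"
  proof -
    have "min d1 d2 > 0" using d1(1) d2(1) by simp
    from mollifier_exists[OF this] show ?thesis using that by blast
  qed
  have c: "continuous_on UNIV \<rho>" using \<rho>(1) smooth_continuous by (auto simp: Cc_infinity_def)
  have u: "L2_norm (\<lambda>x. u (y + x) - u x) \<le> e" and g: "L2_norm (\<lambda>x. g (y + x) - g x) \<le> e"
    if "norm y \<le> min d1 d2" for y
    using that d1(2) d2(2) by auto
  have *: "conv \<rho> f \<in> L2 \<and> L2_norm (\<lambda>x. conv \<rho> f x - f x) \<le> e"
    if f: "f \<in> L2" "\<And>y. norm y \<le> min d1 d2 \<Longrightarrow> L2_norm (\<lambda>x. f (y + x) - f x) \<le> e" for f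
    using conv_close[where R = "min d1 d2", OF c \<rho>(2-5) f less_imp_le[OF assms(3)]] by simp
  show ?thesis using *[OF assms(1) u] *[OF assms(2) g] by (intro that[OF \<rho>(1)]) simp_all
qed

lemma Cc_infinity_dense:
  assumes "u \<in> L2" "e > 0"
  shows "\<exists>\<phi>\<in>Cc_infinity. L2_norm (\<lambda>x. u x - \<phi> x) < e"
proof -
  obtain \<rho> where \<rho>: "\<rho> \<in> Cc_infinity" "conv \<rho> u \<in> L2" "L2_norm (\<lambda>x. conv \<rho> u x - u x) \<le> e / 2"
    using mollification[OF assms(1,1), of "e / 2"] assms(2) by auto
  let ?w = "conv \<rho> u"
  from order_tendstoD(2)[OF cutoff_L2[OF \<rho>(2)], of "e / 2"] assms(2)
  obtain n where n: "L2_norm (\<lambda>x. cutoff n x *\<^sub>R ?w x - ?w x) < e / 2"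
    by (auto simp: eventually_sequentially)
  have C: "(\<lambda>x. cutoff n x *\<^sub>R ?w x) \<in> Cc_infinity"
    by (rule cutoff_scale_Cc_infinity[OF smooth_conv[OF \<rho>(1) assms(1)]])
  have "L2_norm (\<lambda>x. u x - cutoff n x *\<^sub>R ?w x) < e"
    using L2_norm_diff_triangle[OF assms(1) \<rho>(2) Cc_infinity_L2[OF C]] n \<rho>(3)
    by (simp add: L2_norm_diff_commute[of u ?w] L2_norm_diff_commute[of ?w "\<lambda>x. cutoff n x *\<^sub>R ?w x"])
  then show ?thesis by (rule bexI[OF _ C])
qed

lemma slash_L2:
  assumes A: "A \<in> Cc_infinity" and K: "K \<ge> 0" "\<And>x. norm (A x) \<le> K" and w: "w \<in> L2"
  shows "(\<lambda>x. slash (A x) (w x)) \<in> L2" "L2_norm (\<lambda>x. slash (A x) (w x)) \<le> 3 * K * L2_norm w"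
proof -
  note [measurable] = L2_measurable[OF w]
  have [measurable]: "A \<in> borel_measurable borel"
    using A by (intro borel_measurable_continuous_onI smooth_continuous) (simp add: Cc_infinity_def)
  have "continuous_on UNIV (\<lambda>p. slash (fst p) (snd p))"
    by (intro bounded_bilinear.continuous_on[OF bounded_bilinear_slash] continuous_intros)
  from borel_measurable_continuous_onI[OF this]
  have "(\<lambda>p. slash (fst p) (snd p)) \<in> borel_measurable (borel \<Otimes>\<^sub>M borel)"
    by (simp add: borel_prod)
  from measurable_compose[OF _ this, of "\<lambda>x. (A x, w x)"]
  have m: "(\<lambda>x. slash (A x) (w x)) \<in> borel_measurable borel" by simp
  have le: "norm (slash (A x) (w x)) \<le> 3 * K * norm (w x)" for x
    by (rule order_trans[OF norm_slash_le]) (intro mult_right_mono mult_left_mono K(2), auto)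
  show "(\<lambda>x. slash (A x) (w x)) \<in> L2" by (rule L2_dominated[OF m w le])
  show "L2_norm (\<lambda>x. slash (A x) (w x)) \<le> 3 * K * L2_norm w"
    by (rule L2_norm_mono[OF m w le]) (use K in simp)
qed

lemma dirac_Cc_L2: "A \<in> Cc_infinity \<Longrightarrow> f \<in> Cc_infinity \<Longrightarrow> dirac A f \<in> L2"
  by (metis Cc_infinityE dirac_L2 smooth_C_k smooth_continuous)

text \<open>With \<open>g = v + (\<sigma> \<cdot> A) u\<close> the pair \<open>(u, g)\<close> solves the free equation weakly, so the mollified pair solves
it pointwise. As the potential is bounded, subtracting \<open>(\<sigma> \<cdot> A)\<close> applied to the mollified \<open>u\<close> still gives a
function close to \<open>v\<close>. A cutoff then makes the support compact.\<close>

theorem graph_approximation: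
  assumes A: "A \<in> Cc_infinity" and uv: "(u, v) \<in> op_adjoint (weyl_dirac_min A)" and e: "e > 0"
  shows "\<exists>\<phi>\<in>Cc_infinity. L2_norm (\<lambda>x. u x - \<phi> x) < e \<and> L2_norm (\<lambda>x. v x - dirac A \<phi> x) < e"
proof -
  have u: "u \<in> L2" and v: "v \<in> L2"
    and adj: "\<And>f. f \<in> Cc_infinity \<Longrightarrow> L2_inner u (dirac A f) = L2_inner v f"
    using uv by (auto simp: op_adjoint_def weyl_dirac_min_def)
  have cA: "continuous_on UNIV A" using A smooth_continuous by (auto simp: Cc_infinity_def)
  obtain K where K: "K > 0" "\<And>x. norm (A x) \<le> K"
    using Cc_infinityE[OF A] compact_support_bounded[OF smooth_continuous] by metis
  note sl = slash_L2[OF A less_imp_le[OF K(1)] K(2)]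
  define g where "g x = v x + slash (A x) (u x)" for x
  have g: "g \<in> L2" unfolding g_def by (intro L2_add v sl u)
  have weak: "L2_inner u (dirac (\<lambda>x. 0) f) = L2_inner g f" if f: "f \<in> Cc_infinity" for f
  proof -
    note fL = Cc_infinity_L2[OF f]
    have "L2_inner u (dirac (\<lambda>x. 0) f) = (LINT x|lborel. sdot (u x) (dirac A f x) + sdot (u x) (slash (A x) (f x)))"
      unfolding L2_inner_sdot dirac_potential[of A] by (simp flip: sdot_add_right)
    also have "\<dots> = L2_inner u (dirac A f) + (LINT x|lborel. sdot (slash (A x) (u x)) (f x))"
      unfolding L2_inner_sdot sdot_slash
      by (intro Bochner_Integration.integral_add integrable_sdot u dirac_Cc_L2[OF A f] sl fL)
    also have "\<dots> = L2_inner g f"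
      unfolding adj[OF f] unfolding L2_inner_sdot g_def sdot_add_left
      by (rule Bochner_Integration.integral_add[symmetric]; intro integrable_sdot v u sl fL)
    finally show ?thesis .
  qed
  \<comment> \<open>The mollification errors of \<open>g\<close> and \<open>(\<sigma> \<cdot> A) u\<close>, at most \<open>e'\<close> and \<open>3 * K * e'\<close>, then add up to \<open>e / 2\<close>;
    the other half is left to the cutoff.\<close>
  define e' where "e' = e / (2 * (1 + 3 * K))"
  have e'pos: "e' > 0" using e K(1) by (simp add: e'_def)
  have "2 * (1 + 3 * K) \<noteq> 0" using K(1) by simp
  then have "e' * (2 * (1 + 3 * K)) = e" unfolding e'_def by (rule nonzero_eq_divide_eq[THEN iffD1, OF _ refl])
  then have "e' + 3 * K * e' = e / 2" by (simp add: algebra_simps)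
  with mult_pos_pos[OF K(1) e'pos] have e': "e' > 0" "e' + 3 * K * e' = e / 2" "e' \<le> e / 2"
    using e'pos by auto
  obtain \<rho> where \<rho>: "\<rho> \<in> Cc_infinity" "conv \<rho> u \<in> L2" "L2_norm (\<lambda>x. conv \<rho> u x - u x) \<le> e'"
    "conv \<rho> g \<in> L2" "L2_norm (\<lambda>x. conv \<rho> g x - g x) \<le> e'"
    using mollification[OF u g e'(1)] by blast
  define w where "w = conv \<rho> u"
  have w: "smooth w" "w \<in> L2" unfolding w_def using smooth_conv[OF \<rho>(1) u] \<rho>(2) by auto
  have Dw: "dirac A w x = conv \<rho> g x - slash (A x) (w x)" for x
    unfolding dirac_potential[of A] w_def using dirac_conv[OF u g \<rho>(1) weak] by simp
  have DwL: "dirac A w \<in> L2"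
    using L2_diff[OF \<rho>(4) sl(1)[OF w(2)]] by (simp add: Dw[abs_def])
  have wu: "L2_norm (\<lambda>x. u x - w x) \<le> e'" using \<rho>(3) L2_norm_diff_commute[of u w] by (simp add: w_def)
  have "L2_norm (\<lambda>x. v x - dirac A w x) \<le> L2_norm (\<lambda>x. g x - conv \<rho> g x) + L2_norm (\<lambda>x. slash (A x) (w x - u x))"
  proof -
    have eq: "v x - dirac A w x = (g x - conv \<rho> g x) + slash (A x) (w x - u x)" for x
      by (simp add: Dw g_def bounded_bilinear.diff_right[OF bounded_bilinear_slash])
    show ?thesis unfolding eq
      by (intro L2_norm_triangle L2_diff g \<rho> sl w u)
  qed
  also have "\<dots> \<le> e' + 3 * K * e'"
  proof (intro add_mono)
    show "L2_norm (\<lambda>x. g x - conv \<rho> g x) \<le> e'" using \<rho>(5) by (simp add: L2_norm_diff_commute[of g "conv \<rho> g"])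
    have "L2_norm (\<lambda>x. slash (A x) (w x - u x)) \<le> 3 * K * L2_norm (\<lambda>x. w x - u x)"
      by (intro sl(2) L2_diff w u)
    also have "\<dots> \<le> 3 * K * e'"
      using \<rho>(3) K(1) by (intro mult_left_mono) (auto simp: w_def)
    finally show "L2_norm (\<lambda>x. slash (A x) (w x - u x)) \<le> 3 * K * e'" .
  qed
  finally have Dwv: "L2_norm (\<lambda>x. v x - dirac A w x) \<le> e / 2" by (simp add: e'(2))
  have "\<forall>\<^sub>F n in sequentially. L2_norm (\<lambda>x. cutoff n x *\<^sub>R w x - w x) < e / 2 \<and>
      L2_norm (\<lambda>x. dirac A (\<lambda>x. cutoff n x *\<^sub>R w x) x - dirac A w x) < e / 2"
    using e by (intro eventually_conj order_tendstoD(2)[OF cutoff_L2[OF w(2)]]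
        order_tendstoD(2)[OF cutoff_dirac_L2[OF w cA DwL]]) auto
  then obtain n where n: "L2_norm (\<lambda>x. cutoff n x *\<^sub>R w x - w x) < e / 2"
      "L2_norm (\<lambda>x. dirac A (\<lambda>x. cutoff n x *\<^sub>R w x) x - dirac A w x) < e / 2"
    by (auto simp: eventually_sequentially)
  define \<phi> where "\<phi> x = cutoff n x *\<^sub>R w x" for x
  have C: "\<phi> \<in> Cc_infinity" unfolding \<phi>_def[abs_def] by (rule cutoff_scale_Cc_infinity[OF w(1)])
  have "L2_norm (\<lambda>x. u x - \<phi> x) < e"
    using L2_norm_diff_triangle[OF u w(2) Cc_infinity_L2[OF C]] n(1) wu e'(3)
    by (simp add: L2_norm_diff_commute[of w "\<lambda>x. cutoff n x *\<^sub>R w x"] \<phi>_def[abs_def])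
  moreover have "L2_norm (\<lambda>x. v x - dirac A \<phi> x) < e"
    using L2_norm_diff_triangle[OF v DwL dirac_Cc_L2[OF A C]] n(2) Dwv
    by (simp add: L2_norm_diff_commute[of "dirac A w" "dirac A (\<lambda>x. cutoff n x *\<^sub>R w x)"] \<phi>_def[abs_def])
  ultimately show ?thesis using C by blast
qed

section \<open>Essential self-adjointness\<close>

lemma op_adjoint_antimono: "S \<subseteq> T \<Longrightarrow> op_adjoint T \<subseteq> op_adjoint S"
  unfolding op_adjoint_def by blast

lemma weyl_dirac_min_symmetric:
  assumes A: "A \<in> Cc_infinity"
  shows "weyl_dirac_min A \<subseteq> op_adjoint (weyl_dirac_min A)"
proof -
  have "L2_inner f (dirac A g) = L2_inner (dirac A f) g" if fg: "f \<in> Cc_infinity" "g \<in> Cc_infinity" for f g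
  proof -
    obtain R where R: "smooth f" "\<And>x. norm x > R \<Longrightarrow> f x = 0" using Cc_infinityE[OF fg(1)] by metis
    obtain R' where R': "smooth g" "\<And>x. norm x > R' \<Longrightarrow> g x = 0" using Cc_infinityE[OF fg(2)] by metis
    show ?thesis
      by (rule dirac_symmetric[where R = "max R R'", OF smooth_C_k[OF R(1)] _ smooth_C_k[OF R'(1)]])
        (use R R' A smooth_continuous in \<open>auto simp: Cc_infinity_def\<close>)
  qed
  then show ?thesis
    using Cc_infinity_L2 dirac_Cc_L2[OF A] by (auto simp: op_adjoint_def weyl_dirac_min_def)
qed

text \<open>By the graph approximation, the defining relation of the adjoint passes from test fields to all pairs
in the adjoint.\<close>

lemma adjoint_min_symmetric:
  assumes A: "A \<in> Cc_infinity"
  shows "op_adjoint (weyl_dirac_min A) \<subseteq> op_adjoint (op_adjoint (weyl_dirac_min A))"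
proof -
  let ?S = "op_adjoint (weyl_dirac_min A)"
  have "L2_inner f v = L2_inner g u" if fg: "(f, g) \<in> ?S" and uv: "(u, v) \<in> ?S" for f g u v
  proof (rule ccontr)
    assume ne: "L2_inner f v \<noteq> L2_inner g u"
    have L: "f \<in> L2" "g \<in> L2" "u \<in> L2" "v \<in> L2" using fg uv by (auto simp: op_adjoint_def)
    define m where "m = norm (L2_inner f v - L2_inner g u)"
    define e where "e = m / (L2_norm f + L2_norm g + 1)"
    have pos: "L2_norm f + L2_norm g + 1 > 0"
      using L2_norm_nonneg[of f] L2_norm_nonneg[of g] by simp
    have m: "m > 0" using ne by (simp add: m_def)
    then have "e > 0" using pos by (simp add: e_def)
    from graph_approximation[OF A uv this] obtain \<phi> where
      \<phi>: "\<phi> \<in> Cc_infinity" "L2_norm (\<lambda>x. u x - \<phi> x) < e" "L2_norm (\<lambda>x. v x - dirac A \<phi> x) < e"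
      by blast
    note L' = Cc_infinity_L2[OF \<phi>(1)] dirac_Cc_L2[OF A \<phi>(1)]
    have eq: "L2_inner f (dirac A \<phi>) = L2_inner g \<phi>"
      using fg \<phi>(1) by (auto simp: op_adjoint_def weyl_dirac_min_def)
    have "m = norm (L2_inner f (\<lambda>x. v x - dirac A \<phi> x) - L2_inner g (\<lambda>x. u x - \<phi> x))"
      using L L' by (simp add: m_def L2_inner_diff_right eq)
    also have "\<dots> \<le> norm (L2_inner f (\<lambda>x. v x - dirac A \<phi> x)) + norm (L2_inner g (\<lambda>x. u x - \<phi> x))"
      by (rule norm_triangle_ineq4)
    also have "\<dots> \<le> L2_norm f * L2_norm (\<lambda>x. v x - dirac A \<phi> x) + L2_norm g * L2_norm (\<lambda>x. u x - \<phi> x)"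
      by (intro add_mono norm_L2_inner_le L2_diff L L')
    also have "\<dots> \<le> L2_norm f * e + L2_norm g * e"
      using \<phi> L2_norm_nonneg by (intro add_mono mult_left_mono) auto
    also have "\<dots> < (L2_norm f + L2_norm g + 1) * e"
      using \<open>e > 0\<close> by (simp add: algebra_simps)
    also have "\<dots> = m" using pos by (simp add: e_def)
    finally show False by simp
  qed
  note sym = this
  have L2: "f \<in> L2" "g \<in> L2" if "(f, g) \<in> ?S" for f g
    using that by (auto simp: op_adjoint_def)
  show ?thesis
  proof (rule subrelI)
    fix f g assume fg: "(f, g) \<in> ?S"
    then show "(f, g) \<in> op_adjoint ?S"
      unfolding op_adjoint_def[of "?S"] using L2[OF fg] sym[OF fg] by simp blast
  qed
qed

text \<open>A self-adjoint extension lies between the minimal operator and its adjoint. Once the adjoint is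
symmetric it is itself self-adjoint, and taking adjoints reverses the inclusion.\<close>

theorem weyl_dirac_eq_adjoint:
  assumes A: "A \<in> Cc_infinity"
  shows "weyl_dirac A = op_adjoint (weyl_dirac_min A)"
proof -
  let ?M = "weyl_dirac_min A" and ?S = "op_adjoint (weyl_dirac_min A)"
  have MS: "?M \<subseteq> ?S" by (rule weyl_dirac_min_symmetric[OF A])
  have SS: "op_adjoint ?S = ?S"
    using adjoint_min_symmetric[OF A] op_adjoint_antimono[OF MS] by blast
  have "Cc_infinity \<subseteq> Domain ?S" using MS by (auto simp: weyl_dirac_min_def)
  moreover have "Domain ?S \<subseteq> L2" by (auto simp: op_adjoint_def)
  ultimately have "densely_defined ?S"
    using Cc_infinity_dense unfolding densely_defined_def by blast
  then have sa: "self_adjoint ?S" using SS by (simp add: self_adjoint_def)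
  have unique: "T = ?S" if T: "self_adjoint T" "?M \<subseteq> T" for T
  proof -
    have TT: "op_adjoint T = T" using T by (simp add: self_adjoint_def)
    have TS: "T \<subseteq> ?S" using op_adjoint_antimono[OF T(2)] TT by simp
    then have "?S \<subseteq> T" using op_adjoint_antimono[OF TS] SS TT by simp
    with TS show ?thesis by blast
  qed
  show ?thesis unfolding weyl_dirac_def
  proof (rule the_equality)
    show "self_adjoint ?S \<and> ?M \<subseteq> ?S" using sa MS by simp
    show "T = ?S" if "self_adjoint T \<and> ?M \<subseteq> T" for T
      by (rule unique[OF conjunct1[OF that] conjunct2[OF that]])
  qed
qed

section \<open>Rotations about the third axis\<close>

text \<open>Rotation by the angle \<open>- \<theta>\<close>: a field is rotated by \<open>\<theta>\<close> when it is evaluated at points turned back.\<close>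

definition rot :: "real \<Rightarrow> real^3 \<Rightarrow> real^3" where
  "rot \<theta> x = vector [cos \<theta> * x $ 1 + sin \<theta> * x $ 2, - sin \<theta> * x $ 1 + cos \<theta> * x $ 2, x $ 3]"

definition spin :: "real \<Rightarrow> complex^2 \<Rightarrow> complex^2" where
  "spin \<theta> a = vector [cis (- \<theta> / 2) * a $ 1, cis (\<theta> / 2) * a $ 2]"

definition rotated :: "real \<Rightarrow> spinor_field \<Rightarrow> spinor_field" where
  "rotated \<theta> f x = spin \<theta> (f (rot \<theta> x))"

text \<open>This is \<open>- i J\<close> for the angular momentum \<open>J = L\<^sub>3 + \<sigma>\<^sub>3 / 2\<close>.\<close>

definition generator :: "spinor_field \<Rightarrow> spinor_field" where
  "generator f x = x $ 2 *\<^sub>R partial_deriv 1 f x - x $ 1 *\<^sub>R partial_deriv 2 f x - (\<i> / 2) *s (pauli 3 *v f x)"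

lemma rot_components [simp]:
  "rot \<theta> x $ 1 = cos \<theta> * x $ 1 + sin \<theta> * x $ 2"
  "rot \<theta> x $ 2 = - sin \<theta> * x $ 1 + cos \<theta> * x $ 2"
  "rot \<theta> x $ 3 = x $ 3"
  by (simp_all add: rot_def)

lemma spin_components [simp]:
  "spin \<theta> a $ 1 = cis (- \<theta> / 2) * a $ 1" "spin \<theta> a $ 2 = cis (\<theta> / 2) * a $ 2"
  by (simp_all add: spin_def)

lemma norm_spin: "norm (spin \<theta> a) = norm a"
  by (simp add: norm_vec_def L2_set_def sum_2 norm_mult)

lemma bounded_linear_spin: "bounded_linear (spin \<theta>)"
proof (rule bounded_linear_intro[where K = 1])
  show "norm (spin \<theta> a) \<le> norm a * 1" for a by (simp add: norm_spin)
qed (simp_all add: vec_eq_iff forall_2 algebra_simps)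

lemma inner_3: "x \<bullet> y = x $ 1 * y $ 1 + x $ 2 * y $ 2 + x $ 3 * y $ 3" for x y :: "real^3"
  by (simp add: inner_vec_def sum_3)

lemma rot_planar: "(rot \<theta> x $ 1)\<^sup>2 + (rot \<theta> x $ 2)\<^sup>2 = (x $ 1)\<^sup>2 + (x $ 2)\<^sup>2"
proof -
  have "(rot \<theta> x $ 1)\<^sup>2 + (rot \<theta> x $ 2)\<^sup>2
      = ((sin \<theta>)\<^sup>2 + (cos \<theta>)\<^sup>2) * ((x $ 1)\<^sup>2 + (x $ 2)\<^sup>2)"
    unfolding rot_components power2_eq_square by algebra
  then show ?thesis by simp
qed

lemma rot_inner_self: "rot \<theta> x \<bullet> rot \<theta> x = x \<bullet> x"
  using rot_planar[of \<theta> x] by (simp add: inner_3 power2_eq_square del: rot_components(1,2))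

lemma norm_rot: "norm (rot \<theta> x) = norm x"
  by (simp add: norm_eq_sqrt_inner rot_inner_self)

lemma rot_add: "rot \<theta> (x + y) = rot \<theta> x + rot \<theta> y"
  and rot_scaleR: "rot \<theta> (r *\<^sub>R x) = r *\<^sub>R rot \<theta> x"
  by (simp_all add: vec_eq_iff forall_3 algebra_simps)

lemma linear_rot: "linear (rot \<theta>)"
  by (rule linearI) (simp_all add: rot_add rot_scaleR)

lemma orthogonal_transformation_rot: "orthogonal_transformation (rot \<theta>)"
  by (simp add: orthogonal_transformation linear_rot norm_rot)

lemma rot_rot_minus: "rot (- \<theta>) (rot \<theta> x) = x"
proof -
  have s: "cos \<theta> * (cos \<theta> * c) + sin \<theta> * (sin \<theta> * c) = c" for c
    using sin_cos_squared_add[of \<theta>] by algebra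
  show ?thesis by (simp add: vec_eq_iff forall_3 algebra_simps s)
qed

lemma continuous_on_rot: "continuous_on UNIV (rot \<theta>)"
  using linear_rot linear_conv_bounded_linear linear_continuous_on by blast

text \<open>Orthogonal maps preserve the volume of boxes, and these determine the measure.\<close>

lemma distr_rot: "distr lborel borel (rot \<theta>) = lborel"
proof (rule lborel_eqI[symmetric])
  fix l u :: "real^3" assume lu: "\<And>b. b \<in> Basis \<Longrightarrow> l \<bullet> b \<le> u \<bullet> b"
  have [measurable]: "rot \<theta> \<in> borel_measurable borel"
    by (rule borel_measurable_continuous_onI[OF continuous_on_rot])
  have im: "rot \<theta> -` box l u = rot (- \<theta>) ` box l u"
    using rot_rot_minus[of \<theta>] rot_rot_minus[of "- \<theta>"] by (auto intro: image_eqI[where x = "rot \<theta> x" for x])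
  have op: "open (rot \<theta> -` box l u)"
    by (intro open_vimage continuous_on_rot open_box)
  have "bounded (rot (- \<theta>) ` box l u)"
    by (intro bounded_linear_image bounded_box) (use linear_rot linear_conv_bounded_linear in blast)
  then have lm: "rot \<theta> -` box l u \<in> lmeasurable"
    using op by (simp add: im bounded_set_imp_lmeasurable lmeasurable_open)
  have "emeasure (distr lborel borel (rot \<theta>)) (box l u) = emeasure lborel (rot \<theta> -` box l u)"
    by (subst emeasure_distr) auto
  also have "\<dots> = emeasure lebesgue (rot \<theta> -` box l u)"
    using op by (simp add: emeasure_completion)
  also have "\<dots> = ennreal (measure lebesgue (rot (- \<theta>) ` box l u))"
    using lm by (simp add: emeasure_eq_measure2 im)
  also have "measure lebesgue (rot (- \<theta>) ` box l u) = measure lebesgue (box l u)"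
    by (intro measure_orthogonal_image orthogonal_transformation_rot) simp
  also have "\<dots> = (\<Prod>b\<in>Basis. (u - l) \<bullet> b)"
    using lu by (simp add: measure_lborel_box_eq measure_completion)
  finally show "emeasure (distr lborel borel (rot \<theta>)) (box l u) = (\<Prod>b\<in>Basis. (u - l) \<bullet> b)" .
qed simp

lemma L2_rotate:
  assumes "f \<in> L2"
  shows "(\<lambda>x. spin \<theta> (f (rot \<theta> x))) \<in> L2" "L2_norm (\<lambda>x. spin \<theta> (f (rot \<theta> x))) = L2_norm f"
proof -
  note [measurable] = L2_measurable[OF assms]
  have [measurable]: "rot \<theta> \<in> borel_measurable borel" "spin \<theta> \<in> borel_measurable borel"
    by (intro borel_measurable_continuous_onI continuous_on_rot linear_continuous_on bounded_linear_spin)+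
  have eq: "(LINT x|lborel. (norm (f (rot \<theta> x)))\<^sup>2) = (LINT x|lborel. (norm (f x))\<^sup>2)"
    using integral_distr[of "rot \<theta>" lborel borel "\<lambda>x. (norm (f x))\<^sup>2"] by (simp add: distr_rot)
  have "integrable lborel (\<lambda>x. (norm (f (rot \<theta> x)))\<^sup>2)"
    using integrable_distr_eq[of "rot \<theta>" lborel borel "\<lambda>x. (norm (f x))\<^sup>2"] L2_integrable[OF assms]
    by (simp add: distr_rot)
  then show "(\<lambda>x. spin \<theta> (f (rot \<theta> x))) \<in> L2"
    by (intro L2I) (simp_all add: norm_spin)
  show "L2_norm (\<lambda>x. spin \<theta> (f (rot \<theta> x))) = L2_norm f"
    by (simp add: L2_norm_def norm_spin eq)
qed

lemma has_derivative_comp_rot: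
  assumes "f differentiable (at (rot \<theta> x))"
  shows "((\<lambda>x. f (rot \<theta> x)) has_derivative
      (\<lambda>h. \<Sum>j\<in>UNIV. (rot \<theta> h $ j) *\<^sub>R partial_deriv j f (rot \<theta> x))) (at x)"
proof -
  have "(rot \<theta> has_derivative rot \<theta>) (at x)"
    using linear_rot linear_conv_bounded_linear bounded_linear_imp_has_derivative by blast
  from has_derivative_compose[OF this has_derivative_partial[OF assms]] show ?thesis .
qed

lemma partial_deriv_rotated:
  assumes "f differentiable (at (rot \<theta> x))"
  shows "partial_deriv 1 (rotated \<theta> f) x
      = spin \<theta> (cos \<theta> *\<^sub>R partial_deriv 1 f (rot \<theta> x) - sin \<theta> *\<^sub>R partial_deriv 2 f (rot \<theta> x))"
    and "partial_deriv 2 (rotated \<theta> f) x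
      = spin \<theta> (sin \<theta> *\<^sub>R partial_deriv 1 f (rot \<theta> x) + cos \<theta> *\<^sub>R partial_deriv 2 f (rot \<theta> x))"
    and "partial_deriv 3 (rotated \<theta> f) x = spin \<theta> (partial_deriv 3 f (rot \<theta> x))"
    and "rotated \<theta> f differentiable (at x)"
proof -
  have D: "(rotated \<theta> f has_derivative
      (\<lambda>h. spin \<theta> (\<Sum>j\<in>UNIV. (rot \<theta> h $ j) *\<^sub>R partial_deriv j f (rot \<theta> x)))) (at x)"
    unfolding rotated_def[abs_def]
    by (rule bounded_linear.has_derivative[OF bounded_linear_spin has_derivative_comp_rot[OF assms]])
  have ax: "axis 1 (1::real) $ (1::3) = 1" "axis 1 (1::real) $ (2::3) = 0" "axis 1 (1::real) $ (3::3) = 0"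
    "axis 2 (1::real) $ (1::3) = 0" "axis 2 (1::real) $ (2::3) = 1" "axis 2 (1::real) $ (3::3) = 0"
    "axis 3 (1::real) $ (1::3) = 0" "axis 3 (1::real) $ (2::3) = 0" "axis 3 (1::real) $ (3::3) = 1"
    by (simp_all add: axis_def)
  show "partial_deriv 1 (rotated \<theta> f) x
      = spin \<theta> (cos \<theta> *\<^sub>R partial_deriv 1 f (rot \<theta> x) - sin \<theta> *\<^sub>R partial_deriv 2 f (rot \<theta> x))"
   "partial_deriv 2 (rotated \<theta> f) x
      = spin \<theta> (sin \<theta> *\<^sub>R partial_deriv 1 f (rot \<theta> x) + cos \<theta> *\<^sub>R partial_deriv 2 f (rot \<theta> x))"
   "partial_deriv 3 (rotated \<theta> f) x = spin \<theta> (partial_deriv 3 f (rot \<theta> x))"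
    unfolding partial_deriv_eq[OF D] by (simp_all add: sum_3 ax)
  show "rotated \<theta> f differentiable (at x)" using D by (auto simp: differentiable_def)
qed

lemma C1_rotated:
  assumes f: "C_k 1 f"
  shows "C_k 1 (rotated \<theta> f)"
proof -
  have df: "f differentiable (at x)" for x using f by simp
  have c: "continuous_on UNIV (\<lambda>x. partial_deriv j f (rot \<theta> x))" for j
    by (rule continuous_on_compose2[OF _ continuous_on_rot]) (use f in auto)
  have "partial_deriv 1 (rotated \<theta> f)
      = (\<lambda>x. spin \<theta> (cos \<theta> *\<^sub>R partial_deriv 1 f (rot \<theta> x) - sin \<theta> *\<^sub>R partial_deriv 2 f (rot \<theta> x)))"
    "partial_deriv 2 (rotated \<theta> f)
      = (\<lambda>x. spin \<theta> (sin \<theta> *\<^sub>R partial_deriv 1 f (rot \<theta> x) + cos \<theta> *\<^sub>R partial_deriv 2 f (rot \<theta> x)))"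
    "partial_deriv 3 (rotated \<theta> f) = (\<lambda>x. spin \<theta> (partial_deriv 3 f (rot \<theta> x)))"
    by (intro ext partial_deriv_rotated df)+
  moreover have "continuous_on UNIV (\<lambda>x. spin \<theta> (a *\<^sub>R partial_deriv 1 f (rot \<theta> x) + b *\<^sub>R partial_deriv 2 f (rot \<theta> x)))"
    "continuous_on UNIV (\<lambda>x. spin \<theta> (a *\<^sub>R partial_deriv 1 f (rot \<theta> x) - b *\<^sub>R partial_deriv 2 f (rot \<theta> x)))"
    "continuous_on UNIV (\<lambda>x. spin \<theta> (partial_deriv 3 f (rot \<theta> x)))" for a b
    by (intro bounded_linear.continuous_on[OF bounded_linear_spin] continuous_intros c)+
  ultimately have "continuous_on UNIV (partial_deriv j (rotated \<theta> f))" for j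
    using exhaust_3[of j] by auto
  then show ?thesis using partial_deriv_rotated(4)[OF df] by simp
qed

lemma rotated_zero: "rotated 0 f = f"
proof
  fix x
  have r: "rot 0 x = x" by (simp add: vec_eq_iff forall_3)
  show "rotated 0 f x = f x" unfolding rotated_def r by (simp add: vec_eq_iff forall_2)
qed

lemma rotated_full_turn: "rotated (2 * pi) f x = - f x"
proof -
  have r: "rot (2 * pi) x = x" by (simp add: vec_eq_iff forall_3)
  have "cis (- pi) = - 1" by (simp add: complex_eq_iff)
  then show ?thesis unfolding rotated_def r by (simp add: vec_eq_iff forall_2)
qed

text \<open>Conjugation by the spin rotation turns \<open>\<sigma>\<^sub>1\<close> and \<open>\<sigma>\<^sub>2\<close> in the plane. On components this is the half-angle
identity below, and it makes the Dirac expression commute with rotations.\<close>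

lemma cis_half_identity:
  "cis (\<theta> / 2) * (complex_of_real (cos \<theta>) - \<i> * complex_of_real (sin \<theta>)) = cis (- \<theta> / 2)"
  "cis (- \<theta> / 2) * (complex_of_real (cos \<theta>) + \<i> * complex_of_real (sin \<theta>)) = cis (\<theta> / 2)"
proof -
  have "complex_of_real (cos \<theta>) - \<i> * complex_of_real (sin \<theta>) = cis (- \<theta>)"
    "complex_of_real (cos \<theta>) + \<i> * complex_of_real (sin \<theta>) = cis \<theta>"
    by (simp_all add: complex_eq_iff)
  then show "cis (\<theta> / 2) * (complex_of_real (cos \<theta>) - \<i> * complex_of_real (sin \<theta>)) = cis (- \<theta> / 2)"
    "cis (- \<theta> / 2) * (complex_of_real (cos \<theta>) + \<i> * complex_of_real (sin \<theta>)) = cis (\<theta> / 2)"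
    by (simp_all add: cis_mult)
qed

lemma dirac_rotated:
  assumes f: "f differentiable (at (rot \<theta> x))"
    and A: "A x $ 1 = 0" "A x $ 2 = 0" "A (rot \<theta> x) = A x"
  shows "dirac A (rotated \<theta> f) x = spin \<theta> (dirac A f (rot \<theta> x))"
proof -
  define p where "p j = partial_deriv j f (rot \<theta> x)" for j
  define c c' C S where "c = cis (\<theta> / 2)" "c' = cis (- \<theta> / 2)"
    "C = complex_of_real (cos \<theta>)" "S = complex_of_real (sin \<theta>)"
  have h: "c * (C - \<i> * S) = c'" "c' * (C + \<i> * S) = c"
    unfolding c_c'_C_S_def by (rule cis_half_identity)+
  have "dirac A (rotated \<theta> f) x $ 1 = - \<i> * (c' * p 3 $ 1) - A x $ 3 * (c' * f (rot \<theta> x) $ 1)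
      - \<i> * (c * (C * p 1 $ 2 - S * p 2 $ 2)) - c * (S * p 1 $ 2 + C * p 2 $ 2)"
    by (simp add: dirac_components partial_deriv_rotated[OF f] A p_def c_c'_C_S_def rotated_def
        scaleR_conv_of_real[where 'a = complex] algebra_simps)
  also have "\<dots> = c' * (- \<i> * p 3 $ 1 - A x $ 3 * f (rot \<theta> x) $ 1)
      + (c * (C - \<i> * S)) * (- \<i> * p 1 $ 2 - p 2 $ 2)"
    by (simp add: algebra_simps)
  also have "\<dots> = spin \<theta> (dirac A f (rot \<theta> x)) $ 1"
    unfolding h by (simp add: dirac_components A p_def c_c'_C_S_def algebra_simps)
  finally have 1: "dirac A (rotated \<theta> f) x $ 1 = spin \<theta> (dirac A f (rot \<theta> x)) $ 1" .
  have "dirac A (rotated \<theta> f) x $ 2 = \<i> * (c * p 3 $ 2) + A x $ 3 * (c * f (rot \<theta> x) $ 2)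
      - \<i> * (c' * (C * p 1 $ 1 - S * p 2 $ 1)) + c' * (S * p 1 $ 1 + C * p 2 $ 1)"
    by (simp add: dirac_components partial_deriv_rotated[OF f] A p_def c_c'_C_S_def rotated_def
        scaleR_conv_of_real[where 'a = complex] algebra_simps)
  also have "\<dots> = c * (\<i> * p 3 $ 2 + A x $ 3 * f (rot \<theta> x) $ 2)
      + (c' * (C + \<i> * S)) * (- \<i> * p 1 $ 1 + p 2 $ 1)"
    by (simp add: algebra_simps)
  also have "\<dots> = spin \<theta> (dirac A f (rot \<theta> x)) $ 2"
    unfolding h by (simp add: dirac_components A p_def c_c'_C_S_def algebra_simps)
  finally show ?thesis using 1 by (simp only: vec_eq_iff forall_2)
qed

lemma generator_rotated:
  assumes f: "f differentiable (at (rot \<theta> x))"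
  shows "generator (rotated \<theta> f) x = spin \<theta> (generator f (rot \<theta> x))"
  by (simp add: vec_eq_iff forall_2 generator_def partial_deriv_rotated[OF f] rotated_def
      pauli_components scaleR_conv_of_real[where 'a = complex] algebra_simps)

lemma rotated_has_vector_derivative:
  assumes f: "f differentiable (at (rot \<theta> x))"
  shows "((\<lambda>\<theta>. rotated \<theta> f x) has_vector_derivative spin \<theta> (generator f (rot \<theta> x))) (at \<theta>)"
proof -
  define y where "y = rot \<theta> x"
  have rd: "((\<lambda>\<theta>. rot \<theta> x) has_derivative (\<lambda>t. t *\<^sub>R (vector [y $ 2, - (y $ 1), 0] :: real^3))) (at \<theta>)"
  proof -
    have e: "(\<lambda>\<theta>. rot \<theta> x) = (\<lambda>\<theta>. cos \<theta> *\<^sub>R vector [x $ 1, x $ 2, 0] + sin \<theta> *\<^sub>R vector [x $ 2, - (x $ 1), 0]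
        + vector [0, 0, x $ 3])"
      by (auto simp: fun_eq_iff vec_eq_iff forall_3)
    show ?thesis unfolding e
      by (auto intro!: derivative_eq_intros simp: fun_eq_iff vec_eq_iff forall_3 y_def algebra_simps)
  qed
  have "((\<lambda>\<theta>. f (rot \<theta> x)) has_derivative
      (\<lambda>t. \<Sum>j\<in>UNIV. ((t *\<^sub>R (vector [y $ 2, - (y $ 1), 0] :: real^3)) $ j) *\<^sub>R partial_deriv j f y)) (at \<theta>)"
    using has_derivative_compose[OF rd has_derivative_partial[OF f]] by (simp add: y_def)
  then have g: "((\<lambda>\<theta>. f (rot \<theta> x)) has_vector_derivative
      (y $ 2 *\<^sub>R partial_deriv 1 f y - y $ 1 *\<^sub>R partial_deriv 2 f y)) (at \<theta>)"
    by (simp add: has_vector_derivative_def sum_3 algebra_simps)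
  have gi: "((\<lambda>\<theta>. f (rot \<theta> x) $ i) has_vector_derivative
      (y $ 2 *\<^sub>R partial_deriv 1 f y - y $ 1 *\<^sub>R partial_deriv 2 f y) $ i) (at \<theta>)" for i
    by (rule bounded_linear.has_vector_derivative[OF bounded_linear_vec_nth g])
  have ci: "((\<lambda>\<theta>. cis (s * \<theta>)) has_vector_derivative of_real s * (\<i> * cis (s * \<theta>))) (at \<theta>)" for s
  proof -
    have "((\<lambda>z. exp (\<i> * (of_real s * z))) has_field_derivative
        of_real s * (\<i> * exp (\<i> * (of_real s * of_real \<theta>)))) (at (of_real \<theta>))"
      by (auto intro!: derivative_eq_intros)
    from has_vector_derivative_real_field[OF this] show ?thesis by (simp add: cis_conv_exp)
  qed
  define d where "d = spin \<theta> (generator f y)"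
  have d1: "((\<lambda>\<theta>. rotated \<theta> f x $ 1) has_vector_derivative d $ 1) (at \<theta>)"
    using has_vector_derivative_mult[OF ci[of "- 1 / 2"] gi[of 1]]
    by (simp add: rotated_def d_def generator_def y_def[symmetric] pauli_components algebra_simps)
  have d2: "((\<lambda>\<theta>. rotated \<theta> f x $ 2) has_vector_derivative d $ 2) (at \<theta>)"
    using has_vector_derivative_mult[OF ci[of "1 / 2"] gi[of 2]]
    by (simp add: rotated_def d_def generator_def y_def[symmetric] pauli_components algebra_simps)
  have "((\<lambda>\<theta>. axis 1 (rotated \<theta> f x $ 1) + axis 2 (rotated \<theta> f x $ 2) :: complex^2) has_vector_derivative
      axis 1 (d $ 1) + axis 2 (d $ 2)) (at \<theta>)"
    by (intro has_vector_derivative_add bounded_linear.has_vector_derivative[OF bounded_linear_axis] d1 d2)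
  moreover have "axis 1 (a $ 1) + axis 2 (a $ 2) = a" for a :: "complex^2"
    by (simp add: vec_eq_iff forall_2 axis_def)
  ultimately show ?thesis by (simp only: d_def y_def)
qed

section \<open>A lower bound for axial potentials\<close>

definition planar :: "real^3 \<Rightarrow> real" where
  "planar x = (x $ 1)\<^sup>2 + (x $ 2)\<^sup>2"

text \<open>The regularised reciprocal of the distance to the axis.\<close>

definition weight :: "real \<Rightarrow> real^3 \<Rightarrow> real" where
  "weight \<epsilon> x = inverse (sqrt (planar x + \<epsilon>\<^sup>2))"

text \<open>This equals \<open>\<epsilon>\<^sup>2\<close> times the cube of the weight. In the present form it is a polynomial in the weight, so
that the anticommutator identity is an identity of polynomials.\<close>

definition excess :: "real \<Rightarrow> real^3 \<Rightarrow> real" where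
  "excess \<epsilon> x = weight \<epsilon> x - planar x * (weight \<epsilon> x) ^ 3"

text \<open>The velocity field of the rotations about the third axis.\<close>

definition axial :: "real^3 \<Rightarrow> real^3" where
  "axial x = vector [- (x $ 2), x $ 1, 0]"

lemma planar_nonneg: "planar x \<ge> 0"
  by (simp add: planar_def)

lemma axial_components [simp]: "axial x $ 1 = - (x $ 2)" "axial x $ 2 = x $ 1" "axial x $ 3 = 0"
  by (simp_all add: axial_def)

lemma norm_axial: "norm (axial x) = sqrt (planar x)"
  by (simp add: norm_eq_sqrt_inner inner_3 planar_def power2_eq_square)

lemma weight_radius:
  assumes "\<epsilon> > 0"
  shows "planar x + \<epsilon>\<^sup>2 > 0" "weight \<epsilon> x > 0" "(weight \<epsilon> x)\<^sup>2 * (planar x + \<epsilon>\<^sup>2) = 1"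
proof -
  show p: "planar x + \<epsilon>\<^sup>2 > 0" using assms by (intro add_nonneg_pos planar_nonneg) simp
  then show "weight \<epsilon> x > 0" by (simp add: weight_def)
  show "(weight \<epsilon> x)\<^sup>2 * (planar x + \<epsilon>\<^sup>2) = 1"
    using p by (simp add: weight_def power_inverse)
qed

lemma weight_le:
  assumes "\<epsilon> > 0" "c > 0" "c\<^sup>2 \<le> planar x + \<epsilon>\<^sup>2"
  shows "weight \<epsilon> x \<le> 1 / c"
proof -
  have "c \<le> sqrt (planar x + \<epsilon>\<^sup>2)" using assms by (intro real_le_rsqrt) auto
  then show ?thesis using assms by (simp add: weight_def inverse_eq_divide frac_le)
qed

lemma excess_eq: "\<epsilon> > 0 \<Longrightarrow> excess \<epsilon> x = \<epsilon>\<^sup>2 * (weight \<epsilon> x) ^ 3"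
  using weight_radius(3)[of \<epsilon> x] unfolding excess_def by algebra

lemma norm_weight_axial: "\<epsilon> > 0 \<Longrightarrow> norm (weight \<epsilon> x *\<^sub>R axial x) \<le> 1"
proof -
  assume e: "\<epsilon> > 0"
  have "sqrt (planar x) \<le> sqrt (planar x + \<epsilon>\<^sup>2)" by simp
  then show ?thesis using weight_radius(1,2)[OF e, of x]
    by (simp add: norm_axial weight_def divide_simps mult.commute flip: divide_inverse)
qed

lemma weight_has_derivative:
  assumes e: "\<epsilon> > 0"
  shows "(weight \<epsilon> has_derivative (\<lambda>h. - ((weight \<epsilon> x) ^ 3) * (x $ 1 * h $ 1 + x $ 2 * h $ 2))) (at x)"
proof -
  let ?q = "planar x + \<epsilon>\<^sup>2"
  have q: "?q > 0" by (rule weight_radius(1)[OF e])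
  have "((\<lambda>q. inverse (sqrt q)) has_real_derivative - ((inverse (sqrt ?q)) ^ 3 / 2)) (at ?q)"
    using q by (auto intro!: derivative_eq_intros simp: field_simps power3_eq_cube)
  then have 1: "((\<lambda>q. inverse (sqrt q)) has_derivative (\<lambda>h. - ((inverse (sqrt ?q)) ^ 3 / 2) * h)) (at ?q)"
    unfolding has_field_derivative_def .
  have c: "((\<lambda>x::real^3. x $ i) has_derivative (\<lambda>h. h $ i)) (at x)" for i
    by (intro bounded_linear_imp_has_derivative bounded_linear_vec_nth)
  have 2: "((\<lambda>x. planar x + \<epsilon>\<^sup>2) has_derivative (\<lambda>h. 2 * (x $ 1 * h $ 1 + x $ 2 * h $ 2))) (at x)"
    unfolding planar_def by (auto intro!: derivative_eq_intros c)
  have eq: "- (c / 2) * (2 * z) = - c * z" for c z :: real by simp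
  from has_derivative_compose[OF 2 1, unfolded eq] show ?thesis unfolding weight_def[abs_def] .
qed

lemma C1_weight:
  assumes e: "\<epsilon> > 0"
  shows "C_k 1 (weight \<epsilon>)"
proof -
  have "partial_deriv j (weight \<epsilon>)
      = (\<lambda>x. - ((weight \<epsilon> x) ^ 3) * (x $ 1 * axis j 1 $ 1 + x $ 2 * axis j 1 $ 2))" for j
    by (intro ext partial_deriv_eq weight_has_derivative[OF e])
  moreover have "continuous_on UNIV (weight \<epsilon>)"
    using has_derivative_continuous[OF weight_has_derivative[OF e]]
    by (simp add: continuous_on_eq_continuous_at)
  ultimately have "continuous_on UNIV (partial_deriv j (weight \<epsilon>))" for j
    by (auto intro!: continuous_intros)
  then show ?thesis using weight_has_derivative[OF e] by (auto simp: differentiable_def)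
qed

lemma axial_has_derivative: "(axial has_derivative axial) (at x)"
proof -
  have "linear axial" by (rule linearI) (simp_all add: vec_eq_iff forall_3)
  then show ?thesis using linear_conv_bounded_linear bounded_linear_imp_has_derivative by blast
qed

lemma C1_axial: "C_k 1 axial"
proof -
  have "partial_deriv j axial = (\<lambda>x. axial (axis j 1))" for j
    by (intro ext partial_deriv_eq axial_has_derivative)
  then show ?thesis using axial_has_derivative by (auto simp: differentiable_def)
qed

text \<open>Clifford multiplication by a regularisation of the unit vector field along the orbits of the
rotations.\<close>

definition multiplier :: "real \<Rightarrow> spinor_field \<Rightarrow> spinor_field" where
  "multiplier \<epsilon> f x = slash (weight \<epsilon> x *\<^sub>R axial x) (f x)"

lemma C1_multiplier: "\<epsilon> > 0 \<Longrightarrow> C_k 1 f \<Longrightarrow> C_k 1 (multiplier \<epsilon> f)"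
  unfolding multiplier_def[abs_def]
  by (intro C_k_bilinear[OF bounded_bilinear_slash] C_k_bilinear[OF bounded_bilinear_scaleR]
      C1_weight C1_axial)

lemma norm_multiplier_le: "\<epsilon> > 0 \<Longrightarrow> norm (multiplier \<epsilon> f x) \<le> 3 * norm (f x)"
proof -
  assume e: "\<epsilon> > 0"
  have "norm (multiplier \<epsilon> f x) \<le> 3 * norm (weight \<epsilon> x *\<^sub>R axial x) * norm (f x)"
    unfolding multiplier_def by (rule norm_slash_le)
  also have "\<dots> \<le> 3 * 1 * norm (f x)"
    by (intro mult_right_mono mult_left_mono norm_weight_axial e) auto
  finally show ?thesis by simp
qed

lemma multiplier_L2:
  assumes "\<epsilon> > 0" "f \<in> L2" "continuous_on UNIV f"
  shows "multiplier \<epsilon> f \<in> L2" "L2_norm (multiplier \<epsilon> f) \<le> 3 * L2_norm f"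
proof -
  have "continuous_on UNIV (multiplier \<epsilon> f)"
    unfolding multiplier_def[abs_def]
    by (intro bounded_bilinear.continuous_on[OF bounded_bilinear_slash] continuous_intros assms
        C_k_continuous[OF C1_weight] C_k_continuous[OF C1_axial])
  then have m: "multiplier \<epsilon> f \<in> borel_measurable borel" by (rule borel_measurable_continuous_onI)
  show "multiplier \<epsilon> f \<in> L2" by (rule L2_dominated[OF m assms(2) norm_multiplier_le[OF assms(1)]])
  show "L2_norm (multiplier \<epsilon> f) \<le> 3 * L2_norm f"
    by (rule L2_norm_mono[OF m assms(2) norm_multiplier_le[OF assms(1)]]) simp
qed

text \<open>The Clifford relations turn the first-order part into twice the derivative along the weighted rotation
field, and the potential drops out because it is orthogonal to that field. The zeroth-order part is
\<open>\<sigma>\<^sub>3\<close> times the derivative of \<open>r w\<close> with respect to \<open>r\<close> (\<open>w\<close> the weight) plus the spin part \<open>w \<sigma>\<^sub>3\<close> of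
\<open>2 w J\<close>; the former is the excess.\<close>

lemma anticommutator:
  assumes e: "\<epsilon> > 0" and f: "f differentiable (at x)" and A: "A x $ 1 = 0" "A x $ 2 = 0"
  shows "dirac A (multiplier \<epsilon> f) x + multiplier \<epsilon> (dirac A f) x
    = (2 * weight \<epsilon> x) *\<^sub>R (\<i> *s generator f x) + excess \<epsilon> x *\<^sub>R (pauli 3 *v f x)"
proof -
  define w where "w = weight \<epsilon> x"
  define V where "V y = weight \<epsilon> y *\<^sub>R axial y" for y
  have dw: "weight \<epsilon> differentiable (at x)" and dX: "axial differentiable (at x)"
    using weight_has_derivative[OF e] axial_has_derivative by (auto simp: differentiable_def)
  have dV: "V differentiable (at x)" unfolding V_def
    using bounded_bilinear.FDERIV[OF bounded_bilinear_scaleR weight_has_derivative[OF e] axial_has_derivative]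
    by (auto simp: differentiable_def)
  have pV: "partial_deriv j V x
      = w *\<^sub>R axial (axis j 1) + (- (w ^ 3) * (x $ 1 * axis j 1 $ 1 + x $ 2 * axis j 1 $ 2)) *\<^sub>R axial x" for j
    unfolding V_def partial_deriv_bilinear[OF bounded_bilinear_scaleR dw dX]
    by (simp add: partial_deriv_eq[OF weight_has_derivative[OF e]] partial_deriv_eq[OF axial_has_derivative] w_def)
  have pm: "partial_deriv j (multiplier \<epsilon> f) x = slash (V x) (partial_deriv j f x) + slash (partial_deriv j V x) (f x)" for j
    unfolding multiplier_def[abs_def] V_def[symmetric]
    by (rule partial_deriv_bilinear[OF bounded_bilinear_slash dV f])
  have ax: "axis 1 (1::real) $ (1::3) = 1" "axis 1 (1::real) $ (2::3) = 0" "axis 1 (1::real) $ (3::3) = 0"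
    "axis 2 (1::real) $ (1::3) = 0" "axis 2 (1::real) $ (2::3) = 1" "axis 2 (1::real) $ (3::3) = 0"
    "axis 3 (1::real) $ (1::3) = 0" "axis 3 (1::real) $ (2::3) = 0" "axis 3 (1::real) $ (3::3) = 1"
    by (simp_all add: axis_def)
  have m: "multiplier \<epsilon> g x = slash (w *\<^sub>R axial x) (g x)" for g by (simp add: multiplier_def w_def)
  have i: "\<i> * (\<i> * z) = - z" for z by (simp flip: mult.assoc)
  show ?thesis
    by (simp add: vec_eq_iff forall_2 dirac_components pm pV m A V_def w_def[symmetric] slash_def sum_3
        pauli_components ax generator_def excess_def planar_def scaleR_conv_of_real[where 'a = complex]
        algebra_simps i power2_eq_square power3_eq_cube)
qed

lemma excess_nonneg: "\<epsilon> > 0 \<Longrightarrow> excess \<epsilon> x \<ge> 0"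
  using weight_radius(2)[of \<epsilon> x] by (simp add: excess_eq)

lemma content_thin_box:
  assumes "\<delta> \<ge> 0" "R \<ge> 0"
  shows "measure lborel (cbox (vector [- \<delta>, - \<delta>, - R]) (vector [\<delta>, \<delta>, R]) :: (real^3) set) = 8 * \<delta>\<^sup>2 * R"
proof -
  define l u :: "real^3" where "l = vector [- \<delta>, - \<delta>, - R]" "u = vector [\<delta>, \<delta>, R]"
  have "0 \<in> cbox l u"
    using assms by (simp add: mem_box_cart forall_3 l_u_def)
  then have "cbox l u \<noteq> {}" by blast
  then have "measure lborel (cbox l u) = (\<Prod>i\<in>UNIV. u $ i - l $ i)" by (rule content_cbox_cart)
  also have "\<dots> = (u $ 1 - l $ 1) * ((u $ 2 - l $ 2) * (u $ 3 - l $ 3))"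
    unfolding UNIV_3 by simp
  also have "\<dots> = 8 * \<delta>\<^sup>2 * R"
    unfolding l_u_def vector_3 power2_eq_square by algebra
  finally show ?thesis by (simp only: l_u_def)
qed

text \<open>The excess is at most \<open>1 / \<epsilon>\<close> everywhere and at most \<open>\<epsilon>\<^sup>2 / \<delta>\<^sup>3\<close> at distance \<open>\<delta>\<close> or more from the axis.
The remaining part of the ball lies in a box of volume \<open>8 \<delta>\<^sup>2 R\<close>. Both contributions are of order
\<open>\<tau>\<close> for \<open>\<epsilon> = \<tau>\<^sup>5\<close> and \<open>\<delta> = \<tau>\<^sup>3\<close>.\<close>

lemma excess_integral_small:
  assumes R: "R > 0" and t: "0 < \<tau>" "\<tau> < 1"
  shows "(LINT x|lborel. indicator (cball 0 R) x * excess (\<tau> ^ 5) x)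
    \<le> (measure lborel (cball (0 :: real^3) R) + 8 * R) * \<tau>"
    and "integrable lborel (\<lambda>x. indicator (cball 0 R) x * excess (\<tau> ^ 5) x)"
proof -
  define \<epsilon> \<delta> where "\<epsilon> = \<tau> ^ 5" "\<delta> = \<tau> ^ 3"
  have pos: "\<epsilon> > 0" "\<delta> > 0" using t by (simp_all add: \<epsilon>_\<delta>_def)
  define Q :: "(real^3) set" where "Q = cbox (vector [- \<delta>, - \<delta>, - R]) (vector [\<delta>, \<delta>, R])"
  have le: "indicator (cball 0 R) x * excess \<epsilon> x \<le> \<tau> * indicator (cball 0 R) x + (1 / \<epsilon>) * indicator Q x" for x
  proof (cases "x \<in> cball 0 R")
    case True
    note w = weight_radius(2)[OF pos(1), of x]
    show ?thesis
    proof (cases "\<delta>\<^sup>2 \<le> planar x")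
      case far: True
      have "weight \<epsilon> x \<le> 1 / \<delta>" by (rule weight_le[OF pos]) (use far in \<open>simp add: add_increasing2\<close>)
      then have "excess \<epsilon> x \<le> \<epsilon>\<^sup>2 * (1 / \<delta>) ^ 3"
        unfolding excess_eq[OF pos(1)] using w by (intro mult_left_mono power_mono) auto
      also have "\<dots> = \<tau> ^ 10 / \<tau> ^ 9"
        by (simp add: \<epsilon>_\<delta>_def power_one_over divide_inverse power_inverse flip: power_mult)
      also have "\<dots> = \<tau>" using t by (simp add: eval_nat_numeral)
      finally show ?thesis using True pos by (auto simp: indicator_def add_increasing2)
    next
      case False
      have "weight \<epsilon> x \<le> 1 / \<epsilon>" by (rule weight_le[OF pos(1,1)]) (simp add: planar_nonneg)
      then have "excess \<epsilon> x \<le> \<epsilon>\<^sup>2 * (1 / \<epsilon>) ^ 3"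
        unfolding excess_eq[OF pos(1)] using w by (intro mult_left_mono power_mono) auto
      also have "\<dots> = 1 / \<epsilon>" using pos(1) by (simp add: field_simps power2_eq_square power3_eq_cube)
      finally have "excess \<epsilon> x \<le> 1 / \<epsilon>" .
      moreover have "x \<in> Q"
      proof -
        have "(x $ 1)\<^sup>2 \<le> \<delta>\<^sup>2" "(x $ 2)\<^sup>2 \<le> \<delta>\<^sup>2"
          using False zero_le_power2[of "x $ 1"] zero_le_power2[of "x $ 2"] unfolding planar_def by linarith+
        then have "\<bar>x $ 1\<bar> \<le> \<delta>" "\<bar>x $ 2\<bar> \<le> \<delta>" 
          using pos(2) by (auto intro!: power2_le_imp_le[of "\<bar>_\<bar>"])
        moreover have "\<bar>x $ 3\<bar> \<le> R" using True component_le_norm_cart[of x 3] by simp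
        ultimately show ?thesis by (simp add: Q_def mem_box_cart forall_3 abs_le_iff)
      qed
      ultimately show ?thesis using True t by (simp add: indicator_def)
    qed
  next
    case False
    then show ?thesis using pos by (simp add: indicator_def)
  qed
  have iQ: "integrable lborel (\<lambda>x. (1 / \<epsilon>) * indicator Q x :: real)"
    using borel_integrable_compact[of Q "\<lambda>x. 1 / \<epsilon>"] by (simp add: Q_def mult.commute)
  have iB: "integrable lborel (\<lambda>x::real^3. \<tau> * indicator (cball 0 R) x)" by (rule integrable_indicator_cball)
  have i: "integrable lborel (\<lambda>x. \<tau> * indicator (cball 0 R) x + (1 / \<epsilon>) * indicator Q x)"
    using iQ iB by (rule Bochner_Integration.integrable_add[rotated])
  have ce: "continuous_on UNIV (excess \<epsilon>)" unfolding excess_def[abs_def] planar_def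
    by (intro continuous_intros C_k_continuous[OF C1_weight[OF pos(1)]])
  then have [measurable]: "excess \<epsilon> \<in> borel_measurable borel" by (rule borel_measurable_continuous_onI)
  have ii: "integrable lborel (\<lambda>x. indicator (cball 0 R) x * excess \<epsilon> x)"
    using borel_integrable_compact[OF compact_cball continuous_on_subset[OF ce], of 0 R] by simp
  then show "integrable lborel (\<lambda>x. indicator (cball 0 R) x * excess (\<tau> ^ 5) x)"
    by (simp add: \<epsilon>_\<delta>_def)
  have "(LINT x|lborel. indicator (cball 0 R) x * excess \<epsilon> x)
      \<le> (LINT x|lborel. \<tau> * indicator (cball 0 R) x + (1 / \<epsilon>) * indicator Q x)"
    by (intro integral_mono ii i le)
  also have "\<dots> = \<tau> * measure lborel (cball (0 :: real^3) R) + (1 / \<epsilon>) * measure lborel Q"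
    using iQ iB by simp
  also have "measure lborel Q = 8 * \<delta>\<^sup>2 * R"
    unfolding Q_def using pos R by (intro content_thin_box) auto
  also have "(1 / \<epsilon>) * (8 * \<delta>\<^sup>2 * R) = 8 * R * \<tau>"
  proof -
    have "(1 / \<epsilon>) * (8 * \<delta>\<^sup>2 * R) = 8 * R * (\<tau> ^ 6 / \<tau> ^ 5)"
      by (simp add: \<epsilon>_\<delta>_def flip: power_mult)
    also have "\<tau> ^ 6 / \<tau> ^ 5 = \<tau>" using t by (simp add: eval_nat_numeral)
    finally show ?thesis .
  qed
  finally show "(LINT x|lborel. indicator (cball 0 R) x * excess (\<tau> ^ 5) x)
    \<le> (measure lborel (cball (0 :: real^3) R) + 8 * R) * \<tau>"
    by (simp add: \<epsilon>_\<delta>_def algebra_simps)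
qed

lemma vec2_axis: "(a::complex^2) = axis 1 (a $ 1) + axis 2 (a $ 2)"
  by (simp add: vec_eq_iff forall_2 axis_def)

lemma vec3_axis: "(x::real^3) = axis 1 (x $ 1) + axis 2 (x $ 2) + axis 3 (x $ 3)"
  by (simp add: vec_eq_iff forall_3 axis_def)

lemma continuous_on_spin:
  assumes "continuous_on S g" "continuous_on S h"
  shows "continuous_on S (\<lambda>p. spin (g p) (h p))"
  by (subst vec2_axis, unfold spin_components)
    (intro continuous_intros bounded_linear.continuous_on[OF bounded_linear_axis] assms, auto)

lemma continuous_on_rot_pair:
  fixes g :: "'p::t2_space \<Rightarrow> real"
  assumes "continuous_on S g" "continuous_on S h"
  shows "continuous_on S (\<lambda>p. rot (g p) (h p))"
  by (subst vec3_axis, unfold rot_components)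
    (intro continuous_intros bounded_linear.continuous_on[OF bounded_linear_axis] assms)

lemma continuous_on_generator:
  assumes "C_k 1 f"
  shows "continuous_on UNIV (generator f)"
  unfolding generator_def[abs_def] using assms C_k_continuous[OF assms]
  by (intro continuous_intros bounded_linear.continuous_on[OF bounded_linear_smult]
      bounded_linear.continuous_on[OF bounded_linear_pauli]) auto

lemma lborel_integral_cbox:
  fixes g :: "real^3 \<Rightarrow> complex"
  assumes "continuous_on UNIV g" "\<And>x. norm x > R \<Longrightarrow> g x = 0" "cball 0 R \<subseteq> cbox a b"
  shows "(LINT x|lborel. g x) = integral (cbox a b) g"
proof -
  have "(g has_integral (LINT x|lborel. g x)) UNIV"
    by (rule has_integral_integral_lborel[OF integrable_compact_support[OF assms(1,2)]])
  moreover have "g = (\<lambda>x. if x \<in> cbox a b then g x else 0)"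
  proof
    fix x show "g x = (if x \<in> cbox a b then g x else 0)"
      using assms(2)[of x] assms(3) by (auto simp: subset_iff not_le[symmetric])
  qed
  ultimately have "(g has_integral (LINT x|lborel. g x)) (cbox a b)"
    using has_integral_restrict_UNIV[of "cbox a b" g] by metis
  then show ?thesis by (simp add: integral_unique)
qed

text \<open>Everything is supported in a fixed box, so differentiation under the integral only needs the joint
continuity of the derivative in angle and position.\<close>

lemma pairing_has_vector_derivative:
  assumes e: "\<epsilon> > 0" and f: "C_k 1 f" "\<And>x. norm x > R \<Longrightarrow> f x = 0"
  shows "((\<lambda>\<theta>. LINT x|lborel. weight \<epsilon> x *\<^sub>R sdot (f x) (rotated \<theta> f x)) has_vector_derivative
      (LINT x|lborel. weight \<epsilon> x *\<^sub>R sdot (f x) (generator (rotated \<theta> f) x))) (at \<theta>)"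
proof -
  have df: "f differentiable (at x)" for x using f by simp
  have cf: "continuous_on UNIV f" and cw: "continuous_on UNIV (weight \<epsilon>)"
    using C_k_continuous f C1_weight[OF e] by blast+
  obtain a b where ab: "cball (0 :: real^3) R \<subseteq> cbox a b"
    using bounded_subset_cbox_symmetric[OF bounded_cball] by metis
  have cr: "continuous_on UNIV (rotated \<theta> f)" for \<theta> using C_k_continuous[OF C1_rotated[OF f(1)]] .
  define G where "G \<theta> x = weight \<epsilon> x *\<^sub>R sdot (f x) (rotated \<theta> f x)" for \<theta> x
  define G' where "G' \<theta> x = weight \<epsilon> x *\<^sub>R sdot (f x) (spin \<theta> (generator f (rot \<theta> x)))" for \<theta> x
  have G'_eq: "G' \<theta> x = weight \<epsilon> x *\<^sub>R sdot (f x) (generator (rotated \<theta> f) x)" for \<theta> x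
    by (simp add: G'_def generator_rotated[OF df])
  have z: "G \<theta> x = 0" "G' \<theta> x = 0" if "norm x > R" for \<theta> x
    using f(2)[OF that] by (simp_all add: G_def G'_def sdot_def)
  have cG: "continuous_on UNIV (G \<theta>)" for \<theta>
    unfolding G_def[abs_def]
    by (intro continuous_intros bounded_bilinear.continuous_on[OF bounded_bilinear_sdot] cw cf cr)
  have cG2: "continuous_on UNIV (\<lambda>p. G' (fst p) (snd p))"
    unfolding G'_def
    by (intro continuous_intros bounded_bilinear.continuous_on[OF bounded_bilinear_sdot]
        continuous_on_spin continuous_on_compose2[OF cw] continuous_on_compose2[OF cf]
        continuous_on_compose2[OF continuous_on_generator[OF f(1)]] continuous_on_rot_pair) auto
  have cG': "continuous_on UNIV (G' \<theta>)" for \<theta>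
    using continuous_on_compose2[OF cG2, of UNIV "\<lambda>x. (\<theta>, x)"] by (simp add: continuous_on_Pair)
  have "((\<lambda>\<theta>. integral (cbox a b) (G \<theta>)) has_vector_derivative integral (cbox a b) (G' \<theta>)) (at \<theta> within UNIV)"
  proof (rule leibniz_rule_vector_derivative)
    show "((\<lambda>\<theta>. G \<theta> x) has_vector_derivative G' \<theta> x) (at \<theta> within UNIV)" for \<theta> x
      unfolding G_def G'_def
      by (intro bounded_linear.has_vector_derivative[OF bounded_linear_scaleR_right]
          bounded_linear.has_vector_derivative[OF bounded_bilinear.bounded_linear_right[OF bounded_bilinear_sdot]]
          rotated_has_vector_derivative df)
    show "G \<theta> integrable_on cbox a b" for \<theta>
      by (intro integrable_continuous continuous_on_subset[OF cG]) simp
    show "continuous_on (UNIV \<times> cbox a b) (\<lambda>(\<theta>, x). G' \<theta> x)"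
      unfolding case_prod_beta by (rule continuous_on_subset[OF cG2]) simp
  qed auto
  moreover have "integral (cbox a b) (G \<theta>) = (LINT x|lborel. weight \<epsilon> x *\<^sub>R sdot (f x) (rotated \<theta> f x))" for \<theta>
    using lborel_integral_cbox[OF cG z(1) ab, of \<theta>] by (simp add: G_def[abs_def])
  moreover have "integral (cbox a b) (G' \<theta>)
      = (LINT x|lborel. weight \<epsilon> x *\<^sub>R sdot (f x) (generator (rotated \<theta> f) x))"
    using lborel_integral_cbox[OF cG' z(2) ab, of \<theta>] by (simp add: G'_eq[abs_def])
  ultimately show ?thesis by simp
qed

text \<open>The Dirac expression is symmetric, so both inner products pair \<open>f\<close> with an image of \<open>v\<close>, and the two
  images add up to the anticommutator.\<close>

lemma pairing_identity:
  assumes e: "\<epsilon> > 0" and f: "C_k 1 f" "\<And>x. norm x > R \<Longrightarrow> f x = 0"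
    and v: "C_k 1 v" "\<And>x. norm x > R \<Longrightarrow> v x = 0"
    and A: "continuous_on UNIV A" "\<And>x. A x $ 1 = 0" "\<And>x. A x $ 2 = 0"
  shows "2 * \<i> * (LINT x|lborel. weight \<epsilon> x *\<^sub>R sdot (f x) (generator v x))
    = L2_inner (dirac A f) (multiplier \<epsilon> v) + L2_inner f (multiplier \<epsilon> (dirac A v))
      - (LINT x|lborel. excess \<epsilon> x *\<^sub>R sdot (f x) (pauli 3 *v v x))"
proof -
  have dv: "v differentiable (at x)" for x using v by simp
  have cf: "continuous_on UNIV f" and cv: "continuous_on UNIV v" and cw: "continuous_on UNIV (weight \<epsilon>)"
    using C_k_continuous f v C1_weight[OF e] by blast+
  have m0: "multiplier \<epsilon> v x = 0" if "norm x > R" for x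
    using v(2)[OF that] by (simp add: multiplier_def slash_def)
  have fL: "f \<in> L2" and DvL: "dirac A v \<in> L2" and DmL: "dirac A (multiplier \<epsilon> v) \<in> L2"
    using L2_continuous_compact_support[OF cf f(2)] dirac_L2[OF v A(1)]
      dirac_L2[OF C1_multiplier[OF e v(1)] m0 A(1)] by auto
  have mDL: "multiplier \<epsilon> (dirac A v) \<in> L2"
    by (rule multiplier_L2(1)[OF e DvL continuous_on_dirac[OF v(1) A(1)]])
  have ie: "integrable lborel (\<lambda>x. excess \<epsilon> x *\<^sub>R sdot (f x) (pauli 3 *v v x))"
  proof (rule integrable_compact_support[where R = R])
    show "continuous_on UNIV (\<lambda>x. excess \<epsilon> x *\<^sub>R sdot (f x) (pauli 3 *v v x))"
      unfolding excess_def planar_def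
      by (intro continuous_intros bounded_bilinear.continuous_on[OF bounded_bilinear_sdot]
          bounded_linear.continuous_on[OF bounded_linear_pauli] cf cv cw)
  qed (use f in \<open>simp add: sdot_def\<close>)
  have anti: "dirac A (multiplier \<epsilon> v) x + multiplier \<epsilon> (dirac A v) x
      = (2 * weight \<epsilon> x) *\<^sub>R (\<i> *s generator v x) + excess \<epsilon> x *\<^sub>R (pauli 3 *v v x)" for x
    by (rule anticommutator[OF e dv]) (rule A)+
  have "L2_inner (dirac A f) (multiplier \<epsilon> v) + L2_inner f (multiplier \<epsilon> (dirac A v))
      = L2_inner f (dirac A (multiplier \<epsilon> v)) + L2_inner f (multiplier \<epsilon> (dirac A v))"
    using dirac_symmetric[OF f C1_multiplier[OF e v(1)] m0 A(1)] by simp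
  also have "\<dots> = (LINT x|lborel. sdot (f x) (dirac A (multiplier \<epsilon> v) x + multiplier \<epsilon> (dirac A v) x))"
    unfolding L2_inner_sdot sdot_add_right
    using integrable_sdot[OF fL DmL] integrable_sdot[OF fL mDL] by simp
  finally have "L2_inner (dirac A f) (multiplier \<epsilon> v) + L2_inner f (multiplier \<epsilon> (dirac A v))
      - (LINT x|lborel. excess \<epsilon> x *\<^sub>R sdot (f x) (pauli 3 *v v x))
    = (LINT x|lborel. sdot (f x) (dirac A (multiplier \<epsilon> v) x + multiplier \<epsilon> (dirac A v) x)
      - excess \<epsilon> x *\<^sub>R sdot (f x) (pauli 3 *v v x))"
    using ie integrable_sdot[OF fL L2_add[OF DmL mDL]] by simp
  also have "\<dots> = (LINT x|lborel. 2 * \<i> * (weight \<epsilon> x *\<^sub>R sdot (f x) (generator v x)))"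
    unfolding anti
    by (intro Bochner_Integration.integral_cong)
      (simp_all add: sdot_add_right sdot_scaleR_right sdot_smult_right scaleR_conv_of_real[where 'a = complex])
  also have "\<dots> = 2 * \<i> * (LINT x|lborel. weight \<epsilon> x *\<^sub>R sdot (f x) (generator v x))"
    by (rule integral_mult_right_zero)
  finally show ?thesis by simp
qed

lemma excess_pairing_bound:
  assumes e: "\<epsilon> > 0" and f: "\<And>x. norm x > R \<Longrightarrow> f x = 0"
    and B: "\<And>x. norm (f x) \<le> B" "\<And>x. norm (v x) \<le> B"
    and i: "integrable lborel (\<lambda>x. indicator (cball 0 R) x * excess \<epsilon> x)"
  shows "norm (LINT x|lborel. excess \<epsilon> x *\<^sub>R sdot (f x) (pauli 3 *v v x))
    \<le> B\<^sup>2 * (LINT x|lborel. indicator (cball 0 R) x * excess \<epsilon> x)"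
proof -
  have "norm (excess \<epsilon> x *\<^sub>R sdot (f x) (pauli 3 *v v x)) \<le> B\<^sup>2 * (indicator (cball 0 R) x * excess \<epsilon> x)" for x
  proof (cases "norm x > R")
    case True
    then show ?thesis using f by (simp add: sdot_def)
  next
    case False
    have "norm (sdot (f x) (pauli 3 *v v x)) \<le> norm (f x) * norm (v x)"
      using norm_sdot_le[of "f x" "pauli 3 *v v x"] by (simp add: norm_pauli)
    also have "\<dots> \<le> B * B" using B(1)[of x] order_trans[OF norm_ge_zero B(1)[of x]] by (intro mult_mono B) auto
    finally have "excess \<epsilon> x * norm (sdot (f x) (pauli 3 *v v x)) \<le> excess \<epsilon> x * (B * B)"
      by (intro mult_left_mono excess_nonneg e)
    then show ?thesis using False excess_nonneg[OF e, of x] by (simp add: power2_eq_square mult.commute)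
  qed
  then have "(LINT x|lborel. norm (excess \<epsilon> x *\<^sub>R sdot (f x) (pauli 3 *v v x)))
      \<le> (LINT x|lborel. B\<^sup>2 * (indicator (cball 0 R) x * excess \<epsilon> x))"
    by (intro integral_mono') (use i excess_nonneg[OF e] in auto)
  then show ?thesis by (simp add: order_trans[OF integral_norm_bound])
qed

lemma le_of_linear_error:
  fixes X Y K :: real
  assumes "\<And>\<tau>. 0 < \<tau> \<Longrightarrow> \<tau> < 1 \<Longrightarrow> X \<le> Y + K * \<tau>"
  shows "X \<le> Y"
proof (rule LIMSEQ_le_const)
  have "(\<lambda>n. Y + K * inverse (real (Suc n))) \<longlonglongrightarrow> Y + K * 0"
    by (intro tendsto_intros LIMSEQ_inverse_real_of_nat)
  then show "(\<lambda>n. Y + K * inverse (real (Suc n))) \<longlonglongrightarrow> Y" by simp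
  show "\<exists>N. \<forall>n\<ge>N. X \<le> Y + K * inverse (real (Suc n))"
    by (intro exI[of _ 1] allI impI assms) (auto simp: field_simps)
qed

text \<open>The pairing of \<open>f\<close> with its rotation by \<open>\<theta>\<close>, weighted by the regularised reciprocal distance, changes
sign over a full turn. Its initial value is therefore at most half its total variation, and the
derivative is controlled by the anticommutator: rotated fields have the same norms as \<open>f\<close> and
\<open>dirac A f\<close>, and the multiplier is bounded.\<close>

theorem axial_lower_bound:
  assumes f: "f \<in> Cc_infinity" and A: "continuous_on UNIV A"
    and ax: "\<And>x. A x $ 1 = 0" "\<And>x. A x $ 2 = 0" "\<And>\<theta> x. A (rot \<theta> x) = A x"
  shows "(LINT x|lborel. weight 1 x * (norm (f x))\<^sup>2) \<le> 3 * pi * (L2_norm f * L2_norm (dirac A f))"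
proof -
  obtain R where R: "R > 0" "smooth f" "\<And>x. norm x > R \<Longrightarrow> f x = 0" using Cc_infinityE[OF f] by metis
  have f1: "C_k 1 f" using smooth_C_k[OF R(2)] .
  have df: "f differentiable (at x)" for x using f1 by simp
  have cf: "continuous_on UNIV f" by (rule smooth_continuous[OF R(2)])
  obtain B where B: "B > 0" "\<And>x. norm (f x) \<le> B" using compact_support_bounded[OF cf R(3)] by blast
  have fL: "f \<in> L2" and DL: "dirac A f \<in> L2"
    using L2_continuous_compact_support[OF cf R(3)] dirac_L2[OF f1 R(3) A] by auto
  define P where "P = L2_norm f * L2_norm (dirac A f)"
  define K where "K = measure lborel (cball (0 :: real^3) R) + 8 * R"
  have "(LINT x|lborel. weight 1 x * (norm (f x))\<^sup>2) \<le> 3 * pi * P + (pi / 2 * B\<^sup>2 * K) * \<tau>"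
    if t: "0 < \<tau>" "\<tau> < 1" for \<tau>
  proof -
    define \<epsilon> where "\<epsilon> = \<tau> ^ 5"
    have e: "\<epsilon> > 0" "\<epsilon> \<le> 1" using t by (auto simp: \<epsilon>_def power_le_one)
    have cw: "continuous_on UNIV (weight \<epsilon>)" "continuous_on UNIV (weight 1)"
      by (intro C_k_continuous[OF C1_weight] e zero_less_one)+
    define F where "F \<theta> = (LINT x|lborel. weight \<epsilon> x *\<^sub>R sdot (f x) (rotated \<theta> f x))" for \<theta>
    define F' where "F' \<theta> = (LINT x|lborel. weight \<epsilon> x *\<^sub>R sdot (f x) (generator (rotated \<theta> f) x))" for \<theta>
    have FF': "(F has_vector_derivative F' \<theta>) (at \<theta>)" for \<theta>
      unfolding F_def[abs_def] F'_def by (rule pairing_has_vector_derivative[OF e(1) f1 R(3)])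
    let ?M = "3 * P + B\<^sup>2 * (K * \<tau>) / 2"
    have F'_bound: "norm (F' \<theta>) \<le> ?M" for \<theta>
    proof -
      define v where "v = rotated \<theta> f"
      have v1: "C_k 1 v" unfolding v_def by (rule C1_rotated[OF f1])
      have v0: "v x = 0" if "norm x > R" for x
      proof -
        have "f (rot \<theta> x) = 0" by (rule R(3)) (use that in \<open>simp add: norm_rot\<close>)
        then show ?thesis by (simp add: v_def rotated_def vec_eq_iff forall_2)
      qed
      have vB: "norm (v x) \<le> B" for x using B(2) by (simp add: v_def rotated_def norm_spin)
      have Dv: "dirac A v = (\<lambda>x. spin \<theta> (dirac A f (rot \<theta> x)))"
        unfolding v_def by (intro ext dirac_rotated df ax)
      have vL: "v \<in> L2" "L2_norm v = L2_norm f"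
        using L2_rotate[OF fL, of \<theta>] by (simp_all add: v_def rotated_def[abs_def])
      have DvL: "dirac A v \<in> L2" "L2_norm (dirac A v) = L2_norm (dirac A f)"
        unfolding Dv by (rule L2_rotate[OF DL])+
      note mv = multiplier_L2[OF e(1) vL(1) C_k_continuous[OF v1]]
      note mDv = multiplier_L2[OF e(1) DvL(1) continuous_on_dirac[OF v1 A]]
      have "norm (L2_inner (dirac A f) (multiplier \<epsilon> v)) \<le> L2_norm (dirac A f) * (3 * L2_norm f)"
        by (rule order_trans[OF norm_L2_inner_le[OF DL mv(1)]])
          (use mv(2) vL(2) L2_norm_nonneg in \<open>intro mult_left_mono, auto\<close>)
      then have 1: "norm (L2_inner (dirac A f) (multiplier \<epsilon> v)) \<le> 3 * P" by (simp add: P_def mult_ac)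
      have "norm (L2_inner f (multiplier \<epsilon> (dirac A v))) \<le> L2_norm f * (3 * L2_norm (dirac A f))"
        by (rule order_trans[OF norm_L2_inner_le[OF fL mDv(1)]])
          (use mDv(2) DvL(2) L2_norm_nonneg in \<open>intro mult_left_mono, auto\<close>)
      then have 2: "norm (L2_inner f (multiplier \<epsilon> (dirac A v))) \<le> 3 * P" by (simp add: P_def mult_ac)
      let ?E = "LINT x|lborel. excess \<epsilon> x *\<^sub>R sdot (f x) (pauli 3 *v v x)"
      have "norm ?E \<le> B\<^sup>2 * (LINT x|lborel. indicator (cball 0 R) x * excess \<epsilon> x)"
        unfolding \<epsilon>_def
        by (intro excess_pairing_bound R(3) B(2) vB excess_integral_small(2) R(1) t) (use t in simp_all)
      also have "\<dots> \<le> B\<^sup>2 * (K * \<tau>)"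
        unfolding \<epsilon>_def K_def by (intro mult_left_mono excess_integral_small(1) R(1) t) simp
      finally have 3: "norm ?E \<le> B\<^sup>2 * (K * \<tau>)" .
      have "2 * norm (F' \<theta>) = norm (2 * \<i> * F' \<theta>)" by (simp add: norm_mult)
      also have "2 * \<i> * F' \<theta> = L2_inner (dirac A f) (multiplier \<epsilon> v) + L2_inner f (multiplier \<epsilon> (dirac A v)) - ?E"
        unfolding F'_def v_def[symmetric] by (rule pairing_identity[OF e(1) f1 R(3) v1 v0 A ax(1,2)])
      also have "norm \<dots> \<le> (3 * P + 3 * P) + B\<^sup>2 * (K * \<tau>)"
        by (rule order_trans[OF norm_triangle_ineq4], intro add_mono 3,
            rule order_trans[OF norm_triangle_ineq], intro add_mono 1 2)
      finally show ?thesis by simp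
    qed
    define I where "I = (LINT x|lborel. weight \<epsilon> x * (norm (f x))\<^sup>2)"
    have F0: "F 0 = of_real I"
      unfolding F_def I_def rotated_zero sdot_self scaleR_conv_of_real of_real_mult[symmetric]
      by (rule integral_complex_of_real)
    \<comment> \<open>A spinor changes its sign under a full turn.\<close>
    have F2: "F (2 * pi) = - F 0"
      unfolding F_def rotated_zero rotated_full_turn
      by (simp add: bounded_bilinear.minus_right[OF bounded_bilinear_sdot])
    have I0: "I \<ge> 0" unfolding I_def using weight_radius(2)[OF e(1)]
      by (intro integral_nonneg_AE) (simp add: less_imp_le)
    have "norm (F (2 * pi) - F 0) \<le> ?M * norm (2 * pi - 0)"
    proof (rule differentiable_bound[of UNIV F "\<lambda>\<theta> h. h *\<^sub>R F' \<theta>"])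
      show "(F has_derivative (\<lambda>h. h *\<^sub>R F' \<theta>)) (at \<theta> within UNIV)" for \<theta>
        using FF' by (simp add: has_vector_derivative_def)
      show "onorm (\<lambda>h. h *\<^sub>R F' \<theta>) \<le> ?M" for \<theta>
        by (rule onorm_le) (use F'_bound[of \<theta>] in \<open>simp add: mult.commute mult_left_mono\<close>)
    qed auto
    \<comment> \<open>The sign change makes the increment over a full turn twice the initial value.\<close>
    moreover have "norm (F (2 * pi) - F 0) = 2 * I"
      using I0 by (simp add: F2 F0 flip: of_real_minus of_real_diff)
    ultimately have "2 * I \<le> ?M * (2 * pi)" by simp
    then have I_le: "I \<le> 3 * pi * P + (pi / 2 * B\<^sup>2 * K) * \<tau>" by (simp add: algebra_simps)
    have "(LINT x|lborel. weight 1 x * (norm (f x))\<^sup>2) \<le> I"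
      unfolding I_def
    proof (rule integral_mono)
      show "integrable lborel (\<lambda>x. weight 1 x * (norm (f x))\<^sup>2)" "integrable lborel (\<lambda>x. weight \<epsilon> x * (norm (f x))\<^sup>2)"
        by (rule integrable_compact_support[where R = R]; (intro continuous_intros cw cf)?; simp add: R(3))+
      fix x
      have "\<epsilon>\<^sup>2 \<le> 1" using e by (simp add: power_le_one)
      then have "weight 1 x \<le> weight \<epsilon> x"
        using weight_radius(1)[OF e(1), of x] by (simp add: weight_def le_imp_inverse_le)
      then show "weight 1 x * (norm (f x))\<^sup>2 \<le> weight \<epsilon> x * (norm (f x))\<^sup>2"
        by (rule mult_right_mono) simp
    qed
    with I_le show ?thesis by linarith
  qed
  then show ?thesis unfolding P_def by (rule le_of_linear_error)
qed

section \<open>Axial potentials have no zero modes\<close>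

text \<open>A zero mode \<open>\<psi>\<close> is a limit of test fields whose images under the Dirac expression tend to zero, and the
lower bound then gives \<open>\<psi>\<close> a vanishing integral against a positive weight.\<close>

theorem no_zero_mode_axial:
  assumes A: "A \<in> Cc_infinity" and ax: "\<And>x. A x $ 1 = 0" "\<And>x. A x $ 2 = 0" "\<And>\<theta> x. A (rot \<theta> x) = A x"
  shows "\<not> zero_mode (weyl_dirac A) \<psi>"
proof
  assume "zero_mode (weyl_dirac A) \<psi>"
  then have \<psi>: "\<psi> \<in> L2" and ne: "\<not> (AE x in lborel. \<psi> x = 0)"
    and adj: "(\<psi>, \<lambda>x. 0) \<in> op_adjoint (weyl_dirac_min A)"
    by (auto simp: zero_mode_def weyl_dirac_eq_adjoint[OF A])
  have cA: "continuous_on UNIV A" using A smooth_continuous by (auto simp: Cc_infinity_def)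
  note [measurable] = L2_measurable[OF \<psi>]
  have [measurable]: "weight 1 \<in> borel_measurable borel"
    by (intro borel_measurable_continuous_onI C_k_continuous[OF C1_weight]) simp
  have w1: "0 < weight 1 x" "weight 1 x \<le> 1" for x
    using weight_radius(2)[of 1 x] weight_le[of 1 1 x] by (simp_all add: planar_nonneg)
  have iw: "integrable lborel (\<lambda>x. weight 1 x * (norm (g x))\<^sup>2)" if g: "g \<in> L2" for g
  proof (rule Bochner_Integration.integrable_bound[OF L2_integrable[OF g]])
    note [measurable] = L2_measurable[OF g]
    show "(\<lambda>x. weight 1 x * (norm (g x))\<^sup>2) \<in> borel_measurable lborel" by measurable
    show "AE x in lborel. norm (weight 1 x * (norm (g x))\<^sup>2) \<le> norm ((norm (g x))\<^sup>2)"
      using w1 by (simp add: abs_mult less_imp_le mult_left_le_one_le)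
  qed
  define I where "I = (LINT x|lborel. weight 1 x * (norm (\<psi> x))\<^sup>2)"
  have "I \<le> 0 + (6 * pi * (L2_norm \<psi> + 1) + 2) * e" if e: "0 < e" "e < 1" for e
  proof -
    obtain \<phi> where \<phi>: "\<phi> \<in> Cc_infinity" "L2_norm (\<lambda>x. \<psi> x - \<phi> x) < e" "L2_norm (\<lambda>x. 0 - dirac A \<phi> x) < e"
      using graph_approximation[OF A adj e(1)] by blast
    note \<phi>L = Cc_infinity_L2[OF \<phi>(1)]
    have D: "L2_norm (dirac A \<phi>) < e" using \<phi>(3) by (simp add: L2_norm_def)
    have "L2_norm \<phi> \<le> L2_norm \<psi> + 1"
      using L2_norm_triangle[OF \<psi> L2_diff[OF \<phi>L \<psi>]] \<phi>(2) e
      by (simp add: L2_norm_diff_commute[of \<phi> \<psi>])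
    then have PD: "L2_norm \<phi> * L2_norm (dirac A \<phi>) \<le> (L2_norm \<psi> + 1) * e"
      using D L2_norm_nonneg[of \<psi>] L2_norm_nonneg[of "dirac A \<phi>"] by (intro mult_mono) auto
    have "I \<le> (LINT x|lborel. 2 * (weight 1 x * (norm (\<phi> x))\<^sup>2) + 2 * (norm (\<psi> x - \<phi> x))\<^sup>2)"
      unfolding I_def
    proof (rule integral_mono)
      show "integrable lborel (\<lambda>x. 2 * (weight 1 x * (norm (\<phi> x))\<^sup>2) + 2 * (norm (\<psi> x - \<phi> x))\<^sup>2)"
        using iw[OF \<phi>L] L2_integrable[OF L2_diff[OF \<psi> \<phi>L]] by simp
      fix x
      have "(norm (\<psi> x))\<^sup>2 \<le> 2 * (norm (\<phi> x))\<^sup>2 + 2 * (norm (\<psi> x - \<phi> x))\<^sup>2"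
        using norm_add_sq_le[of "\<phi> x" "\<psi> x - \<phi> x"] by simp
      then have "weight 1 x * (norm (\<psi> x))\<^sup>2 \<le> weight 1 x * (2 * (norm (\<phi> x))\<^sup>2 + 2 * (norm (\<psi> x - \<phi> x))\<^sup>2)"
        using w1(1)[of x] by (intro mult_left_mono) auto
      also have "\<dots> = 2 * (weight 1 x * (norm (\<phi> x))\<^sup>2) + weight 1 x * (2 * (norm (\<psi> x - \<phi> x))\<^sup>2)"
        by (simp add: algebra_simps)
      also have "weight 1 x * (2 * (norm (\<psi> x - \<phi> x))\<^sup>2) \<le> 2 * (norm (\<psi> x - \<phi> x))\<^sup>2"
        using w1[of x] by (intro mult_left_le_one_le) auto
      finally show "weight 1 x * (norm (\<psi> x))\<^sup>2 \<le> 2 * (weight 1 x * (norm (\<phi> x))\<^sup>2) + 2 * (norm (\<psi> x - \<phi> x))\<^sup>2"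
        by simp
    qed (rule iw[OF \<psi>])
    also have "\<dots> = 2 * (LINT x|lborel. weight 1 x * (norm (\<phi> x))\<^sup>2) + 2 * (L2_norm (\<lambda>x. \<psi> x - \<phi> x))\<^sup>2"
      using iw[OF \<phi>L] L2_integrable[OF L2_diff[OF \<psi> \<phi>L]] by (simp add: L2_norm_square)
    also have "\<dots> \<le> 2 * (3 * pi * ((L2_norm \<psi> + 1) * e)) + 2 * e"
    proof (intro add_mono mult_left_mono)
      show "(LINT x|lborel. weight 1 x * (norm (\<phi> x))\<^sup>2) \<le> 3 * pi * ((L2_norm \<psi> + 1) * e)"
        by (rule order_trans[OF axial_lower_bound[OF \<phi>(1) cA ax]]) (use PD in \<open>intro mult_left_mono, auto\<close>)
      have "(L2_norm (\<lambda>x. \<psi> x - \<phi> x))\<^sup>2 \<le> e * 1"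
        unfolding power2_eq_square using \<phi>(2) e L2_norm_nonneg by (intro mult_mono) auto
      then show "(L2_norm (\<lambda>x. \<psi> x - \<phi> x))\<^sup>2 \<le> e" by simp
    qed auto
    finally show ?thesis by (simp add: algebra_simps)
  qed
  then have "I \<le> 0" by (rule le_of_linear_error)
  moreover have "I \<ge> 0" unfolding I_def using w1 by (intro integral_nonneg_AE) (simp add: less_imp_le)
  ultimately have "I = 0" by simp
  then have "AE x in lborel. weight 1 x * (norm (\<psi> x))\<^sup>2 = 0"
    unfolding I_def using integral_nonneg_eq_0_iff_AE[OF iw[OF \<psi>]] w1 by (simp add: less_imp_le)
  then have "AE x in lborel. \<psi> x = 0"
    by eventually_elim (use w1(1) in \<open>simp add: less_imp_neq[symmetric]\<close>)
  with ne show False ..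
qed

theorem corollary1p2:
  shows "\<exists>A :: real^3 \<Rightarrow> real^3. A \<in> Cc_infinity \<and> (\<exists>x. curl A x \<noteq> 0) \<and>
    (\<forall>t::real. \<nexists>\<psi>. zero_mode (weyl_dirac (\<lambda>x. t *\<^sub>R A x)) \<psi>)"
proof -
  define A :: "real^3 \<Rightarrow> real^3" where "A x = bump 1 1 x *\<^sub>R axis 3 1" for x
  have const: "smooth (\<lambda>x::real^3. c)" for c :: "'b::real_normed_vector"
    by (simp add: smooth_def C_k_const)
  have A: "A \<in> Cc_infinity" unfolding A_def[abs_def]
    by (rule Cc_infinity_scaleR_left[OF bump_Cc_infinity const]) simp
  \<comment> \<open>Inside the unit ball and off the axis the radial function has a nonzero gradient; here it
    points along the second axis, so the first component of the curl does not vanish.\<close>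
  define p :: "real^3" where "p = axis 2 (1 / 2)"
  have p: "p \<bullet> p = 1 / 4" "p $ 2 = 1 / 2" by (simp_all add: p_def inner_3 axis_def)
  have "(\<lambda>y. A y $ 3) = bump 1 1" "(\<lambda>y. A y $ 2) = (\<lambda>y. 0)"
    by (auto simp: A_def axis_def)
  then have "curl A p $ 1 = bump_profile 2 (3 / 4) * (- 1)"
    by (simp add: curl_def partial_deriv_bump partial_deriv_const p)
  moreover have "bump_profile 2 (3 / 4) > 0" by (rule bump_profile_pos) simp
  ultimately have "curl A p \<noteq> 0" by auto
  moreover have "\<not> zero_mode (weyl_dirac (\<lambda>x. t *\<^sub>R A x)) \<psi>" for t \<psi>
  proof (rule no_zero_mode_axial)
    show "(\<lambda>x. t *\<^sub>R A x) \<in> Cc_infinity" by (rule Cc_infinity_scaleR_right[OF const A])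
    show "t *\<^sub>R A (rot \<theta> x) = t *\<^sub>R A x" for \<theta> x by (simp add: A_def bump_def rot_inner_self)
  qed (simp_all add: A_def axis_def)
  ultimately show ?thesis using A by blast
qed

end
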